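(* Let $ZW_2 = \mathbf{Z}\wr(\mathbf{Z}\times\mathbf{Z})$ be the standard restricted wreath product, and let $PL(S^1)$ be the group of all piecewise-linear self-homeomorphisms of the circle under composition. Then $ZW_2$ does not embed in $PL(S^1)$; that is, there is no injective group homomorphism $ZW_2\to PL(S^1)$.
   Context: The standard restricted wreath product $C\wr T$ of groups $C$ (bottom group) and $T$ (top group) is the semidirect product $B\rtimes T$, where $B=\bigoplus_{t\in T}C$ (the base group), with multiplication $((a_t)_{t\in T},r)\cdot((b_t)_{t\in T},s)=((c_t)_{t\in T},rs)$, where $c_t=a_t\,b_{t\cdot r}$ for each $t\in T$. $PL(S^1)$: let $S^1_p$ be a polyhedron in $\mathbf{R}^2$ homeomorphic to the circle $S^1$, such that $\mathbf{R}^2$ admits a line of reflective symmetry for $S^1_p$, realizing $S^1_p$ as the union of two piecewise-linear homeomorphic images of a polyhedron $I^1_p\subset\mathbf{R}$ homeomorphic to the interval $I=[0,1]$, identified along their common boundary, where one image is the reflection of the other across the line and the common boundary lies in the line. $PL(S^1)$ is the subgroup of $\mathrm{Homeo}(S^1)$, the full group of self-homeomorphisms of $S^1_p$ under composition, consisting of the piecewise-linear self-homeomorphisms (orientation-preserving or not). *)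

theory Defs
  imports
    "HOL-Analysis.Analysis"
    "HOL-Algebra.Bij"
    "HOL-Algebra.Elementary_Groups"
    "HOL-Algebra.Product_Groups"
begin

section \<open>Restricted wreath products\<close>

text \<open>The base group is the library's restricted direct product \<^const>\<open>sum_group\<close>; its
  elements are extensional functions on the carrier of the top group with finite support.\<close>

definition restricted_wreath ::
    "('c, 'm) monoid_scheme \<Rightarrow> ('t, 'n) monoid_scheme \<Rightarrow> (('t \<Rightarrow> 'c) \<times> 't) monoid"
  where "restricted_wreath C T =
    \<lparr>carrier = carrier (sum_group (carrier T) (\<lambda>_. C)) \<times> carrier T,
     mult = (\<lambda>(a, r) (b, s).
       ((\<lambda>t \<in> carrier T. a t \<otimes>\<^bsub>C\<^esub> b (t \<otimes>\<^bsub>T\<^esub> r)), r \<otimes>\<^bsub>T\<^esub> s)),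
     one = (\<one>\<^bsub>sum_group (carrier T) (\<lambda>_. C)\<^esub>, \<one>\<^bsub>T\<^esub>)\<rparr>"

definition ZW2 :: "((int \<times> int \<Rightarrow> int) \<times> (int \<times> int)) monoid"
  where "ZW2 = restricted_wreath integer_group (integer_group \<times>\<times> integer_group)"

lemma group_restricted_wreath:
  assumes C: "group C" and T: "group T"
  shows "group (restricted_wreath C T)"
proof -
  interpret C: group C by (rule C)
  interpret T: group T by (rule T)
  have fin: "finite {t \<in> carrier T. b (t \<otimes>\<^bsub>T\<^esub> r) \<noteq> \<one>\<^bsub>C\<^esub>}"
    if "finite {t \<in> carrier T. b t \<noteq> \<one>\<^bsub>C\<^esub>}" "r \<in> carrier T" for b r
  proof (rule finite_subset)
    show "{t \<in> carrier T. b (t \<otimes>\<^bsub>T\<^esub> r) \<noteq> \<one>\<^bsub>C\<^esub>}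
        \<subseteq> (\<lambda>t. t \<otimes>\<^bsub>T\<^esub> inv\<^bsub>T\<^esub> r) ` {t \<in> carrier T. b t \<noteq> \<one>\<^bsub>C\<^esub>}"
    proof
      fix t assume t: "t \<in> {t \<in> carrier T. b (t \<otimes>\<^bsub>T\<^esub> r) \<noteq> \<one>\<^bsub>C\<^esub>}"
      then have "t = (t \<otimes>\<^bsub>T\<^esub> r) \<otimes>\<^bsub>T\<^esub> inv\<^bsub>T\<^esub> r"
        using that(2) by (simp add: T.m_assoc)
      with t that(2) show "t \<in> (\<lambda>t. t \<otimes>\<^bsub>T\<^esub> inv\<^bsub>T\<^esub> r) ` {t \<in> carrier T. b t \<noteq> \<one>\<^bsub>C\<^esub>}"
        by blast
    qed
  qed (use that in simp)
  note cs = carrier_sum_group[of "carrier T" "\<lambda>_. C", OF C]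
  let ?S = "sum_group (carrier T) (\<lambda>_. C)"
  let ?sh = "\<lambda>b r. \<lambda>t \<in> carrier T. b (t \<otimes>\<^bsub>T\<^esub> r)"
  have sh: "?sh b r \<in> carrier ?S" if "b \<in> carrier ?S" "r \<in> carrier T" for b r
  proof -
    have "{t \<in> carrier T. ?sh b r t \<noteq> \<one>\<^bsub>C\<^esub>} = {t \<in> carrier T. b (t \<otimes>\<^bsub>T\<^esub> r) \<noteq> \<one>\<^bsub>C\<^esub>}" by auto
    then show ?thesis
      using that fin[of b r] by (auto simp: cs PiE_iff)
  qed
  interpret S: group ?S by (rule sum_group) (rule C)
  have mul: "(\<lambda>t \<in> carrier T. a t \<otimes>\<^bsub>C\<^esub> b (t \<otimes>\<^bsub>T\<^esub> r)) = a \<otimes>\<^bsub>?S\<^esub> ?sh b r" for a b r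
    by (auto simp: fun_eq_iff)
  have val: "b t \<in> carrier C" if "b \<in> carrier ?S" "t \<in> carrier T" for b t
    using that by (auto simp: cs PiE_iff)
  show ?thesis
  proof (rule groupI)
    fix x y assume "x \<in> carrier (restricted_wreath C T)" "y \<in> carrier (restricted_wreath C T)"
    then show "x \<otimes>\<^bsub>restricted_wreath C T\<^esub> y \<in> carrier (restricted_wreath C T)"
      by (cases x; cases y)
        (auto simp only: restricted_wreath_def monoid.simps partial_object.simps prod.case mul
          mem_Times_iff fst_conv snd_conv intro!: S.m_closed sh T.m_closed)
  next
    show "\<one>\<^bsub>restricted_wreath C T\<^esub> \<in> carrier (restricted_wreath C T)"
      using S.one_closed by (simp add: restricted_wreath_def del: one_sum_group)
  next
    fix x y z
    assume xyz: "x \<in> carrier (restricted_wreath C T)" "y \<in> carrier (restricted_wreath C T)"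
      "z \<in> carrier (restricted_wreath C T)"
    obtain a r where e1: "x = (a, r)" by (cases x)
    obtain b s where e2: "y = (b, s)" by (cases y)
    obtain c u where e3: "z = (c, u)" by (cases z)
    note e = e1 e2 e3
    have mem: "a \<in> carrier ?S" "b \<in> carrier ?S" "c \<in> carrier ?S"
      "r \<in> carrier T" "s \<in> carrier T" "u \<in> carrier T"
      using xyz by (simp_all add: e restricted_wreath_def)
    show "x \<otimes>\<^bsub>restricted_wreath C T\<^esub> y \<otimes>\<^bsub>restricted_wreath C T\<^esub> z =
        x \<otimes>\<^bsub>restricted_wreath C T\<^esub> (y \<otimes>\<^bsub>restricted_wreath C T\<^esub> z)"
      by (simp add: e restricted_wreath_def C.m_assoc T.m_assoc val mem cong: restrict_cong)
  next
    fix x assume x: "x \<in> carrier (restricted_wreath C T)"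
    obtain a r where xe: "x = (a, r)" by (cases x)
    with x have a: "a \<in> carrier ?S" and r: "r \<in> carrier T"
      by (simp_all add: restricted_wreath_def)
    then have "(\<lambda>t \<in> carrier T. a t) = a"
      by (simp add: cs PiE_iff extensional_restrict)
    with a r show "\<one>\<^bsub>restricted_wreath C T\<^esub> \<otimes>\<^bsub>restricted_wreath C T\<^esub> x = x"
      by (simp add: xe restricted_wreath_def val cong: restrict_cong)
  next
    fix x assume x: "x \<in> carrier (restricted_wreath C T)"
    obtain a r where xe: "x = (a, r)" by (cases x)
    with x have a: "a \<in> carrier ?S" and r: "r \<in> carrier T"
      by (auto simp: restricted_wreath_def)
    let ?y = "(?sh (inv\<^bsub>?S\<^esub> a) (inv\<^bsub>T\<^esub> r), inv\<^bsub>T\<^esub> r)"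
    have inva: "inv\<^bsub>?S\<^esub> a = (\<lambda>t \<in> carrier T. inv\<^bsub>C\<^esub> a t)"
      using a C by simp
    have "?y \<in> carrier (restricted_wreath C T)"
      using a r sh[of "inv\<^bsub>?S\<^esub> a" "inv\<^bsub>T\<^esub> r"] by (simp add: restricted_wreath_def del: inv_sum_group)
    moreover have "?y \<otimes>\<^bsub>restricted_wreath C T\<^esub> x = \<one>\<^bsub>restricted_wreath C T\<^esub>"
      using a r by (auto simp: restricted_wreath_def xe fun_eq_iff inva val)
    ultimately show "\<exists>y\<in>carrier (restricted_wreath C T).
        y \<otimes>\<^bsub>restricted_wreath C T\<^esub> x = \<one>\<^bsub>restricted_wreath C T\<^esub>" by blast
  qed
qed

section \<open>Homeomorphism groups\<close>

text \<open>As in \<^const>\<open>BijGroup\<close>, group elements are extensional functions, so that two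
  homeomorphisms agreeing on \<open>S\<close> are equal.\<close>

definition homeo_group :: "'a::topological_space set \<Rightarrow> ('a \<Rightarrow> 'a) monoid"
  where "homeo_group S =
    (BijGroup S)\<lparr>carrier := {f \<in> Bij S. \<exists>g. homeomorphism S S f g}\<rparr>"

lemma inv_BijGroup_homeomorphism:
  assumes "f \<in> Bij S" "homeomorphism S S f g"
  shows "inv\<^bsub>BijGroup S\<^esub> f = restrict g S"
proof -
  have "inv_into S f x = g x" if "x \<in> S" for x
    using that assms by (intro inv_into_f_eq) (auto simp: Bij_def bij_betw_def homeomorphism_def)
  then show ?thesis using assms(1) by (auto simp: inv_BijGroup fun_eq_iff)
qed

lemma homeomorphism_restrict:
  "homeomorphism S S f g \<Longrightarrow> homeomorphism S S f (restrict g S)"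
  "homeomorphism S S f g \<Longrightarrow> homeomorphism S S (restrict f S) g"
  by (erule homeomorphism_cong; simp)+

lemma subgroup_homeo_group: "subgroup (carrier (homeo_group S)) (BijGroup S)"
proof (rule group.subgroupI[OF group_BijGroup])
  show "carrier (homeo_group S) \<subseteq> carrier (BijGroup S)"
    by (auto simp: homeo_group_def BijGroup_def)
  have "restrict (\<lambda>x. x) S \<in> carrier (homeo_group S)"
    using homeomorphism_restrict(2)[OF homeomorphism_ident[of S]] id_Bij[of S]
    by (auto simp: homeo_group_def)
  then show "carrier (homeo_group S) \<noteq> {}" by blast
next
  fix f assume "f \<in> carrier (homeo_group S)"
  then obtain g where f: "f \<in> Bij S" and fg: "homeomorphism S S f g"
    by (auto simp: homeo_group_def)
  have "homeomorphism S S (restrict g S) f"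
    by (rule homeomorphism_restrict(2)[OF fg[unfolded homeomorphism_sym[of S S f]]])
  moreover have "inv\<^bsub>BijGroup S\<^esub> f \<in> carrier (BijGroup S)"
    using f by (intro group.inv_closed[OF group_BijGroup]) (simp add: BijGroup_def)
  ultimately have "restrict g S \<in> carrier (homeo_group S)"
    unfolding inv_BijGroup_homeomorphism[OF f fg] by (auto simp: homeo_group_def BijGroup_def)
  then show "inv\<^bsub>BijGroup S\<^esub> f \<in> carrier (homeo_group S)"
    by (simp only: inv_BijGroup_homeomorphism[OF f fg])
next
  fix f h assume "f \<in> carrier (homeo_group S)" "h \<in> carrier (homeo_group S)"
  then obtain f' h' where f: "f \<in> Bij S" "homeomorphism S S f f'"
    and h: "h \<in> Bij S" "homeomorphism S S h h'"
    by (auto simp: homeo_group_def)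
  have "homeomorphism S S (restrict (f \<circ> h) S) (h' \<circ> f')"
    by (intro homeomorphism_restrict(2) homeomorphism_compose[OF h(2) f(2)])
  moreover have "restrict (f \<circ> h) S = compose S f h" by (auto simp: compose_def)
  ultimately show "f \<otimes>\<^bsub>BijGroup S\<^esub> h \<in> carrier (homeo_group S)"
    using f h compose_Bij[OF f(1) h(1)] by (auto simp: homeo_group_def BijGroup_def)
qed

lemma group_homeo_group: "group (homeo_group S)"
  using group.subgroup_imp_group[OF group_BijGroup subgroup_homeo_group[of S]]
  by (simp add: homeo_group_def)

section \<open>Piecewise-linear homeomorphisms\<close>

text \<open>Polyhedra in the sense of piecewise-linear topology, in contrast to the library's convex
  \<^const>\<open>polyhedron\<close>. Only compact polyhedra occur here, since all of them are
  homeomorphic to an interval or to a circle.\<close>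

definition pl_polyhedron :: "'a::euclidean_space set \<Rightarrow> bool"
  where "pl_polyhedron P \<longleftrightarrow> (\<exists>F. finite F \<and> (\<forall>K\<in>F. polytope K) \<and> P = \<Union>F)"

definition affine_map_on :: "'a::real_vector set \<Rightarrow> ('a \<Rightarrow> 'b::real_vector) \<Rightarrow> bool"
  where "affine_map_on K f \<longleftrightarrow>
    (\<forall>x\<in>K. \<forall>y\<in>K. \<forall>t\<in>{0..1}. f ((1 - t) *\<^sub>R x + t *\<^sub>R y) = (1 - t) *\<^sub>R f x + t *\<^sub>R f y)"

definition piecewise_linear_on ::
    "'a::euclidean_space set \<Rightarrow> ('a \<Rightarrow> 'b::euclidean_space) \<Rightarrow> bool"
  where "piecewise_linear_on P f \<longleftrightarrow>
    (\<exists>F. finite F \<and> (\<forall>K\<in>F. polytope K \<and> affine_map_on K f) \<and> P = \<Union>F)"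

definition pl_homeo_group :: "'a::euclidean_space set \<Rightarrow> ('a \<Rightarrow> 'a) monoid"
  where "pl_homeo_group S =
    (homeo_group S)\<lparr>carrier := {f \<in> carrier (homeo_group S). piecewise_linear_on S f}\<rparr>"

lemma polytope_graph:
  fixes f :: "'a::euclidean_space \<Rightarrow> 'b::euclidean_space"
  assumes "polytope K" "affine_map_on K f"
  shows "polytope ((\<lambda>x. (x, f x)) ` K)"
proof -
  let ?g = "\<lambda>x. (x, f x)"
  obtain V where V: "finite V" "K = convex hull V" using assms(1) by (auto simp: polytope_def)
  have cK: "convex K" using V by simp
  have aff: "(1 - t) *\<^sub>R ?g x + t *\<^sub>R ?g y = ?g ((1 - t) *\<^sub>R x + t *\<^sub>R y)"
    if "x \<in> K" "y \<in> K" "0 \<le> t" "t \<le> 1" for x y t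
    using assms(2) that by (auto simp: affine_map_on_def)
  have "convex (?g ` K)"
  proof (intro convex_alt[THEN iffD2] ballI allI impI)
    fix v w and t :: real assume "v \<in> ?g ` K" "w \<in> ?g ` K" "0 \<le> t \<and> t \<le> 1"
    then obtain x y where vw: "v = ?g x" "w = ?g y"
      and *: "x \<in> K" "y \<in> K" "0 \<le> t" "t \<le> 1" by blast
    then show "(1 - t) *\<^sub>R v + t *\<^sub>R w \<in> ?g ` K"
      using cK unfolding vw aff[OF *] convex_alt by blast
  qed
  then have 1: "convex hull (?g ` V) \<subseteq> ?g ` K"
    using V by (intro hull_minimal) (auto intro: hull_inc)
  have "convex {x \<in> K. ?g x \<in> convex hull (?g ` V)}"
  proof (intro convex_alt[THEN iffD2] ballI allI impI)
    fix x y :: 'a and t :: real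
    assume "x \<in> {x \<in> K. ?g x \<in> convex hull (?g ` V)}"
      "y \<in> {x \<in> K. ?g x \<in> convex hull (?g ` V)}" "0 \<le> t \<and> t \<le> 1"
    then have *: "x \<in> K" "y \<in> K" "0 \<le> t" "t \<le> 1"
      and h: "?g x \<in> convex hull (?g ` V)" "?g y \<in> convex hull (?g ` V)" by auto
    have "(1 - t) *\<^sub>R ?g x + t *\<^sub>R ?g y \<in> convex hull (?g ` V)"
      using h *(3,4) convex_convex_hull[of "?g ` V"] unfolding convex_alt by blast
    then show "(1 - t) *\<^sub>R x + t *\<^sub>R y \<in> {x \<in> K. ?g x \<in> convex hull (?g ` V)}"
      using * cK unfolding aff[OF *] convex_alt by blast
  qed
  then have "K \<subseteq> {x \<in> K. ?g x \<in> convex hull (?g ` V)}"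
    unfolding V(2) by (intro hull_minimal) (auto intro: hull_inc)
  with 1 have "?g ` K = convex hull (?g ` V)" by blast
  with V show ?thesis by (auto simp: polytope_def)
qed

lemma polytope_affine_image:
  fixes f :: "'a::euclidean_space \<Rightarrow> 'b::euclidean_space"
  assumes "polytope K" "affine_map_on K f"
  shows "polytope (f ` K)"
proof -
  have "polytope (snd ` (\<lambda>x. (x, f x)) ` K)"
    by (intro polytope_linear_image polytope_graph assms linear_snd)
  then show ?thesis by (simp add: image_image)
qed

lemma polytope_affine_vimage:
  fixes f :: "'a::euclidean_space \<Rightarrow> 'b::euclidean_space"
  assumes "polytope K" "affine_map_on K f" "polytope L"
  shows "polytope {x \<in> K. f x \<in> L}"
proof -
  have "polytope (fst ` ((\<lambda>x. (x, f x)) ` K \<inter> K \<times> L))"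
    by (intro polytope_linear_image polytope_Int polytope_Times polytope_graph assms linear_fst)
  moreover have "fst ` ((\<lambda>x. (x, f x)) ` K \<inter> K \<times> L) = {x \<in> K. f x \<in> L}" by force
  ultimately show ?thesis by simp
qed

lemma piecewise_linear_on_cong:
  assumes "piecewise_linear_on P f" "\<And>x. x \<in> P \<Longrightarrow> f x = g x"
  shows "piecewise_linear_on P g"
proof -
  obtain F where F: "finite F" "\<forall>K\<in>F. polytope K \<and> affine_map_on K f" "P = \<Union>F"
    using assms(1) by (auto simp: piecewise_linear_on_def)
  have "affine_map_on K g" if "K \<in> F" for K
  proof -
    have "convex K" "affine_map_on K f" using F that polytope_imp_convex by blast+
    moreover have "f x = g x" if "x \<in> K" for x using that \<open>K \<in> F\<close> F assms(2) by blast
    ultimately show ?thesis unfolding affine_map_on_def convex_alt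
      by (metis atLeastAtMost_iff)
  qed
  with F show ?thesis by (auto simp: piecewise_linear_on_def)
qed

lemma piecewise_linear_on_compose:
  assumes "piecewise_linear_on P f" "piecewise_linear_on Q g" "f ` P \<subseteq> Q"
  shows "piecewise_linear_on P (g \<circ> f)"
proof -
  obtain F where F: "finite F" "\<forall>K\<in>F. polytope K \<and> affine_map_on K f" "P = \<Union>F"
    using assms(1) by (auto simp: piecewise_linear_on_def)
  obtain G where G: "finite G" "\<forall>K\<in>G. polytope K \<and> affine_map_on K g" "Q = \<Union>G"
    using assms(2) by (auto simp: piecewise_linear_on_def)
  let ?H = "(\<lambda>(K, L). {x \<in> K. f x \<in> L}) ` (F \<times> G)"
  have "finite ?H" using F G by simp
  moreover have "P = \<Union>?H" using F(3) G(3) assms(3) by fastforce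
  moreover have "polytope M \<and> affine_map_on M (g \<circ> f)" if "M \<in> ?H" for M
  proof -
    obtain K L where KL: "K \<in> F" "L \<in> G" "M = {x \<in> K. f x \<in> L}" using \<open>M \<in> ?H\<close> by auto
    have "affine_map_on M (g \<circ> f)"
      using F(2) G(2) KL by (auto simp: affine_map_on_def)
    with KL F G show ?thesis by (auto intro: polytope_affine_vimage)
  qed
  ultimately show ?thesis unfolding piecewise_linear_on_def by blast
qed

lemma piecewise_linear_on_inverse:
  assumes "piecewise_linear_on P f" "f ` P = Q" "\<And>x. x \<in> P \<Longrightarrow> g (f x) = x"
  shows "piecewise_linear_on Q g"
proof -
  obtain F where F: "finite F" "\<forall>K\<in>F. polytope K \<and> affine_map_on K f" "P = \<Union>F"
    using assms(1) by (auto simp: piecewise_linear_on_def)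
  have "affine_map_on (f ` K) g" if "K \<in> F" for K
    unfolding affine_map_on_def
  proof clarify
    fix x y :: 'a and t :: real assume *: "x \<in> K" "y \<in> K" "t \<in> {0..1}"
    have "(1 - t) *\<^sub>R x + t *\<^sub>R y \<in> K"
      using * F that polytope_imp_convex[of K] by (auto simp: convex_alt)
    then have "g (f ((1 - t) *\<^sub>R x + t *\<^sub>R y)) = (1 - t) *\<^sub>R x + t *\<^sub>R y" "g (f x) = x" "g (f y) = y"
      using * F that assms(3) by blast+
    then show "g ((1 - t) *\<^sub>R f x + t *\<^sub>R f y) = (1 - t) *\<^sub>R g (f x) + t *\<^sub>R g (f y)"
      using * F(2) that by (auto simp: affine_map_on_def)
  qed
  moreover have "Q = \<Union>((`) f ` F)" using F assms(2) by blast
  ultimately show ?thesis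
    unfolding piecewise_linear_on_def
    using F by (intro exI[of _ "(`) f ` F"]) (auto intro: polytope_affine_image)
qed

lemma subgroup_pl_homeo_group:
  assumes "pl_polyhedron S"
  shows "subgroup (carrier (pl_homeo_group S)) (homeo_group S)"
proof -
  interpret H: group "homeo_group S" by (rule group_homeo_group)
  have mult: "f \<otimes>\<^bsub>homeo_group S\<^esub> h = compose S f h"
    if "f \<in> carrier (homeo_group S)" "h \<in> carrier (homeo_group S)" for f h
    using that by (auto simp: homeo_group_def BijGroup_def)
  show ?thesis
  proof (rule H.subgroupI)
    show "carrier (pl_homeo_group S) \<subseteq> carrier (homeo_group S)"
      by (simp add: pl_homeo_group_def)
    have "piecewise_linear_on S (\<lambda>x. x)"
      using assms by (auto simp: pl_polyhedron_def piecewise_linear_on_def affine_map_on_def)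
    then have "piecewise_linear_on S (restrict (\<lambda>x. x) S)"
      by (rule piecewise_linear_on_cong) simp
    moreover have "\<one>\<^bsub>homeo_group S\<^esub> = restrict (\<lambda>x. x) S"
      by (simp add: homeo_group_def BijGroup_def)
    ultimately have "\<one>\<^bsub>homeo_group S\<^esub> \<in> carrier (pl_homeo_group S)"
      using H.one_closed unfolding pl_homeo_group_def by simp
    then show "carrier (pl_homeo_group S) \<noteq> {}" by blast
  next
    fix f assume "f \<in> carrier (pl_homeo_group S)"
    then have f: "f \<in> carrier (homeo_group S)" and pl: "piecewise_linear_on S f"
      by (auto simp: pl_homeo_group_def)
    let ?g = "inv\<^bsub>homeo_group S\<^esub> f"
    have "compose S ?g f = restrict (\<lambda>x. x) S"
      using H.l_inv[OF f] mult[OF H.inv_closed[OF f] f] by (simp add: homeo_group_def BijGroup_def)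
    then have "?g (f x) = x" if "x \<in> S" for x
      using that by (metis compose_eq restrict_apply')
    moreover have "f ` S = S" using f by (auto simp: homeo_group_def Bij_def bij_betw_def)
    ultimately have "piecewise_linear_on S ?g"
      using piecewise_linear_on_inverse[OF pl] by blast
    with H.inv_closed[OF f] show "?g \<in> carrier (pl_homeo_group S)"
      by (simp add: pl_homeo_group_def)
  next
    fix f h assume "f \<in> carrier (pl_homeo_group S)" "h \<in> carrier (pl_homeo_group S)"
    then have f: "f \<in> carrier (homeo_group S)" "piecewise_linear_on S f"
      and h: "h \<in> carrier (homeo_group S)" "piecewise_linear_on S h"
      by (auto simp: pl_homeo_group_def)
    have "h ` S = S" using h by (auto simp: homeo_group_def Bij_def bij_betw_def)
    then have "piecewise_linear_on S (f \<circ> h)"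
      using piecewise_linear_on_compose[OF h(2) f(2)] by simp
    then have "piecewise_linear_on S (compose S f h)"
      by (rule piecewise_linear_on_cong) (simp add: compose_def)
    with H.m_closed[OF f(1) h(1)] mult[OF f(1) h(1)]
    show "f \<otimes>\<^bsub>homeo_group S\<^esub> h \<in> carrier (pl_homeo_group S)"
      by (simp add: pl_homeo_group_def)
  qed
qed

lemma group_pl_homeo_group:
  assumes "pl_polyhedron S"
  shows "group (pl_homeo_group S)"
  using group.subgroup_imp_group[OF group_homeo_group subgroup_pl_homeo_group[OF assms]]
  by (simp add: pl_homeo_group_def)

section \<open>The polyhedral circle\<close>

definition line_through :: "'a::real_vector \<Rightarrow> 'a \<Rightarrow> 'a set"
  where "line_through p u = range (\<lambda>t. p + t *\<^sub>R u)"

text \<open>The orthogonal reflection across \<open>line_through p u\<close>, provided that \<open>u\<close> is a unit vector.\<close>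

definition reflect_across :: "'a::real_inner \<Rightarrow> 'a \<Rightarrow> 'a \<Rightarrow> 'a"
  where "reflect_across p u x = p + (2 * ((x - p) \<bullet> u)) *\<^sub>R u - (x - p)"

text \<open>\<open>A\<close> is one of the two piecewise-linear arcs that make up \<open>S\<close>; the other one is
  its mirror image. The boundary of \<open>I\<close>, a compact interval of the real line, is its
  topological frontier.\<close>

definition polyhedral_circle :: "(real ^ 2) set \<Rightarrow> bool"
  where "polyhedral_circle S \<longleftrightarrow>
    pl_polyhedron S \<and> S homeomorphic (sphere 0 1 :: (real ^ 2) set) \<and>
    (\<exists>p u (I :: real set) \<phi> \<psi> A.
      norm u = 1 \<and>
      pl_polyhedron I \<and> I homeomorphic {0..1 :: real} \<and>
      homeomorphism I A \<phi> \<psi> \<and> piecewise_linear_on I \<phi> \<and>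
      S = A \<union> reflect_across p u ` A \<and>
      A \<inter> reflect_across p u ` A = \<phi> ` frontier I \<and>
      \<phi> ` frontier I \<subseteq> line_through p u)"

text \<open>The hypothesis on \<open>S\<close> is satisfiable: a square with a diagonal on the
  axis of reflection.\<close>

lemma polyhedral_circle_square:
  "polyhedral_circle {x :: real ^ 2. \<bar>x $ 1\<bar> + \<bar>x $ 2\<bar> = 1}"
proof -
  define S where "S = {x :: real ^ 2. \<bar>x $ 1\<bar> + \<bar>x $ 2\<bar> = 1}"
  define \<phi> :: "real \<Rightarrow> real ^ 2" where "\<phi> t = vector [t, 1 - \<bar>t\<bar>]" for t
  define u :: "real ^ 2" where "u = axis 1 1"
  define A where "A = \<phi> ` {-1..1}"
  let ?R = "reflect_across 0 u"
  have vec_eq: "v = w \<longleftrightarrow> v $ 1 = w $ 1 \<and> v $ 2 = w $ 2" for v w :: "real ^ 2"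
    by (simp add: vec_eq_iff forall_2)
  have phi: "\<phi> t $ 1 = t" "\<phi> t $ 2 = 1 - \<bar>t\<bar>" for t by (simp_all add: \<phi>_def)
  have R: "?R x $ 1 = x $ 1" "?R x $ 2 = - x $ 2" for x
    by (simp_all add: reflect_across_def u_def inner_axis axis_nth axis_def[of 1 1, THEN arg_cong[where f = "\<lambda>v. v $ 2"]])
  have u: "norm u = 1" by (simp add: u_def)
  have A: "x \<in> A \<longleftrightarrow> x \<in> S \<and> x $ 2 \<ge> 0" for x
  proof
    assume "x \<in> S \<and> x $ 2 \<ge> 0"
    then have "x = \<phi> (x $ 1)" "x $ 1 \<in> {-1..1}" by (auto simp: vec_eq phi S_def)
    then show "x \<in> A" unfolding A_def by blast
  qed (auto simp: A_def phi S_def)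
  have RA: "x \<in> ?R ` A \<longleftrightarrow> x \<in> S \<and> x $ 2 \<le> 0" for x
  proof
    assume "x \<in> S \<and> x $ 2 \<le> 0"
    then have "?R x \<in> A" "x = ?R (?R x)" by (auto simp: A S_def R vec_eq)
    then show "x \<in> ?R ` A" by blast
  qed (auto simp: A R S_def)
  have SA: "S = A \<union> ?R ` A" using A RA by force
  have fr: "frontier {-1..1 :: real} = {-1, 1}" by (simp add: frontier_def)
  have "A \<inter> ?R ` A = \<phi> ` frontier {-1..1 :: real}"
    unfolding fr set_eq_iff Int_iff A RA by (auto simp: S_def vec_eq phi)
  moreover have "\<phi> ` frontier {-1..1 :: real} \<subseteq> line_through 0 u"
    unfolding fr line_through_def
    by (auto simp: vec_eq phi u_def axis_def image_iff)
  moreover have "continuous_on X \<phi>" for X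
    unfolding continuous_on_componentwise[of X \<phi>] Basis_vec_def
    by (auto simp: inner_axis phi exhaust_2 forall_2 intro!: continuous_intros)
  then have "homeomorphism {-1..1} A \<phi> (\<lambda>x. x $ 1)"
    by (intro homeomorphismI continuous_intros) (auto simp: A_def phi)
  moreover have "piecewise_linear_on {-1..1} \<phi>"
    unfolding piecewise_linear_on_def
  proof (intro exI[of _ "{cbox (-1) 0, cbox 0 1}"] conjI ballI)
    fix K :: "real set" assume K: "K \<in> {cbox (-1) 0, cbox 0 1}"
    then show "polytope K" using polytope_interval by blast
    have "\<exists>c. \<forall>x\<in>K. \<bar>x\<bar> = c * x"
      using K by (auto intro: exI[of _ 1] exI[of _ "-1"])
    then obtain c where c: "\<And>x. x \<in> K \<Longrightarrow> \<bar>x\<bar> = c * x" by blast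
    have cv: "(1 - t) *\<^sub>R x + t *\<^sub>R y \<in> K" if "x \<in> K" "y \<in> K" "t \<in> {0..1}" for x y t
      using that K convex_box(1)[of "-1::real" 0] convex_box(1)[of "0::real" 1]
      by (auto simp only: convex_alt atLeastAtMost_iff insert_iff empty_iff)
    show "affine_map_on K \<phi>"
      unfolding affine_map_on_def
    proof (intro ballI)
      fix x y t :: real assume *: "x \<in> K" "y \<in> K" "t \<in> {0..1}"
      show "\<phi> ((1 - t) *\<^sub>R x + t *\<^sub>R y) = (1 - t) *\<^sub>R \<phi> x + t *\<^sub>R \<phi> y"
        unfolding vec_eq vector_add_component vector_scaleR_component phi c[OF cv[OF *]]
          c[OF *(1)] c[OF *(2)]
        by (simp add: algebra_simps)
    qed
  qed auto
  moreover have "pl_polyhedron {-1..1 :: real}"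
    unfolding pl_polyhedron_def
    using polytope_interval[of "-1 :: real" 1] by (intro exI[of _ "{{-1..1}}"]) simp
  moreover have "{-1..1 :: real} homeomorphic {0..1 :: real}"
    using homeomorphic_closed_intervals_real[of "-1" 1 0 1] by simp
  moreover have "pl_polyhedron S"
  proof -
    have *: "polytope (closed_segment v w)" for v w :: "real ^ 2"
      by (simp add: segment_convex_hull polytope_convex_hull)
    have plA: "\<exists>F. finite F \<and> (\<forall>K\<in>F. polytope K) \<and> A = \<Union>F"
    proof -
      obtain F where F: "finite F" "\<forall>K\<in>F. polytope K \<and> affine_map_on K \<phi>" "{-1..1} = \<Union>F"
        using \<open>piecewise_linear_on {-1..1} \<phi>\<close> by (auto simp: piecewise_linear_on_def)
      then show ?thesis
        by (intro exI[of _ "(`) \<phi> ` F"]) (auto simp: A_def polytope_affine_image)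
    qed
    then obtain F where F: "finite F" "\<forall>K\<in>F. polytope K" "A = \<Union>F" by blast
    have "linear ?R"
      by (rule linearI) (simp_all add: vec_eq R algebra_simps)
    then have "\<forall>K\<in>(`) ?R ` F. polytope K" using F by (auto intro: polytope_linear_image)
    moreover have "?R ` A = \<Union>((`) ?R ` F)" using F by blast
    ultimately show ?thesis
      unfolding pl_polyhedron_def SA
      using F by (intro exI[of _ "F \<union> (`) ?R ` F"]) auto
  qed
  moreover have "S homeomorphic (sphere 0 1 :: (real ^ 2) set)"
  proof -
    let ?n = "\<lambda>x :: real ^ 2. \<bar>x $ 1\<bar> + \<bar>x $ 2\<bar>"
    have nz: "x \<noteq> 0 \<longleftrightarrow> ?n x \<noteq> 0" for x :: "real ^ 2"
      by (auto simp: vec_eq)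
    have nS: "x \<noteq> 0" "norm x \<noteq> 0" if "x \<in> S" for x using that by (auto simp: S_def)
    have n1: "?n (c *\<^sub>R x) = \<bar>c\<bar> * ?n x" for c x by (simp add: abs_mult distrib_left)
    have "homeomorphism S (sphere 0 1) (\<lambda>x. (1 / norm x) *\<^sub>R x) (\<lambda>x. (1 / ?n x) *\<^sub>R x)"
    proof (rule homeomorphismI)
      show "continuous_on S (\<lambda>x. (1 / norm x) *\<^sub>R x)"
        by (intro continuous_intros) (use nS in auto)
      have "x \<noteq> 0" if "x \<in> sphere 0 1" for x :: "real ^ 2" using that by auto
      then show "continuous_on (sphere 0 1) (\<lambda>x :: real ^ 2. (1 / ?n x) *\<^sub>R x)"
        by (intro continuous_intros) (use nz in blast)
      show "(\<lambda>x. (1 / norm x) *\<^sub>R x) ` S \<subseteq> sphere 0 1" using nS by auto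
      show "(\<lambda>x. (1 / ?n x) *\<^sub>R x) ` sphere 0 1 \<subseteq> S"
      proof clarify
        fix x :: "real ^ 2" assume "x \<in> sphere 0 1"
        then have "?n x \<noteq> 0" unfolding nz[symmetric] by auto
        then have "?n ((1 / ?n x) *\<^sub>R x) = 1" unfolding n1 by simp
        then show "(1 / ?n x) *\<^sub>R x \<in> S" by (simp only: S_def mem_Collect_eq)
      qed
    next
      fix x assume x: "x \<in> S"
      then have "?n ((1 / norm x) *\<^sub>R x) = 1 / norm x" unfolding n1 by (simp add: S_def)
      then show "(1 / ?n ((1 / norm x) *\<^sub>R x)) *\<^sub>R (1 / norm x) *\<^sub>R x = x"
        using nS[OF x] by simp
    next
      fix y :: "real ^ 2" assume y: "y \<in> sphere 0 1"
      then have "?n y \<noteq> 0" unfolding nz[symmetric] by auto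
      then have "?n y > 0" by simp
      moreover from this y have "norm ((1 / ?n y) *\<^sub>R y) = 1 / ?n y"
        unfolding norm_scaleR by simp
      ultimately show "(1 / norm ((1 / ?n y) *\<^sub>R y)) *\<^sub>R (1 / ?n y) *\<^sub>R y = y"
        by (simp only: scaleR_scaleR) simp
    qed
    then show ?thesis unfolding homeomorphic_def by blast
  qed
  ultimately show ?thesis
    unfolding polyhedral_circle_def S_def[symmetric]
    using u SA by blast
qed

end

theory Submission
  imports Defs
begin

text \<open>
  Homeomorphisms of the circle are studied through their increasing piecewise-linear lifts to the line,
  that is, increasing maps commuting with \<open>x \<mapsto> x + 1\<close>. An embedding of the wreath product would provide
  such lifts for the squares of the base and top elements, and these generate a group of the same shape. So it
  suffices to show that a free abelian base group \<open>\<int>[\<int>\<^sup>2]\<close> and a top group \<open>\<int>\<^sup>2\<close>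
  permuting its coordinates cannot act faithfully in this way (\<open>no_wreath_lifts\<close>).

  A base element and a translate of it commute and are conjugate. Their lifts stay at a bounded distance
  under iteration, so their quotient has a fixed point
  (\<open>commuting_conjugate_coincidence\<close>). This gives a nontrivial base element \<open>E\<close> with a fixed point.
  The components of the support of such a map are its orbitals; there are finitely many of them modulo
  \<open>1\<close>. Piecewise linearity enters through the linear germ of a map at an end of an orbital: a map that
  commutes with \<open>E\<close> and fixes an end and an interior point of an orbital of \<open>E\<close> is the identity there
  (\<open>commuting_identity_on_orbital\<close>), and a commuting conjugate of \<open>E\<close> by a map fixing an end agrees
  with \<open>E\<close> there (\<open>commuting_conjugate_eq_on_orbital\<close>). Consequently orbitals of \<open>E\<close> and of its
  translates are equal or disjoint, and if \<open>r \<in> \<int>\<^sup>2\<close> stabilizes an orbital, then the group-ring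
  element \<open>1 - r\<close> turns \<open>E\<close> into an element that is trivial on this orbital and its translates. If
  every orbital had a nontrivial stabilizer, a product of such factors would annihilate \<open>E\<close>, although
  \<open>\<int>[\<int>\<^sup>2]\<close> has no zero divisors (\<open>kill_orbitals\<close>). So some orbital has all its translates under
  \<open>\<int>\<^sup>2\<close> pairwise disjoint.

  This is impossible as well. By Denjoy's theorem
  (\<open>wandering_interval_imp_periodic\<close>) both generators of the top group have periodic points on the
  circle, and suitable powers lift to commuting maps with fixed points. These have an orbital in common that
  contains the wandering interval, and near its end they are homotheties with a common centre. But a
  suitable product of powers of two such homotheties moves an interval near the centre so
  little that it meets its image (\<open>no_free_commuting_pair\<close>).
\<close>

section \<open>Increasing piecewise-linear lifts\<close>

definition right_affine :: "(real \<Rightarrow> 'a::real_vector) \<Rightarrow> real \<Rightarrow> bool"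
  where "right_affine f x \<longleftrightarrow> (\<exists>d>0. \<exists>v. \<forall>s\<in>{0..d}. f (x + s) = f x + s *\<^sub>R v)"

text \<open>Germs on the left are germs on the right of the function composed with \<open>uminus\<close>; this
  halves most proofs. For maps of the line that commute with an integer translation the local
  condition is equivalent to piecewise linearity with finitely many breakpoints per period, and it
  is much easier to transport along a parametrization of the circle.\<close>

definition locally_pl :: "(real \<Rightarrow> 'a::real_vector) \<Rightarrow> bool"
  where "locally_pl f \<longleftrightarrow> (\<forall>x. right_affine f x \<and> right_affine (\<lambda>y. f (- y)) x)"

text \<open>These are the lifts to the line of the orientation-preserving piecewise-linear
  homeomorphisms of the circle \<open>\<real> / \<int>\<close>.\<close>

definition lift_maps :: "(real \<Rightarrow> real) set"
  where "lift_maps = {F. strict_mono F \<and> (\<forall>x. F (x + 1) = F x + 1) \<and> locally_pl F}"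

text \<open>A name of its own for the inverse function, since the prefix \<open>inv\<close> denotes inverses in
  abstract groups.\<close>

abbreviation finv :: "(real \<Rightarrow> real) \<Rightarrow> real \<Rightarrow> real"
  where "finv \<equiv> inv_into UNIV"

lemma right_affineI:
  "d > 0 \<Longrightarrow> (\<And>s. 0 \<le> s \<Longrightarrow> s \<le> d \<Longrightarrow> f (x + s) = f x + s *\<^sub>R v) \<Longrightarrow> right_affine f x"
  by (auto simp: right_affine_def)

lemma locally_plD:
  assumes "locally_pl f"
  shows "right_affine f x" "right_affine (\<lambda>y. f (- y)) x"
  using assms unfolding locally_pl_def by blast+

lemma right_affine_continuous:
  fixes f :: "real \<Rightarrow> 'a::real_normed_vector"
  assumes "right_affine f x"
  shows "continuous (at_right x) f"
proof -
  obtain d v where d: "d > 0" "\<forall>s\<in>{0..d}. f (x + s) = f x + s *\<^sub>R v"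
    using assms by (auto simp: right_affine_def)
  have ev: "eventually (\<lambda>y. f x + (y - x) *\<^sub>R v = f y) (at_right x)"
    unfolding eventually_at_right_field
  proof (intro exI[of _ "x + d"] conjI allI impI)
    show "f x + (y - x) *\<^sub>R v = f y" if "y > x" "y < x + d" for y
      using bspec[OF d(2), of "y - x"] that by simp
  qed (use d in simp)
  have "((\<lambda>y. f x + (y - x) *\<^sub>R v) \<longlongrightarrow> f x + (x - x) *\<^sub>R v) (at_right x)"
    by (intro tendsto_intros)
  then have "((\<lambda>y. f x + (y - x) *\<^sub>R v) \<longlongrightarrow> f x) (at_right x)" by simp
  then show ?thesis
    unfolding continuous_within using ev by (rule Lim_transform_eventually)
qed

lemma locally_pl_isCont:
  fixes f :: "real \<Rightarrow> 'a::real_normed_vector"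
  assumes "locally_pl f"
  shows "isCont f x"
proof -
  have "continuous (at_right (- x)) (\<lambda>y. f (- y))" "continuous (at_right x) f"
    by (intro right_affine_continuous locally_plD assms)+
  then have "(f \<longlongrightarrow> f x) (at_left x)" "(f \<longlongrightarrow> f x) (at_right x)"
    unfolding continuous_within at_left_minus filterlim_filtermap by auto
  then show ?thesis by (simp add: continuous_at_split) (simp add: continuous_within)
qed

lemma locally_pl_continuous_on:
  fixes f :: "real \<Rightarrow> 'a::real_normed_vector"
  shows "locally_pl f \<Longrightarrow> continuous_on A f"
  by (simp add: continuous_at_imp_continuous_on locally_pl_isCont)

lemma right_affine_compose:
  fixes F :: "real \<Rightarrow> real"
  assumes "right_affine g (F x)" "right_affine F x" "strict_mono F"
  shows "right_affine (\<lambda>y. g (F y)) x"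
proof -
  obtain d v where d: "d > 0" "\<forall>s\<in>{0..d}. g (F x + s) = g (F x) + s *\<^sub>R v"
    using assms(1) by (auto simp: right_affine_def)
  obtain e w where e: "e > 0" "\<forall>s\<in>{0..e}. F (x + s) = F x + s *\<^sub>R w"
    using assms(2) by (auto simp: right_affine_def)
  have "F x < F (x + e)" using assms(3) e(1) by (simp add: strict_mono_def)
  then have "w > 0" using bspec[OF e(2), of e] e(1) by (simp add: zero_less_mult_iff)
  show ?thesis
  proof (rule right_affineI[where d = "min e (d / w)" and v = "w *\<^sub>R v"])
    fix s assume s: "0 \<le> s" "s \<le> min e (d / w)"
    then have "0 \<le> s * w" "s * w \<le> d" using \<open>w > 0\<close> by (auto simp: field_simps)
    then have "g (F x + s * w) = g (F x) + (s * w) *\<^sub>R v" using d(2) by simp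
    then show "g (F (x + s)) = g (F x) + s *\<^sub>R w *\<^sub>R v" using bspec[OF e(2), of s] s by simp
  qed (use d e \<open>w > 0\<close> in simp)
qed

text \<open>A map into a line that becomes affine after composition with an injective affine germ is an
  affine germ itself: compare the two directions with the inner product.\<close>

lemma right_affine_cancel:
  fixes F :: "real \<Rightarrow> real" and g :: "real \<Rightarrow> 'a::real_inner"
  assumes g: "right_affine g (F x)" and gF: "right_affine (\<lambda>y. g (F y)) x"
    and F: "strict_mono F" "isCont F x"
    and inj: "\<exists>e>0. inj_on g {F x..F x + e}"
  shows "right_affine F x"
proof -
  obtain d v where d: "d > 0" "\<forall>s\<in>{0..d}. g (F x + s) = g (F x) + s *\<^sub>R v"
    using g by (auto simp: right_affine_def)
  obtain e w where e: "e > 0" "\<forall>s\<in>{0..e}. g (F (x + s)) = g (F x) + s *\<^sub>R w"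
    using gF by (auto simp: right_affine_def)
  have "v \<noteq> 0"
  proof
    assume "v = 0"
    obtain c where c: "c > 0" "inj_on g {F x..F x + c}" using inj by blast
    have "g (F x + min c d) = g (F x)" using bspec[OF d(2), of "min c d"] d(1) c(1) \<open>v = 0\<close> by simp
    then have "F x + min c d = F x" using c(1) d(1) by (intro inj_onD[OF c(2)]) auto
    then show False using c(1) d(1) by linarith
  qed
  obtain r where r: "r > 0" "\<And>y. dist y x < r \<Longrightarrow> dist (F y) (F x) < d"
    using F(2) d(1) unfolding continuous_at_eps_delta by metis
  show ?thesis
  proof (rule right_affineI[where d = "min e (r / 2)" and v = "(w \<bullet> v) / (v \<bullet> v)"])
    fix s assume s: "0 \<le> s" "s \<le> min e (r / 2)"
    let ?t = "F (x + s) - F x"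
    have "F x \<le> F (x + s)" using F(1) s by (simp add: strict_mono_less_eq)
    moreover have "dist (F (x + s)) (F x) < d" using r s by (intro r(2)) (auto simp: dist_real_def)
    ultimately have "0 \<le> ?t" "?t \<le> d" by (auto simp: dist_real_def)
    then have "g (F x) + ?t *\<^sub>R v = g (F x) + s *\<^sub>R w" using bspec[OF d(2), of ?t] bspec[OF e(2), of s] s by simp
    then have "?t * (v \<bullet> v) = s * (w \<bullet> v)"
      by (metis add_left_cancel inner_scaleR_left)
    then show "F (x + s) = F x + s *\<^sub>R ((w \<bullet> v) / (v \<bullet> v))"
      using \<open>v \<noteq> 0\<close> by (simp add: field_simps)
  qed (use e r in simp)
qed

lemma strict_mono_reflect: "strict_mono F \<Longrightarrow> strict_mono (\<lambda>y::real. - F (- y :: real) :: real)"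
  by (simp add: strict_mono_def)

lemma right_affine_uminus:
  "right_affine (\<lambda>y. - f y) x \<longleftrightarrow> right_affine f x"
proof -
  have *: "right_affine (\<lambda>y. - f y) x" if f: "right_affine f x" for f :: "real \<Rightarrow> 'a"
  proof -
    obtain d v where "d > 0" "\<forall>s\<in>{0..d}. f (x + s) = f x + s *\<^sub>R v"
      using f by (auto simp: right_affine_def)
    then show ?thesis by (intro right_affineI[of d _ _ "- v"]) simp_all
  qed
  from *[of f] *[of "\<lambda>y. - f y"] show ?thesis by auto
qed

lemma locally_pl_compose:
  fixes F :: "real \<Rightarrow> real"
  assumes "locally_pl g" "locally_pl F" "strict_mono F"
  shows "locally_pl (\<lambda>y. g (F y))"
  unfolding locally_pl_def
proof (intro allI conjI)
  fix x
  show "right_affine (\<lambda>y. g (F y)) x"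
    by (rule right_affine_compose[OF locally_plD(1) locally_plD(1)]) fact+
  have "right_affine (\<lambda>y. (\<lambda>z. g (- z)) ((\<lambda>y. - F (- y)) y)) x"
  proof (rule right_affine_compose[where g = "\<lambda>z. g (- z)" and F = "\<lambda>y. - F (- y)"])
    show "right_affine (\<lambda>z. g (- z)) (- F (- x))" by (rule locally_plD(2)) fact
    show "right_affine (\<lambda>y. - F (- y)) x"
      unfolding right_affine_uminus by (rule locally_plD(2)) fact
    show "strict_mono (\<lambda>y. - F (- y))" by (rule strict_mono_reflect) fact
  qed
  then show "right_affine (\<lambda>y. g (F (- y))) x" by simp
qed

lemma locally_pl_cancel:
  fixes F :: "real \<Rightarrow> real" and g :: "real \<Rightarrow> 'a::real_inner"
  assumes g: "locally_pl g" and gF: "locally_pl (\<lambda>y. g (F y))"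
    and F: "strict_mono F" "\<And>x. isCont F x"
    and e: "e > 0" "\<And>x. inj_on g {x..x + e}"
  shows "locally_pl F"
  unfolding locally_pl_def
proof (intro allI conjI)
  fix x
  show "right_affine F x"
    by (rule right_affine_cancel[OF locally_plD(1)[OF g] locally_plD(1)[OF gF] F]) (use e in blast)
  have "right_affine (\<lambda>y. - F (- y)) x"
  proof (rule right_affine_cancel[of "\<lambda>y. g (- y)"])
    show "right_affine (\<lambda>y. g (- y)) (- F (- x))" by (rule locally_plD(2)[OF g])
    show "right_affine (\<lambda>y. g (- (- F (- y)))) x" using locally_plD(2)[OF gF] by simp
    show "strict_mono (\<lambda>y. - F (- y))" using F(1) by (rule strict_mono_reflect)
    show "isCont (\<lambda>y. - F (- y)) x"
      by (intro continuous_minus isCont_o2[of x uminus F]) (use F(2) in auto)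
    have "inj_on (\<lambda>y. g (- y)) {c..c + e}" for c
    proof (rule inj_onI)
      fix y z assume "y \<in> {c..c + e}" "z \<in> {c..c + e}" "g (- y) = g (- z)"
      then have "- y = - z" using e(2)[of "- (c + e)"] by (intro inj_onD[of g]) auto
      then show "y = z" by simp
    qed
    then show "\<exists>e>0. inj_on (\<lambda>y. g (- y)) {- F (- x)..- F (- x) + e}" using e(1) by blast
  qed
  then show "right_affine (\<lambda>y. F (- y)) x" by (simp add: right_affine_uminus)
qed

lemma locally_pl_translation: "locally_pl (\<lambda>x. x + c)" for c :: real
  unfolding locally_pl_def
  by (intro allI conjI right_affineI[of 1 _ _ 1] right_affineI[of 1 _ _ "- 1"]) auto

lemma lift_mapsD:
  assumes "F \<in> lift_maps"
  shows "strict_mono F" "F (x + 1) = F x + 1" "locally_pl F" "isCont F x" "continuous_on A F"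
  using assms by (auto simp: lift_maps_def locally_pl_isCont locally_pl_continuous_on)

lemma lift_map_less:
  assumes "F \<in> lift_maps"
  shows "F x < F y \<longleftrightarrow> x < y" "F x \<le> F y \<longleftrightarrow> x \<le> y" "F x = F y \<longleftrightarrow> x = y"
  using lift_mapsD(1)[OF assms] by (simp_all add: strict_mono_less strict_mono_less_eq strict_mono_eq)

lemma lift_map_add_int:
  assumes "F \<in> lift_maps"
  shows "F (x + of_int k) = F x + of_int k"
proof (induction k rule: int_induct[of _ 0])
  case (step1 i)
  then show ?case using lift_mapsD(2)[OF assms, of "x + of_int i"] by (simp add: algebra_simps)
next
  case (step2 i)
  then show ?case using lift_mapsD(2)[OF assms, of "x + of_int i - 1"] by (simp add: algebra_simps)
qed simp

lemma lift_map_diff_int: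
  "F \<in> lift_maps \<Longrightarrow> F (x - of_int k) = F x - of_int k"
  using lift_map_add_int[of F x "- k"] by simp

lemma translation_lift_map: "(\<lambda>x. x + of_int k) \<in> lift_maps"
  using locally_pl_translation by (simp add: lift_maps_def strict_mono_def)

lemma compose_lift_map:
  assumes "F \<in> lift_maps" "G \<in> lift_maps"
  shows "F \<circ> G \<in> lift_maps"
  using assms locally_pl_compose[of F G] by (simp add: lift_maps_def strict_mono_def comp_def)

lemma bij_lift_map:
  assumes "F \<in> lift_maps"
  shows "bij F"
proof (rule bijI)
  show "inj F" using lift_map_less(3)[OF assms] by (auto simp: inj_def)
  have "\<exists>x. F x = y" for y
  proof -
    define n where "n = \<lceil>\<bar>y - F 0\<bar>\<rceil>"
    have n: "of_int n \<ge> \<bar>y - F 0\<bar>" by (simp add: n_def)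
    have "F (- of_int n) \<le> y" "y \<le> F (of_int n)"
      using n lift_map_add_int[OF assms, of 0 n] lift_map_add_int[OF assms, of 0 "- n"] by auto
    then show ?thesis
      using IVT'[of F "- of_int n" y "of_int n"] n lift_mapsD(5)[OF assms] by (meson abs_ge_zero
        minus_le_iff neg_le_0_iff_le order_trans)
  qed
  then show "surj F" by (metis surjI)
qed

lemma lift_map_inv [simp]:
  assumes "F \<in> lift_maps"
  shows "F (finv F x) = x" "finv F (F x) = x" "F \<circ> finv F = id" "finv F \<circ> F = id"
  using bij_lift_map[OF assms] by (auto simp: bij_def surj_f_inv_f fun_eq_iff)

lemma inv_lift_map:
  assumes "F \<in> lift_maps"
  shows "finv F \<in> lift_maps"
proof -
  have mono: "strict_mono (finv F)"
    unfolding strict_mono_def using lift_map_less(1)[OF assms] lift_map_inv(1)[OF assms] by metis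
  have "finv F (x + 1) = finv F x + 1" for x
    using lift_mapsD(2)[OF assms, of "finv F x"] lift_map_inv[OF assms] by metis
  moreover have "isCont (finv F) x" for x
    using isCont_inverse_function[of 1 "finv F x" "finv F" F] lift_mapsD(4)[OF assms]
      lift_map_inv[OF assms] by auto
  moreover have "inj_on F {x..x + 1}" for x using lift_map_less(3)[OF assms] by (auto simp: inj_on_def)
  ultimately show ?thesis
    using mono locally_pl_cancel[OF lift_mapsD(3)[OF assms], of "finv F" 1]
      locally_pl_translation[of 0] lift_map_inv[OF assms]
    by (auto simp: lift_maps_def)
qed

lemma funpow_lift_map: "F \<in> lift_maps \<Longrightarrow> F ^^ n \<in> lift_maps"
  using translation_lift_map[of 0]
  by (induction n) (auto simp: id_def[symmetric] compose_lift_map)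

section \<open>Orbitals of commuting lifts\<close>

text \<open>The orbitals are the components of the support, written as intervals.\<close>

definition orbital :: "(real \<Rightarrow> real) \<Rightarrow> real \<Rightarrow> real \<Rightarrow> bool"
  where "orbital F p q \<longleftrightarrow> p < q \<and> F p = p \<and> F q = q \<and> (\<forall>x. p < x \<and> x < q \<longrightarrow> F x \<noteq> x)"

lemma orbitalD:
  assumes "orbital F p q"
  shows "p < q" "F p = p" "F q = q" "p < x \<Longrightarrow> x < q \<Longrightarrow> F x \<noteq> x"
  using assms by (auto simp: orbital_def)

lemma orbital_disjoint:
  assumes "orbital F p q" "orbital F p' q'"
  shows "p = p' \<and> q = q' \<or> q \<le> p' \<or> q' \<le> p"
  using assms unfolding orbital_def by (metis linorder_not_le linorder_less_linear)

lemma orbital_exists: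
  assumes F: "F \<in> lift_maps" and fixed: "F c = c" and moved: "F y \<noteq> y"
  obtains p q where "orbital F p q" "p < y" "y < q"
proof -
  define Z where "Z = {x. F x = x}"
  have "closed Z"
    unfolding Z_def using lift_mapsD(5)[OF F] by (intro closed_Collect_eq continuous_on_id) auto
  have cZ: "c + of_int k \<in> Z" for k
    using fixed lift_map_add_int[OF F] by (simp add: Z_def)
  have lo: "c + of_int \<lfloor>y - c\<rfloor> \<in> Z \<inter> {..y}" and hi: "c + of_int \<lceil>y - c\<rceil> \<in> Z \<inter> {y..}"
    using cZ by (auto; linarith)+
  have bd: "bdd_above (Z \<inter> {..y})" "bdd_below (Z \<inter> {y..})" by auto
  define p where "p = Sup (Z \<inter> {..y})"
  define q where "q = Inf (Z \<inter> {y..})"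
  have "p \<in> Z \<inter> {..y}"
    unfolding p_def using \<open>closed Z\<close> lo bd(1) by (intro closed_contains_Sup) auto
  moreover have "q \<in> Z \<inter> {y..}"
    unfolding q_def using \<open>closed Z\<close> hi bd(2) by (intro closed_contains_Inf) auto
  moreover have "y \<notin> Z" using moved by (simp add: Z_def)
  ultimately have pq: "p \<in> Z" "q \<in> Z" "p < y" "y < q" by (auto simp: less_le)
  have "x \<notin> Z" if "p < x" "x < q" for x
  proof
    assume "x \<in> Z"
    show False
    proof (cases "x \<le> y")
      case True
      then have "x \<le> p" unfolding p_def using \<open>x \<in> Z\<close> bd(1) by (intro cSup_upper) auto
      with that show False by simp
    next
      case False
      then have "q \<le> x" unfolding q_def using \<open>x \<in> Z\<close> bd(2) by (intro cInf_lower) auto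
      with that show False by simp
    qed
  qed
  with pq have "orbital F p q" by (auto simp: orbital_def Z_def)
  with pq(3,4) show thesis by (intro that)
qed

lemma limit_of_iterates_fixed:
  assumes F: "F \<in> lift_maps" and lim: "(\<lambda>n. (F ^^ n) y) \<longlonglongrightarrow> l"
  shows "F l = l"
proof -
  have "(\<lambda>n. F ((F ^^ n) y)) \<longlonglongrightarrow> F l"
    using lift_mapsD(4)[OF F] lim by (rule isCont_tendsto_compose)
  moreover have "(\<lambda>n. F ((F ^^ n) y)) \<longlonglongrightarrow> l" using LIMSEQ_Suc[OF lim] by simp
  ultimately show ?thesis using LIMSEQ_unique by blast
qed

text \<open>Since \<open>F\<close> and its inverse have the same orbitals and commute with the same maps, arguments
  about an orbital may follow iterates that tend to its left end.\<close>

lemma orbital_contracting: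
  assumes F: "F \<in> lift_maps" and o: "orbital F p q"
  obtains G where "G = F \<or> G = finv F" "G \<in> lift_maps" "orbital G p q"
    "\<And>x. p < x \<Longrightarrow> x < q \<Longrightarrow> G x < x"
proof -
  have oi: "orbital (finv F) p q"
    using o lift_map_inv[OF F] unfolding orbital_def by metis
  have sign: "(\<forall>x\<in>{p<..<q}. F x < x) \<or> (\<forall>x\<in>{p<..<q}. x < F x)"
  proof (rule ccontr)
    assume "\<not> ?thesis"
    then obtain x y where xy: "x \<in> {p<..<q}" "y \<in> {p<..<q}" "x \<le> F x" "F y \<le> y" by force
    have cont: "continuous_on A (\<lambda>z. F z - z)" for A
      using lift_mapsD(5)[OF F] by (intro continuous_intros)
    have "\<exists>z. min x y \<le> z \<and> z \<le> max x y \<and> F z - z = 0"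
    proof (cases "x \<le> y")
      case True
      then show ?thesis using IVT2'[of "\<lambda>z. F z - z" y 0 x] xy cont by auto
    next
      case False
      then show ?thesis using IVT'[of "\<lambda>z. F z - z" y 0 x] xy cont by auto
    qed
    then obtain z where "min x y \<le> z" "z \<le> max x y" "F z = z" by auto
    with xy orbitalD(4)[OF o, of z] show False by (auto simp: min_def max_def split: if_splits)
  qed
  then show thesis
  proof
    assume "\<forall>x\<in>{p<..<q}. F x < x"
    then show thesis using that[of F] F o by simp
  next
    assume up: "\<forall>x\<in>{p<..<q}. x < F x"
    have "finv F x < x" if "p < x" "x < q" for x
    proof -
      have "p < finv F x" "finv F x < q"
        using that orbitalD(2,3)[OF oi] lift_map_less(1)[OF inv_lift_map[OF F]] by metis+
      then show ?thesis using up lift_map_inv(1)[OF F, of x] by force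
    qed
    then show thesis using that[of "finv F"] inv_lift_map[OF F] oi by simp
  qed
qed

lemma funpow_orbital:
  assumes "G \<in> lift_maps" "orbital G p q" "p < y" "y < q"
  shows "p < (G ^^ n) y" "(G ^^ n) y < q"
proof (induction n)
  case (Suc n)
  { case 1 show ?case using Suc lift_map_less(1)[OF assms(1)] orbitalD(2)[OF assms(2)] by (metis comp_apply funpow.simps(2)) }
  { case 2 show ?case using Suc lift_map_less(1)[OF assms(1)] orbitalD(3)[OF assms(2)] by (metis comp_apply funpow.simps(2)) }
qed (use assms in auto)

lemma contracting_iterates:
  assumes G: "G \<in> lift_maps" and o: "orbital G p q"
    and down: "\<And>x. p < x \<Longrightarrow> x < q \<Longrightarrow> G x < x"
    and y: "p < y" "y < q" and e: "e > 0"
  obtains n where "p < (G ^^ n) y" "(G ^^ n) y < p + e"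
proof -
  note b = funpow_orbital[OF G o y]
  have "decseq (\<lambda>n. (G ^^ n) y)" using b down by (intro decseq_SucI) (simp add: less_imp_le)
  then obtain l where l: "(\<lambda>n. (G ^^ n) y) \<longlonglongrightarrow> l" "\<And>n. l \<le> (G ^^ n) y"
    using decseq_convergent[of "\<lambda>n. (G ^^ n) y" p] b(1) by (metis less_imp_le)
  have "p \<le> l" using l(1) b(1) by (intro LIMSEQ_le_const) (auto intro: less_imp_le)
  moreover have "l < q" using l(2)[of 0] y by simp
  moreover have "G l = l" using G l(1) by (rule limit_of_iterates_fixed)
  ultimately have "l = p" using down by (metis less_le)
  then have "eventually (\<lambda>n. (G ^^ n) y < p + e) sequentially"
    using l(1) e by (intro order_tendstoD) auto
  then show thesis using that b by (auto simp: eventually_sequentially)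
qed

lemma funpow_commute:
  assumes "F \<circ> G = G \<circ> F"
  shows "F ((G ^^ n) y) = (G ^^ n) (F y)"
proof (induction n)
  case (Suc n)
  then show ?case using fun_cong[OF assms, of "(G ^^ n) y"] by simp
qed simp

lemma finv_commute:
  assumes "G \<in> lift_maps" "F \<circ> G = G \<circ> F"
  shows "F \<circ> finv G = finv G \<circ> F"
proof
  fix x
  have "G (F (finv G x)) = F x" using fun_cong[OF assms(2), of "finv G x"] assms(1) by simp
  then show "(F \<circ> finv G) x = (finv G \<circ> F) x" using lift_map_inv(2)[OF assms(1)] by (metis comp_apply)
qed

lemma fixed_germ:
  fixes F :: "real \<Rightarrow> real"
  assumes "right_affine F p" "F p = p" and acc: "\<And>e. e > 0 \<Longrightarrow> \<exists>y. p < y \<and> y < p + e \<and> F y = y"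
  obtains e where "e > 0" "\<And>y. p \<le> y \<Longrightarrow> y \<le> p + e \<Longrightarrow> F y = y"
proof -
  obtain d v where d: "d > 0" "\<forall>s\<in>{0..d}. F (p + s) = F p + s *\<^sub>R v"
    using assms(1) by (auto simp: right_affine_def)
  obtain y where y: "p < y" "y < p + d" "F y = y" using acc[OF d(1)] by blast
  then have "y = p + (y - p) * v" using bspec[OF d(2), of "y - p"] assms(2) by simp
  then have "(y - p) * (v - 1) = 0" by (simp add: algebra_simps)
  then have "v = 1" using y by simp
  then have "F z = z" if "p \<le> z" "z \<le> p + d" for z
    using bspec[OF d(2), of "z - p"] assms(2) that by simp
  with d(1) show thesis by (rule that)
qed

text \<open>Iterates of \<open>F\<close> spread a fixed point of a commuting map towards the end \<open>p\<close>, where an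
  affine germ with a second fixed point is the identity; iterating back spreads the identity
  over the whole orbital.\<close>

lemma commuting_identity_on_orbital:
  assumes F: "F \<in> lift_maps" and H: "H \<in> lift_maps" and comm: "H \<circ> F = F \<circ> H"
    and o: "orbital F p q" and Hp: "H p = p" and y: "p < y" "y < q" "H y = y"
    and z: "p < z" "z < q"
  shows "H z = z"
proof -
  obtain G where G: "G = F \<or> G = finv F" "G \<in> lift_maps" "orbital G p q"
    "\<And>x. p < x \<Longrightarrow> x < q \<Longrightarrow> G x < x"
    using orbital_contracting[OF F o] by blast
  have HG: "H \<circ> G = G \<circ> H" using G(1) comm finv_commute[OF F comm] by blast
  have "\<exists>x. p < x \<and> x < p + e \<and> H x = x" if e: "e > 0" for e
  proof -
    obtain n where "p < (G ^^ n) y" "(G ^^ n) y < p + e"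
      using contracting_iterates[OF G(2,3,4) y(1,2) e] by blast
    moreover have "H ((G ^^ n) y) = (G ^^ n) y" using funpow_commute[OF HG] y(3) by simp
    ultimately show ?thesis by blast
  qed
  then obtain e where e: "e > 0" "\<And>x. p \<le> x \<Longrightarrow> x \<le> p + e \<Longrightarrow> H x = x"
    using fixed_germ[OF locally_plD(1)[OF lift_mapsD(3)[OF H]] Hp] by blast
  obtain n where "p < (G ^^ n) z" "(G ^^ n) z < p + e"
    using contracting_iterates[OF G(2,3,4) z e(1)] by blast
  then have "H ((G ^^ n) z) = (G ^^ n) z" using e(2) by simp
  then have "(G ^^ n) (H z) = (G ^^ n) z" unfolding funpow_commute[OF HG] .
  then show ?thesis using lift_map_less(3)[OF funpow_lift_map[OF G(2)]] by simp
qed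

lemma orbital_conjugate:
  assumes R: "R \<in> lift_maps" and "orbital F p q"
  shows "orbital (R \<circ> F \<circ> finv R) (R p) (R q)"
proof -
  have "p < finv R x \<longleftrightarrow> R p < x" "finv R x < q \<longleftrightarrow> x < R q" for x
    using lift_map_less(1)[OF R] lift_map_inv(1)[OF R] by metis+
  then show ?thesis
    using assms(2) lift_map_less[OF R] lift_map_inv[OF R] unfolding orbital_def comp_apply by metis
qed

lemma orbital_commute_image:
  assumes "R \<in> lift_maps" "R \<circ> F = F \<circ> R" "orbital F p q"
  shows "orbital F (R p) (R q)"
proof -
  have "R \<circ> F \<circ> finv R = F"
    using assms(1,2) by (metis comp_assoc comp_id lift_map_inv(3))
  then show ?thesis using orbital_conjugate[OF assms(1,3)] by simp
qed

text \<open>If \<open>H\<close> moved \<open>p\<close>, the left ends of infinitely many orbitals of \<open>F\<close> would accumulate at a point to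
  the right of which \<open>F\<close> is affine, hence the identity.\<close>

lemma commuting_fixes_orbital_ends:
  assumes F: "F \<in> lift_maps" and H: "H \<in> lift_maps" and comm: "H \<circ> F = F \<circ> H"
    and o: "orbital F p q" and c: "H c = c"
  shows "H p = p" "H q = q"
proof -
  show Hp: "H p = p"
  proof (rule ccontr)
    assume "H p \<noteq> p"
    then obtain u v where uv: "orbital H u v" "u < p" "p < v" using orbital_exists[OF H c] by blast
    obtain G where G: "G = H \<or> G = finv H" "G \<in> lift_maps" "orbital G u v"
      "\<And>x. u < x \<Longrightarrow> x < v \<Longrightarrow> G x < x"
      using orbital_contracting[OF H uv(1)] by blast
    have GF: "G \<circ> F = F \<circ> G" using G(1) comm finv_commute[OF H comm[symmetric]] by metis
    have orb: "orbital F ((G ^^ n) p) ((G ^^ n) q)" for n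
    proof -
      have "(G ^^ n) \<circ> F = F \<circ> (G ^^ n)" using funpow_commute[OF GF[symmetric]] by (auto simp: fun_eq_iff)
      then show ?thesis using orbital_commute_image[OF funpow_lift_map[OF G(2)]] o by blast
    qed
    have acc: "\<exists>n. u < (G ^^ n) p \<and> (G ^^ n) p < u + e" if "e > 0" for e
      using contracting_iterates[OF G(2,3,4) uv(2,3) that] by blast
    have "F u = u"
    proof -
      have n: "(\<lambda>n. (G ^^ n) p) \<longlonglongrightarrow> u"
      proof -
        note b = funpow_orbital[OF G(2,3) uv(2,3)]
        have dec: "decseq (\<lambda>n. (G ^^ n) p)" using b G(4) by (intro decseq_SucI) (simp add: less_imp_le)
        have "eventually (\<lambda>n. dist ((G ^^ n) p) u < e) sequentially" if e: "e > 0" for e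
        proof -
          obtain m where m: "(G ^^ m) p < u + e" using acc[OF e] by blast
          show ?thesis
            unfolding eventually_sequentially
          proof (intro exI allI impI)
            fix n assume "m \<le> n"
            then have "(G ^^ n) p \<le> (G ^^ m) p" by (rule decseqD[OF dec])
            then show "dist ((G ^^ n) p) u < e" using b(1)[of n] m by (simp add: dist_real_def)
          qed
        qed
        then show ?thesis by (simp add: tendsto_iff)
      qed
      then have "(\<lambda>n. F ((G ^^ n) p)) \<longlonglongrightarrow> F u"
        by (rule isCont_tendsto_compose[OF lift_mapsD(4)[OF F]])
      then have "(\<lambda>n. (G ^^ n) p) \<longlonglongrightarrow> F u" by (simp only: orbitalD(2)[OF orb])
      then show ?thesis using n by (rule LIMSEQ_unique)
    qed
    moreover have "\<exists>y. u < y \<and> y < u + e \<and> F y = y" if "e > 0" for e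
      using acc[OF that] orbitalD(2)[OF orb] by blast
    ultimately obtain e where e: "e > 0" "\<And>y. u \<le> y \<Longrightarrow> y \<le> u + e \<Longrightarrow> F y = y"
      using fixed_germ[OF locally_plD(1)[OF lift_mapsD(3)[OF F]]] by blast
    obtain n where n: "u < (G ^^ n) p" "(G ^^ n) p < u + e" using acc[OF e(1)] by blast
    define r where "r = min (u + e) (((G ^^ n) p + (G ^^ n) q) / 2)"
    have "(G ^^ n) p < r" "r < (G ^^ n) q" "r \<le> u + e" "u \<le> r"
      using n orbitalD(1)[OF orb[of n]] by (auto simp: r_def min_def)
    then show False using e(2)[of r] orbitalD(4)[OF orb[of n], of r] by blast
  qed
  have "orbital F p (H q)" using orbital_commute_image[OF H comm o] Hp by simp
  then show "H q = q" using orbital_disjoint[OF o, of p "H q"] o orbitalD(1) by fastforce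
qed

lemma commuting_common_fixed_point:
  assumes F: "F \<in> lift_maps" and H: "H \<in> lift_maps" and comm: "H \<circ> F = F \<circ> H"
    and "F a = a" "H b = b"
  obtains c where "F c = c" "H c = c"
proof (cases "F b = b")
  case False
  then obtain p q where "orbital F p q" using orbital_exists[OF F assms(4)] by blast
  then show thesis using commuting_fixes_orbital_ends[OF F H comm _ assms(5)] orbitalD(2) that by blast
qed (use assms that in blast)

text \<open>A conjugation fixing the end \<open>p\<close> does not change the slope of the germ at \<open>p\<close>, so \<open>F\<close> and
  its conjugate agree near \<open>p\<close>; as they commute, they agree on the orbital.\<close>

lemma commuting_conjugate_eq_on_orbital:
  assumes F: "F \<in> lift_maps" and R: "R \<in> lift_maps"
    and o: "orbital F p q" and Rp: "R p = p"
    and comm: "F \<circ> (R \<circ> F \<circ> finv R) = (R \<circ> F \<circ> finv R) \<circ> F"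
    and z: "p < z" "z < q"
  shows "R (F (finv R z)) = F z"
proof -
  let ?C = "R \<circ> F \<circ> finv R"
  have C: "?C \<in> lift_maps" by (intro compose_lift_map F R inv_lift_map)
  have slope: "\<exists>d>0. \<exists>v>0. \<forall>s\<in>{0..d}. H (p + s) = p + s * v" if H: "H \<in> lift_maps" "H p = p" for H
  proof -
    obtain d v where d: "d > 0" "\<forall>s\<in>{0..d}. H (p + s) = H p + s *\<^sub>R v"
      using locally_plD(1)[OF lift_mapsD(3)[OF H(1)], of p] by (auto simp: right_affine_def)
    have "p < p + d * v"
      using bspec[OF d(2), of d] d(1) H lift_map_less(1)[OF H(1), of p "p + d"] by simp
    then have "v > 0" using d(1) by (simp add: zero_less_mult_iff)
    with d H(2) show ?thesis by auto
  qed
  obtain d v where d: "d > 0" "v > 0" "\<And>s. s \<in> {0..d} \<Longrightarrow> F (p + s) = p + s * v"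
    using slope[OF F orbitalD(2)[OF o]] by blast
  obtain e w where e: "e > 0" "w > 0" "\<And>s. s \<in> {0..e} \<Longrightarrow> R (p + s) = p + s * w"
    using slope[OF R Rp] by blast
  \<comment> \<open>So small that both orders of applying the two germs at \<open>p + s\<close> stay within their domains.\<close>
  define s where "s = Min {d, e, d / w, e / v, (q - p) / (2 * w)}"
  have s: "0 < s" "s \<le> d" "s \<le> e" "s \<le> d / w" "s \<le> e / v" "s \<le> (q - p) / (2 * w)"
    using d e orbitalD(1)[OF o] by (auto simp: s_def)
  then have s': "0 < s * w" "s * w \<le> d" "0 < s * v" "s * v \<le> e" "s * w \<le> (q - p) / 2"
    using d e by (auto simp: field_simps)
  define y where "y = p + s * w"
  have y: "p < y" "y < q" using s' orbitalD(1)[OF o] by (auto simp: y_def)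
  have "R (p + s) = y" using e(3)[of s] s by (simp add: y_def)
  then have "?C y = R (F (p + s))" using lift_map_inv(2)[OF R, of "p + s"] by simp
  also have "\<dots> = p + s * v * w" using d(3)[of s] e(3)[of "s * v"] s s' by simp
  also have "\<dots> = F y" using d(3)[of "s * w"] s' by (simp add: y_def)
  finally have Cy: "?C y = F y" .
  let ?D = "finv F \<circ> ?C"
  have "?D \<in> lift_maps" by (intro compose_lift_map C inv_lift_map F)
  moreover have "?D \<circ> F = F \<circ> ?D"
  proof -
    have "?D \<circ> F = finv F \<circ> (F \<circ> ?C)" using comm by (simp add: comp_assoc)
    also have "\<dots> = ?C" using lift_map_inv(4)[OF F] by (metis comp_assoc id_comp)
    also have "\<dots> = F \<circ> ?D" using lift_map_inv(3)[OF F] by (metis comp_assoc id_comp)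
    finally show ?thesis .
  qed
  moreover have "?D p = p" "?D y = y"
    using Cy lift_map_inv(2)[OF F] Rp lift_map_inv(2)[OF R, of p] orbitalD(2)[OF o] by (auto, metis)
  ultimately have "?D z = z" using commuting_identity_on_orbital[OF F _ _ o _ y _ z] by blast
  then show ?thesis using lift_map_inv(1)[OF F] by (metis comp_apply)
qed

lemma affine_two_fixed_points_identity:
  fixes F :: "real \<Rightarrow> real"
  assumes "\<And>y. a \<le> y \<Longrightarrow> y \<le> b \<Longrightarrow> F y = c + (y - a) * v"
    "a \<le> x" "x < x'" "x' \<le> b" "F x = x" "F x' = x'" "a \<le> y" "y \<le> b"
  shows "F y = y"
proof -
  have "c + (x - a) * v = x" "c + (x' - a) * v = x'" using assms by (metis less_imp_le order_trans)+
  then have "(x' - x) * v = (x' - x) * 1" by (simp add: algebra_simps)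
  then have "v = 1" using assms(3) by (metis less_irrefl mult_cancel_left right_minus_eq)
  then show ?thesis using assms(1)[of y] assms(7,8) \<open>c + (x - a) * v = x\<close> by simp
qed

lemma finite_orbitals_affine:
  fixes F :: "real \<Rightarrow> real"
  assumes aff: "\<And>y. a \<le> y \<Longrightarrow> y \<le> b \<Longrightarrow> F y = c + (y - a) * v"
  shows "finite {p. a \<le> p \<and> p \<le> b \<and> (\<exists>q. orbital F p q)}" (is "finite ?A")
proof -
  have le: "x' \<le> x" if x: "x \<in> ?A" "x' \<in> ?A" for x x'
  proof (rule ccontr)
    assume "\<not> x' \<le> x"
    obtain q q' where o: "orbital F x q" "orbital F x' q'" using x by blast
    have xs: "a \<le> x" "x < x'" "x' \<le> b" using x \<open>\<not> x' \<le> x\<close> by auto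
    have "F y = y" if "a \<le> y" "y \<le> b" for y
      by (rule affine_two_fixed_points_identity[where a = a and b = b and x = x and x' = x'])
        (use xs aff that orbitalD(2)[OF o(1)] orbitalD(2)[OF o(2)] in auto)
    moreover define y where "y = min b ((x + q) / 2)"
    have "x < y" "y < q" "a \<le> y" "y \<le> b"
      using x orbitalD(1)[OF o(1)] \<open>\<not> x' \<le> x\<close> by (auto simp: y_def min_def)
    ultimately show False using orbitalD(4)[OF o(1), of y] by blast
  qed
  show ?thesis
  proof (cases "?A = {}")
    case False
    then obtain x where "x \<in> ?A" by blast
    then have "?A \<subseteq> {x}" using le by (blast intro: order_antisym)
    then show ?thesis by (rule finite_subset) simp
  qed (metis finite.emptyI)
qed

text \<open>Where \<open>F\<close> is affine it has at most one fixed point unless it is the identity, and either way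
  there is room for the left end of at most one orbital; compactness does the rest.\<close>

lemma finite_orbitals:
  assumes F: "F \<in> lift_maps"
  shows "finite {(p, q). 0 \<le> p \<and> p \<le> 1 \<and> orbital F p q}"
proof -
  let ?P = "\<lambda>a b. finite {p. a \<le> p \<and> p \<le> b \<and> (\<exists>q. orbital F p q)}"
  have "?P 0 1"
  proof (rule Bolzano[of 0 1 ?P])
    fix a b c :: real assume "?P a b" "?P b c" "a \<le> b" "b \<le> c"
    have "{p. a \<le> p \<and> p \<le> c \<and> (\<exists>q. orbital F p q)} \<subseteq>
      {p. a \<le> p \<and> p \<le> b \<and> (\<exists>q. orbital F p q)} \<union> {p. b \<le> p \<and> p \<le> c \<and> (\<exists>q. orbital F p q)}"
      by auto
    then show "?P a c" using \<open>?P a b\<close> \<open>?P b c\<close> by (meson finite_UnI finite_subset)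
  next
    fix x :: real
    obtain d v where d: "d > 0" "\<forall>s\<in>{0..d}. F (x + s) = F x + s *\<^sub>R v"
      using locally_plD(1)[OF lift_mapsD(3)[OF F], of x] by (auto simp: right_affine_def)
    obtain e w where e: "e > 0" "\<forall>s\<in>{0..e}. F (- (- x + s)) = F (- (- x)) + s *\<^sub>R w"
      using locally_plD(2)[OF lift_mapsD(3)[OF F], of "- x"] by (auto simp: right_affine_def)
    have 1: "?P x (x + d)"
    proof (rule finite_orbitals_affine)
      show "F y = F x + (y - x) * v" if "x \<le> y" "y \<le> x + d" for y
        using bspec[OF d(2), of "y - x"] that by simp
    qed
    have 2: "?P (x - e) x"
    proof (rule finite_orbitals_affine)
      show "F y = F x + e * w + (y - (x - e)) * (- w)" if "x - e \<le> y" "y \<le> x" for y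
        using bspec[OF e(2), of "x - y"] that by (simp add: algebra_simps)
    qed
    have "?P a b" if "a \<le> x \<and> x \<le> b \<and> b - a < min d e" for a b
      by (rule finite_subset[OF _ finite_UnI[OF 1 2]]) (use that in auto)
    then show "\<exists>d>0. \<forall>a b. a \<le> x \<and> x \<le> b \<and> b - a < d \<longrightarrow> ?P a b"
      using d(1) e(1) by (intro exI[of _ "min d e"]) auto
  qed simp
  then have "finite (fst ` {(p, q). 0 \<le> p \<and> p \<le> 1 \<and> orbital F p q})"
    by (rule finite_subset[rotated]) auto
  moreover have "inj_on fst {(p, q). 0 \<le> p \<and> p \<le> 1 \<and> orbital F p q}"
  proof (rule inj_onI)
    fix x y
    assume "x \<in> {(p, q). 0 \<le> p \<and> p \<le> 1 \<and> orbital F p q}"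
      "y \<in> {(p, q). 0 \<le> p \<and> p \<le> 1 \<and> orbital F p q}" "fst x = fst y"
    then have o: "orbital F (fst x) (snd x)" "orbital F (fst x) (snd y)" by auto
    have "snd x = snd y" using orbital_disjoint[OF o] orbitalD(1)[OF o(1)] orbitalD(1)[OF o(2)] by linarith
    with \<open>fst x = fst y\<close> show "x = y" by (simp add: prod_eq_iff)
  qed
  ultimately show ?thesis by (rule finite_imageD)
qed

section \<open>Bounded displacement\<close>

lemma lift_map_displacement:
  assumes F: "F \<in> lift_maps"
  obtains d :: int where "d \<ge> 0" "\<And>x. \<bar>F x - x\<bar> \<le> of_int d"
proof
  fix x :: real
  let ?k = "\<lfloor>x\<rfloor>"
  have "F (0 + of_int ?k) \<le> F x" "F x \<le> F (0 + of_int (?k + 1))"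
    unfolding lift_map_less(2)[OF F] by (simp; linarith)+
  then have "F 0 + of_int ?k \<le> F x" "F x \<le> F 0 + of_int (?k + 1)"
    unfolding lift_map_add_int[OF F] .
  moreover have "\<bar>F 0\<bar> \<le> of_int \<lceil>\<bar>F 0\<bar>\<rceil>" by simp
  moreover have "of_int ?k \<le> x" "x < of_int ?k + 1" by linarith+
  ultimately show "\<bar>F x - x\<bar> \<le> of_int (\<lceil>\<bar>F 0\<bar>\<rceil> + 1)" unfolding of_int_add of_int_1 by linarith
qed simp

lemma lift_map_near:
  assumes "F \<in> lift_maps" "\<bar>x - y\<bar> \<le> of_int d"
  shows "\<bar>F x - F y\<bar> \<le> of_int d"
proof -
  have "F x \<le> F (y + of_int d)" "F y \<le> F (x + of_int d)"
    using assms(2) unfolding lift_map_less(2)[OF assms(1)] by linarith+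
  then show ?thesis unfolding lift_map_add_int[OF assms(1)] by linarith
qed

lemma conjugation_displacement:
  assumes R: "R \<in> lift_maps"
  obtains d :: int where "\<And>X x. X \<in> lift_maps \<Longrightarrow> \<bar>R (X (finv R x)) - X x\<bar> \<le> of_int d"
proof -
  obtain d where d: "\<And>x. \<bar>R x - x\<bar> \<le> of_int d" using lift_map_displacement[OF R] by blast
  have "\<bar>R (X (finv R x)) - X x\<bar> \<le> of_int (2 * d)" if X: "X \<in> lift_maps" for X x
  proof -
    have "\<bar>finv R x - x\<bar> \<le> of_int d" using d[of "finv R x"] R by (simp add: abs_minus_commute)
    then have "\<bar>X (finv R x) - X x\<bar> \<le> of_int d" by (rule lift_map_near[OF X])
    with d[of "X (finv R x)"] show ?thesis by simp
  qed
  then show thesis by (rule that)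
qed

text \<open>If \<open>G\<close> and \<open>H\<close> commute up to a translation by \<open>k\<close>, then \<open>G ^^ n\<close> and \<open>H\<close> commute up
  to a translation by \<open>n * k\<close>, whereas the displacement of \<open>H\<close> is bounded.\<close>

lemma commute_up_to_translation:
  assumes G: "G \<in> lift_maps" and H: "H \<in> lift_maps"
    and comm: "\<And>x. H (G x) = G (H x) + of_int k"
  shows "k = 0"
proof -
  obtain d where d: "d \<ge> 0" "\<And>x. \<bar>H x - x\<bar> \<le> of_int d" using lift_map_displacement[OF H] by blast
  have iter: "H ((G ^^ n) x) = (G ^^ n) (H x) + of_int (int n * k)" for n x
  proof (induction n)
    case (Suc n)
    have "H (G ((G ^^ n) x)) = G ((G ^^ n) (H x) + of_int (int n * k)) + of_int k"
      using comm Suc by simp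
    then show ?case unfolding lift_map_add_int[OF G] by (simp add: algebra_simps)
  qed simp
  define n where "n = nat (2 * d + 1)"
  have "\<bar>(G ^^ n) (H 0) - (G ^^ n) 0\<bar> \<le> of_int d"
    using lift_map_near[OF funpow_lift_map[OF G]] d(2) by blast
  moreover have "\<bar>H ((G ^^ n) 0) - (G ^^ n) 0\<bar> \<le> of_int d" by (rule d(2))
  ultimately have "\<bar>of_int (int n * k) :: real\<bar> \<le> of_int (2 * d)" unfolding iter by simp
  then have "\<bar>int n * k\<bar> \<le> 2 * d" by linarith
  then have "(2 * d + 1) * \<bar>k\<bar> \<le> 2 * d" using d(1) by (simp add: n_def abs_mult)
  then show "k = 0" using d(1) by (smt (verit) mult_le_cancel_left1)
qed

text \<open>If \<open>G\<close> exceeded its conjugate \<open>H\<close> everywhere, by periodicity it would do so by a definite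
  amount at each iteration, whereas \<open>G ^^ n\<close> and \<open>H ^^ n\<close> are boundedly close.\<close>

lemma commuting_conjugate_not_above:
  assumes G: "G \<in> lift_maps" and R: "R \<in> lift_maps" and HR: "H = R \<circ> G \<circ> finv R"
    and comm: "G \<circ> H = H \<circ> G"
  shows "\<exists>x. G x \<le> H x"
proof (rule ccontr)
  assume "\<not> ?thesis"
  then have above: "H x < G x" for x by (meson not_le)
  have H: "H \<in> lift_maps" unfolding HR by (intro compose_lift_map G R inv_lift_map)
  have Hn: "(H ^^ n) x = R ((G ^^ n) (finv R x))" for n x
    by (induction n) (use R in \<open>auto simp: HR\<close>)
  have "continuous_on {0..1} (\<lambda>x. G x - H x)"
    by (intro continuous_intros lift_mapsD G H)
  then obtain c where c: "c \<in> {0..1}" "\<And>x. x \<in> {0..1} \<Longrightarrow> G c - H c \<le> G x - H x"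
    using continuous_attains_inf[of "{0..1::real}" "\<lambda>x. G x - H x"] by auto
  define e where "e = G c - H c"
  have "e > 0" using above by (simp add: e_def)
  have gap: "H x + e \<le> G x" for x
  proof -
    have "x - of_int \<lfloor>x\<rfloor> \<in> {0..1}" by (simp; linarith)
    from c(2)[OF this] show ?thesis unfolding e_def lift_map_diff_int[OF G] lift_map_diff_int[OF H] by simp
  qed
  define D where "D = G \<circ> finv H"
  have D: "D \<in> lift_maps" unfolding D_def by (intro compose_lift_map G inv_lift_map H)
  have GD: "G = D \<circ> H" unfolding D_def using lift_map_inv(4)[OF H] by (metis comp_assoc comp_id)
  have DH: "H \<circ> D = D \<circ> H"
  proof -
    have "H \<circ> D = (G \<circ> H) \<circ> finv H" unfolding D_def comm by (simp add: comp_assoc)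
    also have "\<dots> = G" using lift_map_inv(3)[OF H] by (metis comp_assoc comp_id)
    finally show ?thesis using GD by simp
  qed
  have Gn: "(G ^^ n) x = (D ^^ n) ((H ^^ n) x)" for n x
  proof (induction n)
    case (Suc n)
    have "(G ^^ Suc n) x = D (H ((D ^^ n) ((H ^^ n) x)))" using Suc fun_cong[OF GD] by (metis comp_apply funpow.simps(2))
    also have "\<dots> = D ((D ^^ n) (H ((H ^^ n) x)))" unfolding funpow_commute[OF DH] ..
    finally show ?case by simp
  qed simp
  have Dn: "x + of_nat n * e \<le> (D ^^ n) x" for n x
  proof (induction n)
    case (Suc n)
    have "y + e \<le> D y" for y using gap[of "finv H y"] H by (simp add: D_def)
    from this[of "(D ^^ n) x"] show ?case using Suc by (simp add: algebra_simps)
  qed simp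
  obtain d :: int where d: "\<And>X x. X \<in> lift_maps \<Longrightarrow> \<bar>R (X (finv R x)) - X x\<bar> \<le> of_int d"
    using conjugation_displacement[OF R] by blast
  obtain n :: nat where "of_int d < of_nat n * e"
    using reals_Archimedean3[OF \<open>e > 0\<close>] by blast
  moreover have "\<bar>(H ^^ n) 0 - (G ^^ n) 0\<bar> \<le> of_int d"
    unfolding Hn by (rule d[OF funpow_lift_map[OF G]])
  moreover have "(H ^^ n) 0 + of_nat n * e \<le> (G ^^ n) 0" unfolding Gn by (rule Dn)
  ultimately show False by linarith
qed

text \<open>As \<open>G\<close> is also a conjugate of \<open>H\<close>, neither of the two exceeds the other everywhere.\<close>

lemma commuting_conjugate_coincidence:
  assumes G: "G \<in> lift_maps" and R: "R \<in> lift_maps" and HR: "H = R \<circ> G \<circ> finv R"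
    and comm: "G \<circ> H = H \<circ> G"
  shows "\<exists>x. G x = H x"
proof -
  have H: "H \<in> lift_maps" unfolding HR by (intro compose_lift_map G R inv_lift_map)
  have inv2: "finv (finv R) = R" using bij_lift_map[OF R] by (rule inv_inv_eq)
  have GR: "G = finv R \<circ> H \<circ> finv (finv R)"
    unfolding inv2 HR using R by (simp add: fun_eq_iff)
  obtain x where x: "G x \<le> H x" using commuting_conjugate_not_above[OF G R HR comm] by blast
  obtain y where y: "H y \<le> G y"
    using commuting_conjugate_not_above[OF H inv_lift_map[OF R] GR comm[symmetric]] by blast
  have cont: "continuous_on A (\<lambda>x. G x - H x)" for A
    by (intro continuous_intros lift_mapsD G H)
  have "\<exists>z. G z - H z = 0"
  proof (cases "x \<le> y")
    case True
    then show ?thesis using IVT'[of "\<lambda>z. G z - H z" x 0 y] x y cont by auto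
  next
    case False
    then show ?thesis using IVT2'[of "\<lambda>z. G z - H z" x 0 y] x y cont by auto
  qed
  then show ?thesis by simp
qed

section \<open>Integer powers\<close>

definition zpow :: "(real \<Rightarrow> real) \<Rightarrow> int \<Rightarrow> real \<Rightarrow> real"
  where "zpow F i = (if 0 \<le> i then F ^^ nat i else finv F ^^ nat (- i))"

lemma zpow_of_nat [simp]: "zpow F (int n) = F ^^ n"
  by (simp add: zpow_def)

lemma zpow_0 [simp]: "zpow F 0 = id" and zpow_1 [simp]: "zpow F 1 = F"
  by (simp_all add: zpow_def)

lemma zpow_lift_map: "F \<in> lift_maps \<Longrightarrow> zpow F i \<in> lift_maps"
  by (simp add: zpow_def funpow_lift_map inv_lift_map)

lemma zpow_minus_of_nat: "zpow F (- int n) = finv F ^^ n"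
  by (cases "n = 0") (simp_all add: zpow_def)

lemma zpow_Suc:
  assumes F: "F \<in> lift_maps"
  shows "zpow F (i + 1) = F \<circ> zpow F i"
proof (cases "0 \<le> i")
  case True
  then obtain n where "i = int n" using nonneg_int_cases by blast
  then have "i + 1 = int (Suc n)" by simp
  then show ?thesis unfolding \<open>i = int n\<close> by (simp only: zpow_of_nat funpow.simps)
next
  case False
  then obtain n where n: "i = - int (Suc n)" using negD by (metis not_le)
  have "F \<circ> (finv F ^^ Suc n) = finv F ^^ n" using F by (simp add: fun_eq_iff)
  moreover have "i + 1 = - int n" using n by simp
  ultimately show ?thesis unfolding n by (simp only: zpow_minus_of_nat)
qed

lemma zpow_add:
  assumes F: "F \<in> lift_maps"
  shows "zpow F (i + j) = zpow F i \<circ> zpow F j"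
proof (induction i rule: int_induct[of _ 0])
  case (step1 i)
  have "zpow F (i + 1 + j) = F \<circ> zpow F (i + j)" using zpow_Suc[OF F, of "i + j"] by (simp add: algebra_simps)
  then show ?case using step1 zpow_Suc[OF F, of i] by (simp add: comp_assoc)
next
  case (step2 i)
  have "F \<circ> zpow F (i - 1 + j) = zpow F (i + j)"
    using zpow_Suc[OF F, of "i - 1 + j"] by (simp add: algebra_simps)
  also have "\<dots> = F \<circ> (zpow F (i - 1) \<circ> zpow F j)"
    using step2 zpow_Suc[OF F, of "i - 1"] by (simp add: fun_eq_iff)
  finally have "finv F \<circ> (F \<circ> zpow F (i - 1 + j)) = finv F \<circ> (F \<circ> (zpow F (i - 1) \<circ> zpow F j))" by simp
  then show ?case using lift_map_inv(4)[OF F] by (simp flip: comp_assoc)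
qed simp

lemma zpow_zpow_add: "F \<in> lift_maps \<Longrightarrow> zpow F i (zpow F j x) = zpow F (i + j) x"
  by (simp add: zpow_add)

section \<open>Wandering intervals\<close>

lemma lift_map_breakpoints_unit:
  assumes F: "F \<in> lift_maps"
  obtains X where "finite X"
    "\<And>u v. 0 \<le> u \<Longrightarrow> u < v \<Longrightarrow> v \<le> 1 \<Longrightarrow> {u<..<v} \<inter> X = {} \<Longrightarrow>
      \<exists>c w. \<forall>y\<in>{u..v}. F y = c + w * y"
proof -
  let ?P = "\<lambda>a b. \<exists>X. finite X \<and> (\<forall>u v. a \<le> u \<and> u < v \<and> v \<le> b \<and> {u<..<v} \<inter> X = {} \<longrightarrow>
      (\<exists>c w. \<forall>y\<in>{u..v}. F y = c + w * y))"
  have "?P 0 1"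
  proof (rule Bolzano[of 0 1 ?P])
    fix a b c :: real assume P: "?P a b" "?P b c"
    obtain X where X: "finite X" "\<And>u v. a \<le> u \<Longrightarrow> u < v \<Longrightarrow> v \<le> b \<Longrightarrow> {u<..<v} \<inter> X = {} \<Longrightarrow>
        \<exists>c w. \<forall>y\<in>{u..v}. F y = c + w * y" using P(1) by blast
    obtain Y where Y: "finite Y" "\<And>u v. b \<le> u \<Longrightarrow> u < v \<Longrightarrow> v \<le> c \<Longrightarrow> {u<..<v} \<inter> Y = {} \<Longrightarrow>
        \<exists>c w. \<forall>y\<in>{u..v}. F y = c + w * y" using P(2) by blast
    show "?P a c"
    proof (intro exI[of _ "insert b (X \<union> Y)"] conjI allI impI)
      fix u v assume uv: "a \<le> u \<and> u < v \<and> v \<le> c \<and> {u<..<v} \<inter> insert b (X \<union> Y) = {}"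
      then have "b \<notin> {u<..<v}" "{u<..<v} \<inter> X = {}" "{u<..<v} \<inter> Y = {}" by blast+
      then have "v \<le> b \<or> b \<le> u" by auto
      then show "\<exists>c w. \<forall>y\<in>{u..v}. F y = c + w * y"
        using uv X(2)[of u v] Y(2)[of u v] \<open>{u<..<v} \<inter> X = {}\<close> \<open>{u<..<v} \<inter> Y = {}\<close> by blast
    qed (use X(1) Y(1) in simp)
  next
    fix x :: real
    obtain d v where d: "d > 0" "\<forall>s\<in>{0..d}. F (x + s) = F x + s *\<^sub>R v"
      using locally_plD(1)[OF lift_mapsD(3)[OF F], of x] by (auto simp: right_affine_def)
    obtain e w where e: "e > 0" "\<forall>s\<in>{0..e}. F (- (- x + s)) = F (- (- x)) + s *\<^sub>R w"
      using locally_plD(2)[OF lift_mapsD(3)[OF F], of "- x"] by (auto simp: right_affine_def)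
    have 1: "F y = (F x - x * v) + v * y" if "x \<le> y" "y \<le> x + d" for y
      using bspec[OF d(2), of "y - x"] that by (simp add: algebra_simps)
    have 2: "F y = (F x + x * w) + (- w) * y" if "x - e \<le> y" "y \<le> x" for y
      using bspec[OF e(2), of "x - y"] that by (simp add: algebra_simps)
    have "?P a b" if ab: "a \<le> x \<and> x \<le> b \<and> b - a < min d e" for a b
    proof (intro exI[of _ "{x}"] conjI allI impI)
      fix u v' assume uv: "a \<le> u \<and> u < v' \<and> v' \<le> b \<and> {u<..<v'} \<inter> {x} = {}"
      then have "x \<notin> {u<..<v'}" by blast
      then consider "v' \<le> x" | "x \<le> u" by force
      then show "\<exists>c w. \<forall>y\<in>{u..v'}. F y = c + w * y"
      proof cases
        case 1
        show ?thesis
          by (intro exI[of _ "F x + x * w"] exI[of _ "- w"] ballI 2) (use 1 uv ab in auto)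
      next
        case 2
        show ?thesis
          by (intro exI[of _ "F x - x * v"] exI[of _ v] ballI 1) (use 2 uv ab in auto)
      qed
    qed simp
    then have "\<forall>a b. a \<le> x \<and> x \<le> b \<and> b - a < min d e \<longrightarrow> ?P a b" by blast
    moreover have "0 < min d e" using d(1) e(1) by simp
    ultimately show "\<exists>d>0. \<forall>a b. a \<le> x \<and> x \<le> b \<and> b - a < d \<longrightarrow> ?P a b" by blast
  qed simp
  then show thesis using that by meson
qed

text \<open>Including \<open>0\<close> among the breakpoints confines an interval that avoids them modulo \<open>1\<close> to
  a single period.\<close>

lemma lift_map_breakpoints:
  assumes F: "F \<in> lift_maps"
  obtains X where "finite X"
    "\<And>u v. u < v \<Longrightarrow> (\<And>x k. x \<in> X \<Longrightarrow> \<not> (u < x + of_int k \<and> x + of_int k < v)) \<Longrightarrow>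
      \<exists>c w. \<forall>y\<in>{u..v}. F y = c + w * y"
proof -
  obtain X where X: "finite X"
    "\<And>u v. 0 \<le> u \<Longrightarrow> u < v \<Longrightarrow> v \<le> 1 \<Longrightarrow> {u<..<v} \<inter> X = {} \<Longrightarrow>
      \<exists>c w. \<forall>y\<in>{u..v}. F y = c + w * y"
    using lift_map_breakpoints_unit[OF F] by blast
  show thesis
  proof (rule that[of "insert 0 X"])
    fix u v :: real
    assume uv: "u < v" and avoid: "\<And>x k. x \<in> insert 0 X \<Longrightarrow> \<not> (u < x + of_int k \<and> x + of_int k < v)"
    define k where "k = \<lfloor>u\<rfloor>"
    have k: "of_int k \<le> u" "u < of_int k + 1" by (simp_all add: k_def)
    have "v \<le> of_int k + 1" using avoid[of 0 "k + 1"] k by simp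
    moreover have "{u - of_int k<..<v - of_int k} \<inter> X = {}"
    proof -
      have "x \<notin> {u - of_int k<..<v - of_int k}" if "x \<in> X" for x using avoid[of x k] that by auto
      then show ?thesis by blast
    qed
    ultimately obtain c w where cw: "\<And>y. y \<in> {u - of_int k..v - of_int k} \<Longrightarrow> F y = c + w * y"
      using X(2)[of "u - of_int k" "v - of_int k"] uv k by auto
    have "F y = (c + of_int k - w * of_int k) + w * y" if "y \<in> {u..v}" for y
      using cw[of "y - of_int k"] that by (auto simp: lift_map_diff_int[OF F] algebra_simps)
    then show "\<exists>c w. \<forall>y\<in>{u..v}. F y = c + w * y" by blast
  qed (use X(1) in simp)
qed

lemma lift_map_lipschitz:
  assumes F: "F \<in> lift_maps"
  obtains M where "M > 0" "\<And>x y. x \<le> y \<Longrightarrow> y \<le> x + 1 \<Longrightarrow> F y - F x \<le> M * (y - x)"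
proof -
  let ?P = "\<lambda>a b. \<exists>M>0. \<forall>x y. a \<le> x \<and> x \<le> y \<and> y \<le> b \<longrightarrow> F y - F x \<le> M * (y - x)"
  have "?P 0 2"
  proof (rule Bolzano[of 0 2 ?P])
    fix a b c :: real assume P: "?P a b" "?P b c"
    obtain M where M: "M > 0" "\<And>x y. a \<le> x \<Longrightarrow> x \<le> y \<Longrightarrow> y \<le> b \<Longrightarrow> F y - F x \<le> M * (y - x)"
      using P(1) by blast
    obtain N where N: "N > 0" "\<And>x y. b \<le> x \<Longrightarrow> x \<le> y \<Longrightarrow> y \<le> c \<Longrightarrow> F y - F x \<le> N * (y - x)"
      using P(2) by blast
    have "F y - F x \<le> (M + N) * (y - x)" if xy: "a \<le> x" "x \<le> y" "y \<le> c" for x y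
    proof -
      have le: "M * t \<le> (M + N) * t" "N * t \<le> (M + N) * t" if "t \<ge> 0" for t
        using that M(1) N(1) by (simp_all add: mult_right_mono)
      consider "y \<le> b" | "b \<le> x" | "x < b" "b < y" by linarith
      then show ?thesis
      proof cases
        case 1 then show ?thesis using M(2)[of x y] le(1)[of "y - x"] xy by simp
      next
        case 2 then show ?thesis using N(2)[of x y] le(2)[of "y - x"] xy by simp
      next
        case 3
        then have "F b - F x \<le> M * (b - x)" "F y - F b \<le> N * (y - b)" using M(2) N(2) xy by auto
        then have "F y - F x \<le> M * (b - x) + N * (y - b)" by simp
        also have "\<dots> \<le> (M + N) * (b - x) + (M + N) * (y - b)" using le 3 by (intro add_mono) auto
        finally show ?thesis by (simp add: algebra_simps)
      qed
    qed
    then show "?P a c" using M(1) N(1) by (intro exI[of _ "M + N"]) auto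
  next
    fix x :: real
    obtain d v where d: "d > 0" "\<forall>s\<in>{0..d}. F (x + s) = F x + s *\<^sub>R v"
      using locally_plD(1)[OF lift_mapsD(3)[OF F], of x] by (auto simp: right_affine_def)
    obtain e w where e: "e > 0" "\<forall>s\<in>{0..e}. F (- (- x + s)) = F (- (- x)) + s *\<^sub>R w"
      using locally_plD(2)[OF lift_mapsD(3)[OF F], of "- x"] by (auto simp: right_affine_def)
    have 1: "F y = F x + (y - x) * v" if "x \<le> y" "y \<le> x + d" for y
      using bspec[OF d(2), of "y - x"] that by simp
    have 2: "F y = F x - (y - x) * w" if "x - e \<le> y" "y \<le> x" for y
      using bspec[OF e(2), of "x - y"] that by (simp add: algebra_simps)
    define M where "M = \<bar>v\<bar> + \<bar>w\<bar> + 1"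
    have le: "v * t \<le> M * t" "(- w) * t \<le> M * t" if "t \<ge> 0" for t
      by (rule mult_right_mono[OF _ that]; simp add: M_def)+
    have main: "F z - F y \<le> M * (z - y)" if yz: "x - e \<le> y" "y \<le> z" "z \<le> x + d" for y z
    proof -
      consider "z \<le> x" | "x \<le> y" | "y < x" "x < z" by linarith
      then show ?thesis
      proof cases
        case A: 1
        then have "F z - F y = (- w) * (z - y)" using 2[of y] 2[of z] yz by (simp add: algebra_simps)
        then show ?thesis using le(2)[of "z - y"] yz by simp
      next
        case A: 2
        then have "F z - F y = v * (z - y)" using 1[of y] 1[of z] yz by (simp add: algebra_simps)
        then show ?thesis using le(1)[of "z - y"] yz by simp
      next
        case 3
        then have "F z - F y = (- w) * (x - y) + v * (z - x)"
          using 2[of y] 1[of z] yz by (simp add: algebra_simps)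
        also have "\<dots> \<le> M * (x - y) + M * (z - x)" using le 3 by (intro add_mono) auto
        finally show ?thesis by (simp add: algebra_simps)
      qed
    qed
    have "M > 0" by (simp add: M_def add_nonneg_pos)
    then have "?P a b" if "a \<le> x \<and> x \<le> b \<and> b - a < min d e" for a b
      using that by (intro exI[of _ M] conjI allI impI main) auto
    then have "\<forall>a b. a \<le> x \<and> x \<le> b \<and> b - a < min d e \<longrightarrow> ?P a b" by blast
    moreover have "0 < min d e" using d(1) e(1) by simp
    ultimately show "\<exists>d>0. \<forall>a b. a \<le> x \<and> x \<le> b \<and> b - a < d \<longrightarrow> ?P a b" by blast
  qed simp
  then obtain M where M: "M > 0" "\<And>x y. 0 \<le> x \<Longrightarrow> x \<le> y \<Longrightarrow> y \<le> 2 \<Longrightarrow> F y - F x \<le> M * (y - x)"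
    by blast
  have "F y - F x \<le> M * (y - x)" if xy: "x \<le> y" "y \<le> x + 1" for x y
  proof -
    have "of_int \<lfloor>x\<rfloor> \<le> x" "y - of_int \<lfloor>x\<rfloor> \<le> 2" using xy by linarith+
    then show ?thesis
      using M(2)[of "x - of_int \<lfloor>x\<rfloor>" "y - of_int \<lfloor>x\<rfloor>"] xy
      by (simp add: lift_map_diff_int[OF F])
  qed
  with M(1) show thesis by (rule that)
qed

text \<open>Denjoy's distortion estimate. While the images of \<open>{u..v}\<close> stay disjoint on the circle, each
  breakpoint of \<open>F\<close> lies in at most one of them. On all other images \<open>F\<close> is affine and scales both
  subintervals by the same factor.\<close>

lemma bounded_distortion:
  assumes F: "F \<in> lift_maps"
  shows "\<exists>\<kappa>>0. \<forall>n u v x x' y y'.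
    (\<forall>i<n. \<forall>j<n. \<forall>k. i \<noteq> j \<longrightarrow>
        (F ^^ i) v \<le> (F ^^ j) u + of_int k \<or> (F ^^ j) v + of_int k \<le> (F ^^ i) u) \<and>
    v \<le> u + 1 \<and> u \<le> x \<and> x < x' \<and> x' \<le> v \<and> u \<le> y \<and> y < y' \<and> y' \<le> v \<longrightarrow>
    \<kappa> * ((F ^^ n) x' - (F ^^ n) x) * (y' - y) \<le> ((F ^^ n) y' - (F ^^ n) y) * (x' - x)"
proof -
  obtain X where X: "finite X"
    "\<And>u v. u < v \<Longrightarrow> (\<And>x k. x \<in> X \<Longrightarrow> \<not> (u < x + of_int k \<and> x + of_int k < v)) \<Longrightarrow>
      \<exists>c w. \<forall>y\<in>{u..v}. F y = c + w * y"
    using lift_map_breakpoints[OF F] by blast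
  obtain M where M: "M > 0" "\<And>x y. x \<le> y \<Longrightarrow> y \<le> x + 1 \<Longrightarrow> F y - F x \<le> M * (y - x)"
    using lift_map_lipschitz[OF F] by blast
  obtain M' where M': "M' > 0"
    "\<And>x y. x \<le> y \<Longrightarrow> y \<le> x + 1 \<Longrightarrow> finv F y - finv F x \<le> M' * (y - x)"
    using lift_map_lipschitz[OF inv_lift_map[OF F]] by blast
  \<comment> \<open>The comparison of the two subintervals loses at most this factor where \<open>F\<close> is not affine.\<close>
  define \<rho> where "\<rho> = min 1 (1 / (M * M'))"
  have \<rho>: "0 < \<rho>" "\<rho> \<le> 1" "\<rho> * M * M' \<le> 1"
    using M(1) M'(1) by (auto simp: \<rho>_def min_def field_simps)
  show ?thesis
  proof (intro exI[of _ "\<rho> ^ card X"] conjI allI impI)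
    fix n u v x x' y y'
    assume *: "(\<forall>i<n. \<forall>j<n. \<forall>k. i \<noteq> j \<longrightarrow>
        (F ^^ i) v \<le> (F ^^ j) u + of_int k \<or> (F ^^ j) v + of_int k \<le> (F ^^ i) u) \<and>
      v \<le> u + 1 \<and> u \<le> x \<and> x < x' \<and> x' \<le> v \<and> u \<le> y \<and> y < y' \<and> y' \<le> v"
    then have disj: "i < n \<Longrightarrow> j < n \<Longrightarrow> i \<noteq> j \<Longrightarrow>
        (F ^^ i) v \<le> (F ^^ j) u + of_int k \<or> (F ^^ j) v + of_int k \<le> (F ^^ i) u" for i j k
      by blast
    have vu: "v \<le> u + 1" and x: "u \<le> x" "x < x'" "x' \<le> v" and y: "u \<le> y" "y < y'" "y' \<le> v"
      using * by blast+
    note mono = lift_map_less[OF funpow_lift_map[OF F]]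
    define hit where "hit b i \<longleftrightarrow> (\<exists>k. (F ^^ i) u < b + of_int k \<and> b + of_int k < (F ^^ i) v)" for b i
    define bad where "bad i \<longleftrightarrow> (\<exists>b\<in>X. hit b i)" for i
    have card: "card {i. i < n \<and> bad i} \<le> card X"
    proof -
      have "\<forall>i. \<exists>b. bad i \<longrightarrow> b \<in> X \<and> hit b i" unfolding bad_def by blast
      then obtain f where f: "\<And>i. bad i \<Longrightarrow> f i \<in> X \<and> hit (f i) i" by metis
      have "inj_on f {i. i < n \<and> bad i}"
      proof (rule inj_onI, rule ccontr)
        fix i j assume ij: "i \<in> {i. i < n \<and> bad i}" "j \<in> {i. i < n \<and> bad i}" "f i = f j" "i \<noteq> j"
        then obtain k l where "(F ^^ i) u < f i + of_int k" "f i + of_int k < (F ^^ i) v"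
          "(F ^^ j) u < f i + of_int l" "f i + of_int l < (F ^^ j) v"
          using f[of i] f[of j] unfolding hit_def by auto
        then show False using disj[of i j "k - l"] ij by auto
      qed
      then show ?thesis using f X(1) by (intro card_inj_on_le[of f]) auto
    qed
    have step: "\<rho> ^ card {i. i < m \<and> bad i} * ((F ^^ m) x' - (F ^^ m) x) * (y' - y)
        \<le> ((F ^^ m) y' - (F ^^ m) y) * (x' - x)" if "m \<le> n" for m
      using that
    proof (induction m)
      case 0
      then show ?case by simp
    next
      case (Suc m)
      let ?x = "(F ^^ m) x" and ?x' = "(F ^^ m) x'" and ?y = "(F ^^ m) y" and ?y' = "(F ^^ m) y'"
      let ?c = "\<rho> ^ card {i. i < m \<and> bad i}"
      have IH: "?c * (?x' - ?x) * (y' - y) \<le> (?y' - ?y) * (x' - x)" using Suc by simp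
      have in_uv: "(F ^^ m) u \<le> ?x" "?x' \<le> (F ^^ m) v" "(F ^^ m) u \<le> ?y" "?y' \<le> (F ^^ m) v"
        "?x < ?x'" "?y < ?y'"
        using x y unfolding mono by auto
      show ?case
      proof (cases "bad m")
        case False
        then have c: "{i. i < Suc m \<and> bad i} = {i. i < m \<and> bad i}" by (auto simp: less_Suc_eq)
        obtain c w where cw: "\<And>z. z \<in> {(F ^^ m) u..(F ^^ m) v} \<Longrightarrow> F z = c + w * z"
          using X(2)[of "(F ^^ m) u" "(F ^^ m) v"] False in_uv unfolding bad_def hit_def by force
        have scale: "F ?x' - F ?x = w * (?x' - ?x)" "F ?y' - F ?y = w * (?y' - ?y)"
          using cw in_uv by (auto simp: algebra_simps)
        then have "0 < w * (?x' - ?x)"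
          using in_uv(5) lift_map_less(1)[OF F, of ?x ?x'] by linarith
        then have "w > 0" using in_uv(5) by (simp add: zero_less_mult_iff)
        then have "w * (?c * (?x' - ?x) * (y' - y)) \<le> w * ((?y' - ?y) * (x' - x))"
          using IH by (intro mult_left_mono) auto
        then show ?thesis unfolding c funpow.simps comp_apply scale by (simp only: mult_ac)
      next
        case True
        have fin: "finite {i. i < m \<and> bad i}" by simp
        have "{i. i < Suc m \<and> bad i} = insert m {i. i < m \<and> bad i}" using True by (auto simp: less_Suc_eq)
        then have c: "\<rho> ^ card {i. i < Suc m \<and> bad i} = \<rho> * ?c" using fin by simp
        have len: "?x' \<le> ?x + 1" "F ?y' \<le> F ?y + 1"
        proof -
          have "x' \<le> x + of_int 1" "y' \<le> y + of_int 1" using x y vu by auto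
          then have "?x' \<le> (F ^^ m) (x + of_int 1)" "?y' \<le> (F ^^ m) (y + of_int 1)" unfolding mono .
          then have "?x' \<le> ?x + 1" "?y' \<le> ?y + 1"
            unfolding lift_map_add_int[OF funpow_lift_map[OF F]] by auto
          moreover from this(2) have "F ?y' \<le> F (?y + of_int 1)" unfolding lift_map_less(2)[OF F] by simp
          ultimately show "?x' \<le> ?x + 1" "F ?y' \<le> F ?y + 1" by (auto simp: lift_mapsD(2)[OF F])
        qed
        have X1: "F ?x' - F ?x \<le> M * (?x' - ?x)" using M(2) in_uv len by auto
        have Y1: "?y' - ?y \<le> M' * (F ?y' - F ?y)"
          using M'(2)[of "F ?y" "F ?y'"] in_uv len F lift_map_less(2)[OF F, of ?y ?y'] by simp
        have "\<rho> * ?c * (F ?x' - F ?x) * (y' - y) \<le> \<rho> * ?c * (M * (?x' - ?x)) * (y' - y)"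
          using X1 \<rho>(1) y by (intro mult_right_mono mult_left_mono) auto
        also have "\<dots> = (\<rho> * M) * (?c * (?x' - ?x) * (y' - y))" by (simp add: algebra_simps)
        also have "\<dots> \<le> (\<rho> * M) * ((?y' - ?y) * (x' - x))"
          using IH \<rho>(1) M(1) by (intro mult_left_mono) auto
        also have "\<dots> \<le> (\<rho> * M) * ((M' * (F ?y' - F ?y)) * (x' - x))"
          using Y1 \<rho>(1) M(1) x by (intro mult_left_mono mult_right_mono) auto
        also have "\<dots> = (\<rho> * M * M') * ((F ?y' - F ?y) * (x' - x))" by (simp add: algebra_simps)
        also have "\<dots> \<le> 1 * ((F ?y' - F ?y) * (x' - x))"
          using \<rho>(3) x in_uv lift_map_less(2)[OF F, of ?y ?y'] by (intro mult_right_mono) auto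
        finally show ?thesis unfolding c by simp
      qed
    qed
    have "\<rho> ^ card X \<le> \<rho> ^ card {i. i < n \<and> bad i}"
      using card \<rho> by (intro power_decreasing) auto
    then have "\<rho> ^ card X * (((F ^^ n) x' - (F ^^ n) x) * (y' - y)) \<le>
        \<rho> ^ card {i. i < n \<and> bad i} * (((F ^^ n) x' - (F ^^ n) x) * (y' - y))"
      using x y mono(2)[of n x x'] by (intro mult_right_mono mult_nonneg_nonneg) auto
    then show "\<rho> ^ card X * ((F ^^ n) x' - (F ^^ n) x) * (y' - y) \<le> ((F ^^ n) y' - (F ^^ n) y) * (x' - x)"
      using step[of n] by (simp add: mult.assoc)
  qed (use \<rho> in simp)
qed

text \<open>Denjoy's theorem for piecewise-linear maps: a closest return of a wandering interval spans
  an arc whose first images are disjoint on the circle, so bounded distortion compares the lengths of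
  the images of the interval under \<open>zpow A m\<close> and \<open>zpow A (- m)\<close>; but both tend to zero.\<close>

lemma wandering_interval_imp_periodic:
  assumes A: "A \<in> lift_maps" and pq: "p < q"
    and wander: "\<And>n k. n \<noteq> 0 \<or> k \<noteq> 0 \<Longrightarrow> zpow A n q + of_int k \<le> p \<or> q \<le> zpow A n p + of_int k"
  shows "\<exists>n k x. n \<noteq> 0 \<and> zpow A n x = x + of_int k"
proof (rule ccontr)
  assume "\<not> ?thesis"
  then have aper: "zpow A n x \<noteq> x + of_int k" if "n \<noteq> 0" for n x k using that by blast
  define a where "a = zpow A"
  have aL: "a n \<in> lift_maps" for n unfolding a_def using A by (rule zpow_lift_map)
  note mono = lift_map_less[OF aL] and shift = lift_map_add_int[OF aL]
  have add: "a i (a j x) = a (i + j) x" for i j x unfolding a_def using A by (rule zpow_zpow_add)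
  have a0: "a 0 x = x" for x by (simp add: a_def)
  have apart: "a n q + of_int k \<le> a m p + of_int l \<or> a m q + of_int l \<le> a n p + of_int k"
    if "n \<noteq> m \<or> k \<noteq> l" for n m k l
  proof -
    have "a (n - m) q + of_int (k - l) \<le> p \<or> q \<le> a (n - m) p + of_int (k - l)"
      unfolding a_def using that by (intro wander) auto
    then have "a m (a (n - m) q + of_int (k - l)) \<le> a m p \<or> a m q \<le> a m (a (n - m) p + of_int (k - l))"
      unfolding mono .
    then show ?thesis unfolding shift add by auto
  qed
  define len where "len n = a n q - a n p" for n
  have len_pos: "len n > 0" for n using pq mono(1)[of n p q] by (simp add: len_def)
  \<comment> \<open>The position \<open>w n\<close> of the \<open>n\<close>-th image of the interval on the circle cut open at \<open>p\<close>.\<close>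
  define r where "r n = - \<lfloor>a n p - p\<rfloor>" for n
  define w where "w n = a n p + of_int (r n)" for n
  have w: "p < w n" "w n < p + 1" if "n \<noteq> 0" for n
  proof -
    have "a n p \<noteq> p + of_int \<lfloor>a n p - p\<rfloor>" using aper[OF that] by (simp add: a_def)
    moreover have "of_int \<lfloor>a n p - p\<rfloor> \<le> a n p - p" "a n p - p < of_int \<lfloor>a n p - p\<rfloor> + 1" by linarith+
    moreover have "w n = a n p - of_int \<lfloor>a n p - p\<rfloor>" by (simp add: w_def r_def)
    ultimately show "p < w n" "w n < p + 1" by linarith+
  qed
  have w_unique: "a n p + of_int k = w n" if "p < a n p + of_int k" "a n p + of_int k < p + 1" for n k
  proof -
    have "k = r n" unfolding r_def using that by linarith
    then show ?thesis by (simp add: w_def)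
  qed
  \<comment> \<open>The lengths tend to zero, because the intervals are disjoint on the circle.\<close>
  have few: "finite {n. e \<le> len n}" if e: "e > 0" for e
  proof -
    define f where "f n = \<lfloor>(w n - p) / e\<rfloor>" for n
    have "inj_on f {n. n \<noteq> 0 \<and> e \<le> len n}"
    proof (rule inj_onI, rule ccontr)
      fix n m assume nm: "n \<in> {n. n \<noteq> 0 \<and> e \<le> len n}" "m \<in> {n. n \<noteq> 0 \<and> e \<le> len n}" "f n = f m" "n \<noteq> m"
      have "\<bar>(w n - p) / e - (w m - p) / e\<bar> < 1" using nm(3) unfolding f_def by linarith
      then have "\<bar>w n - w m\<bar> < e" using e by (simp add: field_simps flip: diff_divide_distrib)
      moreover have "w n + len n \<le> w m \<or> w m + len m \<le> w n"
        using apart[of n m "r n" "r m"] nm(4) by (auto simp: w_def len_def)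
      ultimately show False using nm(1,2) by auto
    qed
    moreover have "f ` {n. n \<noteq> 0 \<and> e \<le> len n} \<subseteq> {0..\<lfloor>1 / e\<rfloor>}"
    proof safe
      fix n :: int assume "n \<noteq> 0"
      then have "0 \<le> (w n - p) / e" "(w n - p) / e \<le> 1 / e"
        using w[of n] e by (auto intro!: divide_right_mono)
      then show "f n \<in> {0..\<lfloor>1 / e\<rfloor>}" by (auto simp: f_def floor_mono)
    qed
    ultimately have "finite {n. n \<noteq> 0 \<and> e \<le> len n}"
      using finite_imageD finite_subset by blast
    then have "finite (insert 0 {n. n \<noteq> 0 \<and> e \<le> len n})" by simp
    then show ?thesis by (rule finite_subset[rotated]) auto
  qed
  \<comment> \<open>There are ever closer returns: iterating one of them winds around the circle and lands inside.\<close>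
  have closer: "\<exists>n. n \<noteq> 0 \<and> w n < w m" if m: "m \<noteq> 0" for m
  proof -
    define D where "D x = a m x + of_int (r m)" for x
    have "D \<in> lift_maps"
      using compose_lift_map[OF translation_lift_map[of "r m"] aL[of m]] unfolding D_def comp_def .
    have Dp: "D p = w m" by (simp add: D_def w_def)
    have Dj: "(D ^^ j) x = a (int j * m) x + of_int (int j * r m)" for j x
    proof (induction j)
      case (Suc j)
      have "(D ^^ Suc j) x = a m (a (int j * m) x + of_int (int j * r m)) + of_int (r m)"
        using Suc by (simp only: funpow.simps comp_apply) (simp only: D_def)
      then show ?case unfolding shift add by (simp add: algebra_simps)
    qed (simp add: a0)
    have no_fix: "D x \<noteq> x" for x
      using aper[OF m, of x "- r m"] by (simp add: D_def a_def)
    have "\<exists>j. p + 1 < (D ^^ j) p"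
    proof (rule ccontr)
      assume "\<not> ?thesis"
      then have bd: "(D ^^ j) p \<le> p + 1" for j by (meson not_le)
      have "incseq (\<lambda>j. (D ^^ j) p)"
      proof (intro incseq_SucI)
        fix j
        have "(D ^^ j) p \<le> (D ^^ j) (D p)"
          using lift_map_less(2)[OF funpow_lift_map[OF \<open>D \<in> lift_maps\<close>]] w(1)[OF m] Dp by simp
        then show "(D ^^ j) p \<le> (D ^^ Suc j) p" by (simp add: funpow_swap1)
      qed
      then obtain l where "(\<lambda>j. (D ^^ j) p) \<longlonglongrightarrow> l"
        using incseq_convergent[of "\<lambda>j. (D ^^ j) p" "p + 1"] bd by blast
      then have "D l = l" by (rule limit_of_iterates_fixed[OF \<open>D \<in> lift_maps\<close>])
      then show False using no_fix by blast
    qed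
    define j where "j = (LEAST j. p + 1 < (D ^^ j) p)"
    have j: "p + 1 < (D ^^ j) p"
      unfolding j_def by (rule LeastI_ex[OF \<open>\<exists>j. p + 1 < (D ^^ j) p\<close>])
    have before_j: "(D ^^ i) p \<le> p + 1" if "i < j" for i
      using not_less_Least that unfolding j_def by (metis not_less)
    have "j \<noteq> 0" using j by (intro notI) simp
    moreover have "j \<noteq> 1" using j w(2)[OF m] Dp by (intro notI) simp
    ultimately obtain i where i: "j = Suc i" "i > 0" by (cases j) auto
    define n where "n = - (int i * m)"
    have n: "n \<noteq> 0" using m i(2) by (simp add: n_def)
    define k where "k = 1 - int i * r m"
    have Dn: "(D ^^ i) (a n p + of_int k) = p + 1"
      unfolding Dj shift add by (simp add: n_def k_def a0)
    have "(D ^^ i) p \<le> (D ^^ i) (a n p + of_int k)" using before_j[of i] i(1) Dn by simp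
    then have "p \<le> a n p + of_int k" using lift_map_less(2)[OF funpow_lift_map[OF \<open>D \<in> lift_maps\<close>]] by simp
    moreover have "p \<noteq> a n p + of_int k" using aper[OF n, of p "- k"] by (auto simp: a_def)
    ultimately have "p < a n p + of_int k" by simp
    moreover have "(D ^^ i) (a n p + of_int k) < (D ^^ i) (D p)" using j i(1) Dn by (simp add: funpow_swap1)
    then have "a n p + of_int k < w m" using lift_map_less(1)[OF funpow_lift_map[OF \<open>D \<in> lift_maps\<close>]] Dp by simp
    ultimately have "w n < w m" using w_unique[of n k] w(2)[OF m] by simp
    with n show ?thesis by blast
  qed
  \<comment> \<open>Closer returns eventually beat all returns of order up to \<open>N\<close>, so a best one has larger order.\<close>
  have closest: "\<exists>m. N < \<bar>m\<bar> \<and> (\<forall>j. j \<noteq> 0 \<and> \<bar>j\<bar> < \<bar>m\<bar> \<longrightarrow> w m \<le> w j)" if N: "N \<ge> 1" for N :: int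
  proof -
    have fin: "finite {j :: int. j \<noteq> 0 \<and> \<bar>j\<bar> \<le> K}" for K
      by (rule finite_subset[of _ "{-K..K}"]) auto
    have min_ex: "\<exists>m. m \<noteq> 0 \<and> \<bar>m\<bar> \<le> K \<and> (\<forall>j. j \<noteq> 0 \<and> \<bar>j\<bar> \<le> K \<longrightarrow> w m \<le> w j)" if "K \<ge> 1" for K
    proof -
      have "1 \<in> {j. j \<noteq> 0 \<and> \<bar>j\<bar> \<le> K}" using that by simp
      then have "{j. j \<noteq> 0 \<and> \<bar>j\<bar> \<le> K} \<noteq> {}" by blast
      note arg_min_if_finite(1)[OF fin this, of w] arg_min_least[OF fin this, where f = w]
      then show ?thesis by (intro exI[of _ "arg_min_on w {j. j \<noteq> 0 \<and> \<bar>j\<bar> \<le> K}"]) auto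
    qed
    obtain m0 where m0: "m0 \<noteq> 0" "\<And>j. j \<noteq> 0 \<Longrightarrow> \<bar>j\<bar> \<le> N \<Longrightarrow> w m0 \<le> w j" using min_ex[OF N] by blast
    obtain n where n: "n \<noteq> 0" "w n < w m0" using closer[OF m0(1)] by blast
    have "1 \<le> \<bar>n\<bar>" using n(1) by simp
    from min_ex[OF this] obtain m where m: "m \<noteq> 0" "\<bar>m\<bar> \<le> \<bar>n\<bar>" "\<And>j. j \<noteq> 0 \<Longrightarrow> \<bar>j\<bar> \<le> \<bar>n\<bar> \<Longrightarrow> w m \<le> w j"
      by blast
    have "w m < w m0" using m(3)[of n] n by simp
    then have "N < \<bar>m\<bar>" using m0(2)[of m] m(1) by force
    moreover have "w m \<le> w j" if "j \<noteq> 0" "\<bar>j\<bar> < \<bar>m\<bar>" for j using m(2,3) that by simp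
    ultimately show ?thesis by blast
  qed
  have distortion: "\<exists>\<kappa>>0. \<forall>m. m \<noteq> 0 \<and> sgn m = \<sigma> \<and> (\<forall>j. j \<noteq> 0 \<and> \<bar>j\<bar> < \<bar>m\<bar> \<longrightarrow> w m \<le> w j) \<longrightarrow>
      \<kappa> * len 0 * len 0 \<le> len m * len (- m)"
    if \<sigma>: "\<sigma> = 1 \<or> \<sigma> = - 1" for \<sigma> :: int
  proof -
    have Fn: "(a \<sigma> ^^ n) x = a (\<sigma> * int n) x" for n x
      by (induction n) (simp_all add: a0 add algebra_simps)
    obtain \<kappa> where \<kappa>: "\<kappa> > 0" "\<forall>n u v x x' y y'.
      (\<forall>i<n. \<forall>j<n. \<forall>k. i \<noteq> j \<longrightarrow>
        (a \<sigma> ^^ i) v \<le> (a \<sigma> ^^ j) u + of_int k \<or> (a \<sigma> ^^ j) v + of_int k \<le> (a \<sigma> ^^ i) u) \<and>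
      v \<le> u + 1 \<and> u \<le> x \<and> x < x' \<and> x' \<le> v \<and> u \<le> y \<and> y < y' \<and> y' \<le> v \<longrightarrow>
      \<kappa> * ((a \<sigma> ^^ n) x' - (a \<sigma> ^^ n) x) * (y' - y) \<le> ((a \<sigma> ^^ n) y' - (a \<sigma> ^^ n) y) * (x' - x)"
      using bounded_distortion[OF aL[of \<sigma>]] by (elim exE conjE) (rule that)
    have "\<kappa> * len 0 * len 0 \<le> len m * len (- m)"
      if m: "m \<noteq> 0" "sgn m = \<sigma>" and close: "\<And>j. j \<noteq> 0 \<Longrightarrow> \<bar>j\<bar> < \<bar>m\<bar> \<Longrightarrow> w m \<le> w j" for m
    proof -
      define n where "n = nat \<bar>m\<bar>"
      have mn: "m = \<sigma> * int n" using m(2) by (simp add: n_def flip: m(2)) (metis mult.commute abs_mult_sgn)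
      let ?e = "a m q + of_int (r m)"
      have we: "q \<le> w m" "w m < ?e" "?e \<le> p + 1"
      proof -
        show "q \<le> w m" using apart[of m 0 "r m" 0] m(1) w(1)[OF m(1)] len_pos[of m]
          by (auto simp: a0 w_def len_def)
        show "w m < ?e" using len_pos[of m] by (simp add: w_def len_def)
        show "?e \<le> p + 1" using apart[of m 0 "r m" 1] m(1) w(2)[OF m(1)] pq
          by (auto simp: a0 w_def)
      qed
      \<comment> \<open>By minimality no earlier image enters the arc \<open>{p..?e}\<close>; so earlier images of the whole
          arc are disjoint from it on the circle.\<close>
      have right: "?e \<le> a s p + of_int l" if s: "s \<noteq> 0" "\<bar>s\<bar> < \<bar>m\<bar>" "p < a s p + of_int l" for s l
      proof (cases "a s p + of_int l < p + 1")
        case True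
        then have "a s p + of_int l = w s" using w_unique s(3) by blast
        then have "w m \<le> a s p + of_int l" using close[OF s(1,2)] by simp
        moreover have "a s p < a s q" using pq mono(1) by blast
        ultimately show ?thesis using apart[of m s "r m" l] s(2) by (auto simp: w_def)
      qed (use we in simp)
      have sep: "?e \<le> a s p + of_int l \<or> a s ?e + of_int l \<le> p" if s: "s \<noteq> 0" "\<bar>s\<bar> < \<bar>m\<bar>" for s l
      proof (cases "p < a s p + of_int l")
        case False
        have "a s p + of_int l \<noteq> p" using aper[OF s(1), of p "- l"] by (auto simp: a_def)
        then have "a s p + of_int l < p" using False by simp
        then have "a (- s) (a s p + of_int l) < a (- s) p" unfolding mono .
        then have "p < a (- s) p + of_int (- l)" unfolding shift add by (simp add: a0)
        then have "?e \<le> a (- s) p + of_int (- l)" using right[of "- s" "- l"] s by simp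
        then have "a s ?e \<le> a s (a (- s) p + of_int (- l))" unfolding mono .
        then show ?thesis unfolding shift add by (simp add: a0)
      qed (use right s in blast)
      \<comment> \<open>The arc pulled back by \<open>a m\<close>: up to a translation it runs from the \<open>- m\<close>-th image of the
          interval to the interval itself, and after \<open>n\<close> steps from the interval to its \<open>m\<close>-th image.\<close>
      let ?u = "a (- m) p" and ?v = "q + of_int (r m)"
      have um: "a m ?u = p" "a m ?v = ?e" "a m (?u + 1) = p + 1" "a m (a (- m) q) = q"
        "a m (p + of_int (r m)) = w m"
        unfolding shift add lift_mapsD(2)[OF aL] by (simp_all add: a0 w_def)
      have "\<kappa> * ((a \<sigma> ^^ n) (a (- m) q) - (a \<sigma> ^^ n) ?u) * (?v - (p + of_int (r m)))
        \<le> ((a \<sigma> ^^ n) ?v - (a \<sigma> ^^ n) (p + of_int (r m))) * (a (- m) q - ?u)"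
      proof (intro \<kappa>(2)[rule_format, where u = ?u and v = ?v] conjI allI impI)
        fix i j :: nat and k :: int assume ij: "i < n" "j < n" "i \<noteq> j"
        define s where "s = \<sigma> * (int j - int i)"
        have "s \<noteq> 0" "\<bar>s\<bar> < \<bar>m\<bar>" using ij \<sigma> mn by (auto simp: s_def abs_mult)
        then have "?e \<le> a s p + of_int k \<or> a s ?e + of_int k \<le> p" by (rule sep)
        then have "a (\<sigma> * int i - m) ?e \<le> a (\<sigma> * int i - m) (a s p + of_int k) \<or>
            a (\<sigma> * int i - m) (a s ?e + of_int k) \<le> a (\<sigma> * int i - m) p" unfolding mono .
        moreover have "\<sigma> * int i - m + s = \<sigma> * int j - m" by (simp add: s_def algebra_simps)
        ultimately show "(a \<sigma> ^^ i) ?v \<le> (a \<sigma> ^^ j) ?u + of_int k \<or> (a \<sigma> ^^ j) ?v + of_int k \<le> (a \<sigma> ^^ i) ?u"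
          unfolding Fn shift add by simp
      next
        show "?v \<le> ?u + 1" unfolding mono(2)[of m ?v, symmetric] um by (rule we)
        show "?u < a (- m) q" using pq mono(1) by blast
        show "a (- m) q \<le> ?v" unfolding mono(2)[of m "a (- m) q", symmetric] um using we by simp
        show "?u \<le> p + of_int (r m)" unfolding mono(2)[of m ?u, symmetric] um using w(1)[OF m(1)] by simp
      qed (use pq in auto)
      then show ?thesis unfolding Fn mn[symmetric] um by (simp add: len_def a0 w_def)
    qed
    then show ?thesis using \<kappa>(1) by blast
  qed
  obtain \<kappa>1 where \<kappa>1: "\<kappa>1 > 0" "\<forall>m. m \<noteq> 0 \<and> sgn m = 1 \<and>
      (\<forall>j. j \<noteq> 0 \<and> \<bar>j\<bar> < \<bar>m\<bar> \<longrightarrow> w m \<le> w j) \<longrightarrow> \<kappa>1 * len 0 * len 0 \<le> len m * len (- m)"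
    using distortion[OF disjI1[OF refl]] by (elim exE conjE) (rule that)
  obtain \<kappa>2 where \<kappa>2: "\<kappa>2 > 0" "\<forall>m. m \<noteq> 0 \<and> sgn m = - 1 \<and>
      (\<forall>j. j \<noteq> 0 \<and> \<bar>j\<bar> < \<bar>m\<bar> \<longrightarrow> w m \<le> w j) \<longrightarrow> \<kappa>2 * len 0 * len 0 \<le> len m * len (- m)"
    using distortion[OF disjI2[OF refl]] by (elim exE conjE) (rule that)
  define \<kappa> where "\<kappa> = min \<kappa>1 \<kappa>2"
  have \<kappa>: "\<kappa> > 0" using \<kappa>1(1) \<kappa>2(1) by (simp add: \<kappa>_def)
  \<comment> \<open>Two lengths below this threshold contradict the distortion estimate.\<close>
  define e where "e = sqrt \<kappa> * len 0"
  have e: "e > 0" using \<kappa> len_pos by (simp add: e_def)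
  define N where "N = Max (insert 1 (abs ` {n. e \<le> len n}))"
  have fN: "finite (insert 1 (abs ` {n. e \<le> len n}))" using few[OF e] by simp
  have "1 \<le> N" unfolding N_def using fN by (intro Max_ge) auto
  obtain m where m: "N < \<bar>m\<bar>" "\<forall>j. j \<noteq> 0 \<and> \<bar>j\<bar> < \<bar>m\<bar> \<longrightarrow> w m \<le> w j"
    using closest[OF \<open>1 \<le> N\<close>] by (elim exE conjE) (rule that)
  have short: "len n < e" if "\<bar>n\<bar> = \<bar>m\<bar>" for n
  proof (rule ccontr)
    assume "\<not> len n < e"
    then have "\<bar>n\<bar> \<le> N" unfolding N_def using fN by (intro Max_ge) auto
    with m(1) that show False by simp
  qed
  have "m \<noteq> 0" using m(1) \<open>1 \<le> N\<close> by auto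
  then have "sgn m = 1 \<or> sgn m = - 1" by (auto simp: sgn_if)
  then have "\<kappa>1 * len 0 * len 0 \<le> len m * len (- m) \<or> \<kappa>2 * len 0 * len 0 \<le> len m * len (- m)"
    using \<kappa>1(2) \<kappa>2(2) m(2) \<open>m \<noteq> 0\<close> by blast
  moreover have "\<kappa> * len 0 * len 0 \<le> \<kappa>1 * len 0 * len 0" "\<kappa> * len 0 * len 0 \<le> \<kappa>2 * len 0 * len 0"
    using len_pos[of 0] by (auto simp: \<kappa>_def intro!: mult_right_mono)
  ultimately have "\<kappa> * len 0 * len 0 \<le> len m * len (- m)" by linarith
  also have "\<dots> < e * e" using short[of m] short[of "- m"] len_pos e by (intro mult_strict_mono) (auto simp: less_imp_le)
  also have "\<dots> = \<kappa> * len 0 * len 0" using \<kappa> by (simp add: e_def algebra_simps)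
  finally show False by simp
qed

section \<open>Free pairs of commuting lifts with fixed points\<close>

lemma linear_germ_funpow:
  fixes u l :: real
  assumes "\<And>s. s \<in> {0..d} \<Longrightarrow> G (u + s) = u + s * l" "0 \<le> l" "l \<le> 1" "s \<in> {0..d}"
  shows "(G ^^ n) (u + s) = u + l ^ n * s"
proof (induction n)
  case (Suc n)
  have "l ^ n * s \<le> 1 * s" using assms(2-4) by (intro mult_right_mono power_le_one) auto
  then have "l ^ n * s \<in> {0..d}" using assms(2,4) by auto
  then show ?case using Suc assms(1) by (simp add: mult.commute mult.left_commute)
qed simp

lemma contracting_germ:
  assumes G: "G \<in> lift_maps" and o: "orbital G u v" and down: "\<And>x. u < x \<Longrightarrow> x < v \<Longrightarrow> G x < x"
  obtains d l where "d > 0" "0 < l" "l < 1" "\<And>s. s \<in> {0..d} \<Longrightarrow> G (u + s) = u + s * l"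
proof -
  obtain d l where d: "d > 0" "\<forall>s\<in>{0..d}. G (u + s) = G u + s *\<^sub>R l"
    using locally_plD(1)[OF lift_mapsD(3)[OF G], of u] by (auto simp: right_affine_def)
  then have lin: "G (u + s) = u + s * l" if "s \<in> {0..d}" for s using that orbitalD(2)[OF o] by simp
  define s where "s = min d ((v - u) / 2)"
  have s: "0 < s" "s \<in> {0..d}" "u + s < v"
    using d(1) orbitalD(1)[OF o] by (auto simp: s_def min_def field_simps)
  have "u < G (u + s)" using lift_map_less(1)[OF G, of u "u + s"] s orbitalD(2)[OF o] by simp
  then have "0 < s * l" using lin[OF s(2)] by simp
  moreover have "s * l < s * 1" using down[of "u + s"] s lin[OF s(2)] by simp
  ultimately have "0 < l" "l < 1" using s(1) by (auto simp: zero_less_mult_iff)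
  with d(1) show thesis using lin by (rule that)
qed

text \<open>The two maps share an orbital and are linear near its left end, with slopes \<open>l, m < 1\<close>
  after inversion. In the coordinate given by the logarithm of the distance to that end their powers are
  translations by multiples of \<open>ln l\<close> and \<open>ln m\<close>. By Dirichlet's approximation theorem, a
  power of one and a power of the other differ by a translation shorter than the interval.\<close>

lemma no_free_commuting_pair:
  assumes A: "A \<in> lift_maps" and B: "B \<in> lift_maps" and comm: "A \<circ> B = B \<circ> A"
    and fixed: "A x = x" "B y = y" and pq: "p < q"
    and wander: "\<And>m n. m \<noteq> 0 \<or> n \<noteq> 0 \<Longrightarrow>
      zpow A m (zpow B n q) \<le> p \<or> q \<le> zpow A m (zpow B n p)"
  shows False
proof -
  have "A q \<le> p \<or> q \<le> A p" using wander[of 1 0] by simp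
  then have Ap: "A p \<noteq> p" using pq lift_map_less(1)[OF A, of p q] by auto
  have "B q \<le> p \<or> q \<le> B p" using wander[of 0 1] by simp
  then have Bp: "B p \<noteq> p" using pq lift_map_less(1)[OF B, of p q] by auto
  obtain u v where uv: "orbital A u v" "u < p" "p < v" using orbital_exists[OF A fixed(1) Ap] by blast
  have "q < v"
  proof (rule ccontr)
    assume "\<not> q < v"
    then have "v \<le> A q" using lift_map_less(2)[OF A, of v q] orbitalD(3)[OF uv(1)] by simp
    moreover have "A p < v" using lift_map_less(1)[OF A, of p v] orbitalD(3)[OF uv(1)] uv(3) by simp
    ultimately show False using \<open>A q \<le> p \<or> q \<le> A p\<close> uv(3) \<open>\<not> q < v\<close> by linarith
  qed
  have Buv: "B u = u" "B v = v"
    using commuting_fixes_orbital_ends[OF A B comm[symmetric] uv(1) fixed(2)] by blast+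
  have "B z \<noteq> z" if "u < z" "z < v" for z
    using commuting_identity_on_orbital[OF A B comm[symmetric] uv(1) Buv(1) that _ uv(2,3)] Bp by blast
  then have uvB: "orbital B u v" using Buv uv(2,3) by (simp add: orbital_def)
  obtain G where G: "G = A \<or> G = finv A" "G \<in> lift_maps" "orbital G u v" "\<And>x. u < x \<Longrightarrow> x < v \<Longrightarrow> G x < x"
    using orbital_contracting[OF A uv(1)] by blast
  obtain H where H: "H = B \<or> H = finv B" "H \<in> lift_maps" "orbital H u v" "\<And>x. u < x \<Longrightarrow> x < v \<Longrightarrow> H x < x"
    using orbital_contracting[OF B uvB] by blast
  have GH: "H \<circ> G = G \<circ> H"
  proof -
    have "B \<circ> G = G \<circ> B" using G(1) comm finv_commute[OF A comm[symmetric]] by metis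
    then show ?thesis using H(1) finv_commute[OF B, of G] by metis
  qed
  have zA: "\<exists>i. (\<forall>n. G ^^ n = zpow A (i * int n))"
    using G(1) zpow_of_nat[of A] zpow_minus_of_nat[of A] by (metis mult_1 mult_minus1)
  have zB: "\<exists>j. j \<noteq> 0 \<and> (\<forall>n. H ^^ n = zpow B (j * int n))"
    using H(1) zpow_of_nat[of B] zpow_minus_of_nat[of B]
    by (metis mult_1 mult_minus1 zero_neq_one neg_equal_0_iff_equal)
  obtain i where i: "\<And>n. G ^^ n = zpow A (i * int n)" using zA by blast
  obtain j where j: "j \<noteq> 0" "\<And>n. H ^^ n = zpow B (j * int n)" using zB by blast
  \<comment> \<open>Only nonnegative powers of the contractions \<open>G\<close> and \<open>H\<close> stay in the linear germs.\<close>
  have disj: "(H ^^ n) q \<le> (G ^^ m) p \<or> (G ^^ m) q \<le> (H ^^ n) p" if "n \<noteq> 0" for m n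
  proof -
    have "zpow A (- (i * int m)) ((H ^^ n) q) \<le> p \<or> q \<le> zpow A (- (i * int m)) ((H ^^ n) p)"
      unfolding j(2) using that j(1) by (intro wander) simp
    then have "(G ^^ m) (zpow A (- (i * int m)) ((H ^^ n) q)) \<le> (G ^^ m) p
      \<or> (G ^^ m) q \<le> (G ^^ m) (zpow A (- (i * int m)) ((H ^^ n) p))"
      unfolding lift_map_less[OF funpow_lift_map[OF G(2)]] .
    then show ?thesis unfolding i zpow_zpow_add[OF A] by simp
  qed
  obtain d l where d: "d > 0" "0 < l" "l < 1" "\<And>s. s \<in> {0..d} \<Longrightarrow> G (u + s) = u + s * l"
    using contracting_germ[OF G(2,3,4)] by blast
  obtain e m where e: "e > 0" "0 < m" "m < 1" "\<And>s. s \<in> {0..e} \<Longrightarrow> H (u + s) = u + s * m"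
    using contracting_germ[OF H(2,3,4)] by blast
  have "min d e > 0" using d(1) e(1) by simp
  then obtain N where N: "u < (G ^^ N) q" "(G ^^ N) q < u + min d e"
    using contracting_iterates[OF G(2,3,4) _ \<open>q < v\<close>] uv(2) pq by (metis less_trans)
  define s where "s = (G ^^ N) p - u"
  define t where "t = (G ^^ N) q - u"
  have "(G ^^ N) p < (G ^^ N) q" using lift_map_less(1)[OF funpow_lift_map[OF G(2)]] pq by blast
  then have st: "0 < s" "s < t" "s \<in> {0..d}" "t \<in> {0..d}" "s \<in> {0..e}" "t \<in> {0..e}"
    using N funpow_orbital(1)[OF G(2,3) uv(2,3), of N] by (auto simp: s_def t_def)
  have push: "m ^ n * t \<le> l ^ k * s \<or> l ^ k * t \<le> m ^ n * s" if n: "n \<noteq> 0" for k n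
  proof -
    have "(G ^^ N) ((H ^^ n) q) \<le> (G ^^ N) ((G ^^ k) p) \<or> (G ^^ N) ((G ^^ k) q) \<le> (G ^^ N) ((H ^^ n) p)"
      using disj[OF n] lift_map_less(2)[OF funpow_lift_map[OF G(2)]] by blast
    moreover have "(G ^^ N) ((H ^^ n) z) = (H ^^ n) ((G ^^ N) z)" for z
    proof -
      have "(H ^^ n) \<circ> G = G \<circ> (H ^^ n)" using funpow_commute[OF GH[symmetric]] by (auto simp: fun_eq_iff)
      from funpow_commute[OF this] show ?thesis by simp
    qed
    moreover have "(G ^^ N) ((G ^^ k) z) = (G ^^ k) ((G ^^ N) z)" for z
      by (metis add.commute comp_apply funpow_add)
    moreover have "(G ^^ N) p = u + s" "(G ^^ N) q = u + t" by (simp_all add: s_def t_def)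
    moreover have "(G ^^ k) (u + s) = u + l ^ k * s" "(G ^^ k) (u + t) = u + l ^ k * t"
      using d st by (auto intro!: linear_germ_funpow[where d = d])
    moreover have "(H ^^ n) (u + s) = u + m ^ n * s" "(H ^^ n) (u + t) = u + m ^ n * t"
      using e st by (auto intro!: linear_germ_funpow[where d = e])
    ultimately show ?thesis by simp
  qed
  define a where "a = - ln l"
  define b where "b = - ln m"
  define w where "w = ln t - ln s"
  have abw: "a > 0" "b > 0" "w > 0" using d e st by (auto simp: a_def b_def w_def)
  have far: "w \<le> \<bar>of_nat n * b - of_nat k * a\<bar>" if n: "n \<noteq> 0" for n k
  proof -
    have "ln (m ^ n * t) \<le> ln (l ^ k * s) \<or> ln (l ^ k * t) \<le> ln (m ^ n * s)"
      using push[OF n, of k] d e st by (simp add: ln_le_cancel_iff)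
    then show ?thesis using d e st by (auto simp: ln_mult ln_realpow a_def b_def w_def)
  qed
  \<comment> \<open>An approximation \<open>h / k\<close> of \<open>b / a\<close> that brings \<open>k * b\<close> and \<open>h * a\<close> within \<open>w\<close>.\<close>
  obtain K :: nat where K: "a / w < of_nat K" using reals_Archimedean2 by blast
  have "0 < a / w" using abw by simp
  with K have "K > 0" by (cases K) auto
  obtain h k where hk: "0 < k" "\<bar>of_int k * (b / a) - of_int h\<bar> < 1 / of_nat K"
    using Dirichlet_approx[OF \<open>K > 0\<close>, of "b / a"] by metis
  have "1 / of_nat K \<le> (1 :: real)" using \<open>K > 0\<close> by simp
  moreover have "0 < of_int k * (b / a)" using hk(1) abw by simp
  ultimately have "(-1 :: real) < of_int h" using hk(2) by linarith
  then have "0 \<le> h" by simp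
  have "a * \<bar>of_int k * (b / a) - of_int h\<bar> < a * (1 / of_nat K)"
    using hk(2) abw(1) by (intro mult_strict_left_mono)
  moreover have "a * \<bar>of_int k * (b / a) - of_int h\<bar> = \<bar>a * (of_int k * (b / a) - of_int h)\<bar>"
    using abw(1) by (simp add: abs_mult)
  moreover have "a * (of_int k * (b / a) - of_int h) = of_int k * b - of_int h * a"
    using abw(1) by (simp add: field_simps)
  moreover have "a * (1 / of_nat K) < w" using K \<open>K > 0\<close> abw by (simp add: field_simps)
  ultimately have "\<bar>of_int k * b - of_int h * a\<bar> < w" by (metis less_trans)
  then show False using far[of "nat k" "nat h"] hk(1) \<open>0 \<le> h\<close> by simp
qed

section \<open>Wreath products do not act by lifts\<close>

text \<open>In group-ring terms: \<open>1\<close> minus a nontrivial translation is not a zero divisor. A function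
  annihilated by it would be periodic, hence of infinite support.\<close>

lemma shift_difference_nonzero:
  fixes b :: "int \<times> int \<Rightarrow> int"
  assumes fin: "finite {s. b s \<noteq> 0}" and b: "b s0 \<noteq> 0" and t: "t \<noteq> 0"
  shows "\<exists>s. b s - b (s + t) \<noteq> 0"
proof (rule ccontr)
  assume "\<not> ?thesis"
  then have step: "b (s + t) = b s" for s by (metis right_minus_eq)
  define f where "f n = (fst s0 + int n * fst t, snd s0 + int n * snd t)" for n
  have "b (f n) = b s0" for n
  proof (induction n)
    case (Suc n)
    have "f (Suc n) = f n + t" by (simp add: f_def prod_eq_iff algebra_simps)
    then show ?case using step Suc by simp
  qed (simp add: f_def)
  then have "range f \<subseteq> {s. b s \<noteq> 0}" using b by auto
  moreover have "inj f" using t by (auto simp: inj_def f_def prod_eq_iff)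
  ultimately show False using fin by (meson finite_imageD finite_subset infinite_UNIV_nat)
qed

text \<open>Think of \<open>X b\<close> as the set of all lifts of the action of the base element \<open>2 * b\<close>, and of
  \<open>Y t\<close> as the set of all lifts of the action of \<open>2 * t\<close>. The doubling comes from passing to
  squares, which act by orientation-preserving homeomorphisms.\<close>

locale wreath_lifts =
  fixes X :: "(int \<times> int \<Rightarrow> int) \<Rightarrow> (real \<Rightarrow> real) set" and Y :: "int \<times> int \<Rightarrow> (real \<Rightarrow> real) set"
  assumes X_lift: "F \<in> X b \<Longrightarrow> F \<in> lift_maps"
    and X_finite: "F \<in> X b \<Longrightarrow> finite {s. b s \<noteq> 0}"
    and X_nonempty: "finite {s. b s \<noteq> 0} \<Longrightarrow> X b \<noteq> {}"
    and X_compose: "F \<in> X b \<Longrightarrow> G \<in> X c \<Longrightarrow> F \<circ> G \<in> X (\<lambda>s. b s + c s)"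
    and X_finv: "F \<in> X b \<Longrightarrow> finv F \<in> X (\<lambda>s. - b s)"
    and X_unique: "F \<in> X b \<Longrightarrow> G \<in> X b \<Longrightarrow> \<exists>k. \<forall>x. F x = G x + of_int k"
    and X_faithful: "id \<in> X b \<Longrightarrow> b s = 0"
    and Y_lift: "R \<in> Y t \<Longrightarrow> R \<in> lift_maps"
    and Y_nonempty: "Y t \<noteq> {}"
    and Y_compose: "R \<in> Y s \<Longrightarrow> R' \<in> Y t \<Longrightarrow> R \<circ> R' \<in> Y (s + t)"
    and Y_finv: "R \<in> Y t \<Longrightarrow> finv R \<in> Y (- t)"
    and Y_unique: "R \<in> Y t \<Longrightarrow> R' \<in> Y t \<Longrightarrow> \<exists>k. \<forall>x. R x = R' x + of_int k"
    and Y_translate: "R \<in> Y t \<Longrightarrow> (\<lambda>x. R x + of_int k) \<in> Y t"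
    and conj_X: "R \<in> Y t \<Longrightarrow> F \<in> X b \<Longrightarrow> R \<circ> F \<circ> finv R \<in> X (\<lambda>s. b (s + (t + t)))"
begin

lemma Y_id: "id \<in> Y 0"
proof -
  obtain R where R: "R \<in> Y 0" using Y_nonempty by blast
  then have "R \<circ> finv R \<in> Y (0 + - 0)" by (intro Y_compose Y_finv)
  then show ?thesis using Y_lift[OF R] by simp
qed

text \<open>Two lifts of the same element differ by a translation, so commuting elements have lifts that
  commute up to a translation, and hence commute.\<close>

lemma Y_commute:
  assumes R: "R \<in> Y s" and R': "R' \<in> Y t"
  shows "R \<circ> R' = R' \<circ> R"
proof -
  have "R \<circ> R' \<in> Y (s + t)" "R' \<circ> R \<in> Y (s + t)"
    using Y_compose[OF R R'] Y_compose[OF R' R] by (simp_all add: add.commute)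
  from Y_unique[OF this] obtain k where k: "\<And>x. R (R' x) = R' (R x) + of_int k" by auto
  then have "k = 0" by (rule commute_up_to_translation[OF Y_lift[OF R'] Y_lift[OF R]])
  with k show ?thesis by (simp add: fun_eq_iff)
qed

text \<open>A lift with a fixed point moves every point by less than \<open>1\<close>, so no other lift of the same
  element has one.\<close>

lemma X_fixed_unique:
  assumes F: "F \<in> X b" "F x = x" and G: "G \<in> X b" "G y = y"
  shows "F = G"
proof -
  obtain k where k: "\<And>z. F z = G z + of_int k" using X_unique[OF F(1) G(1)] by blast
  note GL = X_lift[OF G(1)]
  define j where "j = \<lfloor>x - y\<rfloor>"
  have j: "y + of_int j \<le> x" "x < y + of_int (j + 1)" unfolding j_def by linarith+
  then have "G (y + of_int j) \<le> G x" "G x < G (y + of_int (j + 1))" unfolding lift_map_less[OF GL] .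
  then have "y + of_int j \<le> G x" "G x < y + of_int (j + 1)" unfolding lift_map_add_int[OF GL] G(2) .
  then have "\<bar>of_int k :: real\<bar> < 1" using j k[of x] F(2) by simp
  then have "k = 0" by linarith
  with k show ?thesis by (simp add: fun_eq_iff)
qed

text \<open>Conjugating \<open>F\<close> by \<open>G\<close> gives a lift of the same element that again has a fixed point.\<close>

lemma X_fixed_commute:
  assumes F: "F \<in> X b" "F x = x" and G: "G \<in> X c" "G y = y"
  shows "F \<circ> G = G \<circ> F"
proof -
  have "G \<circ> F \<circ> finv G \<in> X (\<lambda>s. (c s + b s) + - c s)" by (intro X_compose X_finv F(1) G(1))
  then have "G \<circ> F \<circ> finv G \<in> X b" by simp
  moreover have "(G \<circ> F \<circ> finv G) (G x) = G x" using F(2) X_lift[OF G(1)] by simp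
  ultimately have "F = G \<circ> F \<circ> finv G" using X_fixed_unique[OF F] by blast
  then have "F \<circ> G = G \<circ> F \<circ> (finv G \<circ> G)" by (metis comp_assoc)
  then show ?thesis using X_lift[OF G(1)] by simp
qed

lemma conj_X_fixed:
  assumes "R \<in> Y t" "F x = x"
  shows "(R \<circ> F \<circ> finv R) (R x) = R x"
  using assms(2) Y_lift[OF assms(1)] by simp

text \<open>For a generator \<open>b\<close> of the base group and a translate of it, the two lifts commute and are
  conjugate, so they agree somewhere; hence the quotient of the two elements lifts to a map with a
  fixed point.\<close>

lemma exists_X_with_fixed_point:
  "\<exists>b F x s. b s \<noteq> 0 \<and> F \<in> X b \<and> F x = x"
proof -
  define b :: "int \<times> int \<Rightarrow> int" where "b s = (if s = 0 then 1 else 0)" for s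
  have fin: "finite {s. b s \<noteq> 0}" by (simp add: b_def)
  obtain G where G: "G \<in> X b" using X_nonempty[OF fin] by blast
  define t :: "int \<times> int" where "t = (1, 0)"
  obtain R where R: "R \<in> Y t" using Y_nonempty by blast
  define H where "H = R \<circ> G \<circ> finv R"
  have H: "H \<in> X (\<lambda>s. b (s + (t + t)))" unfolding H_def using R G by (rule conj_X)
  have "(\<lambda>s. b (s + (t + t)) + b s) = (\<lambda>s. b s + b (s + (t + t)))" by (rule ext) (rule add.commute)
  with X_compose[OF H G] have "H \<circ> G \<in> X (\<lambda>s. b s + b (s + (t + t)))" by (simp only:)
  from X_unique[OF X_compose[OF G H] this] obtain k where k: "\<And>x. G (H x) = H (G x) + of_int k"
    by auto
  then have "k = 0" by (rule commute_up_to_translation[OF X_lift[OF H] X_lift[OF G]])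
  with k have "G \<circ> H = H \<circ> G" by (simp add: fun_eq_iff)
  then obtain x where x: "G x = H x"
    using commuting_conjugate_coincidence[OF X_lift[OF G] Y_lift[OF R] H_def] by blast
  have "finv H \<circ> G \<in> X (\<lambda>s. - b (s + (t + t)) + b s)" by (intro X_compose X_finv H G)
  moreover have "(finv H \<circ> G) x = x" using x X_lift[OF H] by simp
  moreover have "- b (0 + (t + t)) + b 0 \<noteq> 0" by (simp add: b_def t_def zero_prod_def)
  ultimately show ?thesis
    by (intro exI[of _ "\<lambda>s. - b (s + (t + t)) + b s"] exI[of _ "finv H \<circ> G"] exI[of _ x] exI[of _ 0] conjI)
qed

text \<open>If \<open>R\<close> stabilizes an orbital of \<open>E\<close>, then passing from \<open>F\<close> to
  \<open>F \<circ> finv (R \<circ> F \<circ> finv R)\<close> makes all translates of the orbital fixed pointwise, since \<open>F\<close> and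
  its conjugate agree there. On the base group this operation multiplies by a nonzero element of a group
  ring without zero divisors, so the result is still nontrivial.\<close>

lemma kill_orbitals:
  assumes E: "E \<in> X \<beta>" "E c = c" and \<beta>: "\<beta> s0 \<noteq> 0" and fin: "finite P"
    and stab: "\<And>p q. (p, q) \<in> P \<Longrightarrow> orbital E p q \<and> (\<exists>t R. t \<noteq> 0 \<and> R \<in> Y t \<and> R p = p \<and> R q = q)"
  shows "\<exists>b F s x. b s \<noteq> 0 \<and> F \<in> X b \<and> F x = x \<and>
    (\<forall>p q t R y. (p, q) \<in> P \<and> R \<in> Y t \<and> p < y \<and> y < q \<longrightarrow> F (R y) = R y) \<and>
    (\<forall>y. (\<forall>t R. R \<in> Y t \<longrightarrow> R (E (finv R y)) = y) \<longrightarrow> F y = y)"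
  using fin stab
proof (induction P rule: finite_induct)
  case empty
  have "E y = y" if "\<And>t R. R \<in> Y t \<Longrightarrow> R (E (finv R y)) = y" for y
    using that[OF Y_id] by simp
  then show ?case using E \<beta> by (intro exI[of _ \<beta>] exI[of _ E] exI[of _ s0] exI[of _ c]) auto
next
  case (insert pq P)
  obtain p q where pq: "pq = (p, q)" by (cases pq)
  have "\<exists>b F s x. b s \<noteq> 0 \<and> F \<in> X b \<and> F x = x \<and>
    (\<forall>p q t R y. (p, q) \<in> P \<and> R \<in> Y t \<and> p < y \<and> y < q \<longrightarrow> F (R y) = R y) \<and>
    (\<forall>y. (\<forall>t R. R \<in> Y t \<longrightarrow> R (E (finv R y)) = y) \<longrightarrow> F y = y)"
    by (rule insert.IH, rule insert.prems) simp
  then obtain b F s x where F: "b s \<noteq> 0" "F \<in> X b" "F x = x"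
    and *: "\<forall>p q t R y. (p, q) \<in> P \<and> R \<in> Y t \<and> p < y \<and> y < q \<longrightarrow> F (R y) = R y"
      "\<forall>y. (\<forall>t R. R \<in> Y t \<longrightarrow> R (E (finv R y)) = y) \<longrightarrow> F y = y"
    by (elim exE conjE) (rule that)
  have killed: "F (R y) = R y" if "(p, q) \<in> P" "R \<in> Y t" "p < y" "y < q" for p q t R y
    using *(1) that by blast
  have supp: "F y = y" if "\<And>t R. R \<in> Y t \<Longrightarrow> R (E (finv R y)) = y" for y
    using *(2) that by blast
  have o: "orbital E p q" using insert.prems[of p q] pq by blast
  obtain t R where R: "t \<noteq> 0" "R \<in> Y t" "R p = p" "R q = q" using insert.prems[of p q] pq by blast
  note RL = Y_lift[OF R(2)] and FL = X_lift[OF F(2)] and EL = X_lift[OF E(1)]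
  define C where "C = R \<circ> F \<circ> finv R"
  have C: "C \<in> X (\<lambda>s. b (s + (t + t)))" "C (R x) = R x"
    unfolding C_def using conj_X[OF R(2) F(2)] conj_X_fixed[of R t F x, OF R(2) F(3)] by auto
  note CL = X_lift[OF C(1)]
  have FC: "F \<circ> C = C \<circ> F" using X_fixed_commute[OF F(2,3) C] .
  define F' where "F' = F \<circ> finv C"
  have agree: "F' y = y" if "F y = C y" for y
  proof -
    have "C (F (finv C y)) = F y" using fun_cong[OF FC, of "finv C y"] CL by simp
    then have "finv C (C (F (finv C y))) = finv C (C y)" using that by simp
    then show ?thesis using CL by (simp add: F'_def)
  qed
  have "t + t \<noteq> 0" using R(1) by (cases t) (simp add: zero_prod_def)
  from shift_difference_nonzero[OF X_finite[OF F(2)] F(1) this]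
  obtain s' where s': "b s' + - b (s' + (t + t)) \<noteq> 0"
    unfolding diff_conv_add_uminus by blast
  have F'X: "F' \<in> X (\<lambda>s. b s + - b (s + (t + t)))" unfolding F'_def by (intro X_compose X_finv F C)
  obtain z where z: "C z = z" "F z = z"
    using commuting_common_fixed_point[OF CL FL FC C(2) F(3)] by blast
  have F'z: "F' z = z" using z by (intro agree) simp
  \<comment> \<open>As \<open>R\<close> commutes with \<open>S\<close>, it stabilizes the translate by \<open>S\<close> of the new orbital too.\<close>
  have new: "F' (S y) = S y" if S: "S \<in> Y u" and y: "p < y" "y < q" for S u y
  proof (rule agree)
    note SL = Y_lift[OF S]
    let ?E = "S \<circ> E \<circ> finv S"
    have o': "orbital ?E (S p) (S q)" using orbital_conjugate[OF SL o] .
    have Ex: "?E \<in> X (\<lambda>s. \<beta> (s + (u + u)))" "?E (S c) = S c"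
      using conj_X[OF S E(1)] conj_X_fixed[of S u E c, OF S E(2)] by auto
    have FE: "F \<circ> ?E = ?E \<circ> F" using X_fixed_commute[OF F(2,3) Ex] .
    have Fends: "F (S p) = S p" "F (S q) = S q"
      using commuting_fixes_orbital_ends[OF X_lift[OF Ex(1)] FL FE o' F(3)] by blast+
    have RS: "R (S z) = S (R z)" for z using fun_cong[OF Y_commute[OF R(2) S], of z] by simp
    have Rends: "R (S p) = S p" "R (S q) = S q" using RS R(3,4) by auto
    have Sy: "S p < S y" "S y < S q" using y lift_map_less(1)[OF SL] by auto
    show "F (S y) = C (S y)"
    proof (cases "\<exists>w. S p < w \<and> w < S q \<and> F w = w")
      case True
      then obtain w where w: "S p < w" "w < S q" "F w = w" by blast
      have F_id: "F z = z" if "S p < z" "z < S q" for z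
        using commuting_identity_on_orbital[OF X_lift[OF Ex(1)] FL FE o' Fends(1) w that] .
      have "R (S p) < R (finv R (S y))" "R (finv R (S y)) < R (S q)" using Sy Rends RL by auto
      then have "S p < finv R (S y)" "finv R (S y) < S q" unfolding lift_map_less[OF RL] .
      then have "C (S y) = S y" using F_id RL by (simp add: C_def)
      then show ?thesis using F_id Sy by simp
    next
      case False
      then have "orbital F (S p) (S q)" using Fends orbitalD(1)[OF o'] by (auto simp: orbital_def)
      from commuting_conjugate_eq_on_orbital[OF FL RL this Rends(1) FC[unfolded C_def] Sy]
      show ?thesis by (simp add: C_def)
    qed
  qed
  have old: "F' (S y) = S y" if P: "(p', q') \<in> P" and S: "S \<in> Y u" and y: "p' < y" "y < q'" for S u y p' q'
  proof (rule agree)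
    have "finv R \<circ> S \<in> Y (- t + u)" by (intro Y_compose Y_finv R S)
    from killed[OF P this y] have "C (S y) = S y" using RL by (simp add: C_def)
    then show "F (S y) = C (S y)" using killed[OF P S y] by simp
  qed
  have supp': "F' y = y" if y: "\<And>t R. R \<in> Y t \<Longrightarrow> R (E (finv R y)) = y" for y
  proof (rule agree)
    have "S (E (finv S (finv R y))) = finv R y" if S: "S \<in> Y u" for S u
    proof -
      have RSL: "R \<circ> S \<in> lift_maps" by (intro compose_lift_map RL Y_lift[OF S])
      have "(R \<circ> S) (E (finv (R \<circ> S) y)) = y" using y[OF Y_compose[OF R(2) S]] .
      moreover have "finv (R \<circ> S) y = finv S (finv R y)"
        using lift_map_inv(2)[OF RSL, of "finv S (finv R y)"] RL Y_lift[OF S] by simp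
      ultimately have "R (S (E (finv S (finv R y)))) = y" by simp
      then show ?thesis using lift_map_inv(2)[OF RL] by metis
    qed
    then have "F (finv R y) = finv R y" by (rule supp)
    then have "C y = y" using RL by (simp add: C_def)
    moreover have "F y = y" by (rule supp) (rule y)
    ultimately show "F y = C y" by simp
  qed
  show ?case
    using s' F'X F'z new old supp' pq
    by (intro exI[of _ "\<lambda>s. b s + - b (s + (t + t))"] exI[of _ F'] exI[of _ s'] exI[of _ z])
      (auto simp del: add_uminus_conv_diff)
qed

lemma orbital_translate:
  assumes F: "F \<in> lift_maps" and "orbital F p q"
  shows "orbital F (p - of_int k) (q - of_int k)"
  unfolding orbital_def
proof (intro conjI allI impI)
  fix x assume "p - of_int k < x \<and> x < q - of_int k"
  then have "F (x + of_int k) \<noteq> x + of_int k" using orbitalD(4)[OF assms(2), of "x + of_int k"] by auto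
  then show "F x \<noteq> x" by (simp add: lift_map_add_int[OF F])
qed (use orbitalD[OF assms(2)] lift_map_diff_int[OF F] in auto)

text \<open>Otherwise the finitely many orbitals of \<open>E\<close> modulo \<open>1\<close> could all be killed. But an element
  obtained from translates of \<open>E\<close> moves only points that some translate of \<open>E\<close> moves, so it would
  be trivial.\<close>

lemma exists_unstabilized_orbital:
  assumes E: "E \<in> X \<beta>" "E c = c" and \<beta>: "\<beta> s0 \<noteq> 0"
  shows "\<exists>p q. orbital E p q \<and> (\<forall>t R. t \<noteq> 0 \<and> R \<in> Y t \<longrightarrow> \<not> (R p = p \<and> R q = q))"
proof (rule ccontr)
  assume neg: "\<not> ?thesis"
  note EL = X_lift[OF E(1)]
  let ?P = "{(p, q). 0 \<le> p \<and> p \<le> 1 \<and> orbital E p q}"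
  have "\<exists>b F s x. b s \<noteq> 0 \<and> F \<in> X b \<and> F x = x \<and>
    (\<forall>p q t R y. (p, q) \<in> ?P \<and> R \<in> Y t \<and> p < y \<and> y < q \<longrightarrow> F (R y) = R y) \<and>
    (\<forall>y. (\<forall>t R. R \<in> Y t \<longrightarrow> R (E (finv R y)) = y) \<longrightarrow> F y = y)"
  proof (rule kill_orbitals[OF E \<beta> finite_orbitals[OF EL]])
    fix p q assume "(p, q) \<in> ?P"
    then have "orbital E p q" by simp
    with neg show "orbital E p q \<and> (\<exists>t R. t \<noteq> 0 \<and> R \<in> Y t \<and> R p = p \<and> R q = q)" by meson
  qed
  then obtain b F s x where F: "b s \<noteq> 0" "F \<in> X b" "F x = x"
    and *: "\<forall>p q t R y. (p, q) \<in> ?P \<and> R \<in> Y t \<and> p < y \<and> y < q \<longrightarrow> F (R y) = R y"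
      "\<forall>y. (\<forall>t R. R \<in> Y t \<longrightarrow> R (E (finv R y)) = y) \<longrightarrow> F y = y"
    by (elim exE conjE) (rule that)
  have killed: "F (R y) = R y" if "(p, q) \<in> ?P" "R \<in> Y t" "p < y" "y < q" for p q t R y
    using *(1) that by blast
  note FL = X_lift[OF F(2)]
  have "F \<noteq> id" using X_faithful F(1,2) by metis
  then obtain y where y: "F y \<noteq> y" by (auto simp: fun_eq_iff)
  then obtain t R where R: "R \<in> Y t" "R (E (finv R y)) \<noteq> y" using *(2) by blast
  note RL = Y_lift[OF R(1)]
  have "E (finv R y) \<noteq> finv R y" using R(2) RL by auto
  then obtain p q where pq: "orbital E p q" "p < finv R y" "finv R y < q"
    using orbital_exists[OF EL E(2)] by blast
  define k where "k = \<lfloor>p\<rfloor>"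
  have k: "0 \<le> p - of_int k" "p - of_int k \<le> 1" unfolding k_def by linarith+
  have "F (R (finv R y - of_int k)) = R (finv R y - of_int k)"
    by (rule killed[of "p - of_int k" "q - of_int k" R t])
      (use k pq R(1) orbital_translate[OF EL pq(1)] in auto)
  then have "F y = y" unfolding lift_map_diff_int[OF RL] lift_map_diff_int[OF FL] using RL by simp
  with y show False by simp
qed

text \<open>An orbital of \<open>E\<close> and an orbital of a commuting translate of \<open>E\<close> are equal or disjoint;
  so the translates of an orbital that is never stabilized are disjoint from it.\<close>

lemma free_interval:
  obtains p q where "p < q" "q \<le> p + 1" "\<And>t R. t \<noteq> 0 \<Longrightarrow> R \<in> Y t \<Longrightarrow> R q \<le> p \<or> q \<le> R p"
proof -
  obtain \<beta> E c s where E: "\<beta> s \<noteq> 0" "E \<in> X \<beta>" "E c = c"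
    using exists_X_with_fixed_point by (elim exE conjE) (rule that)
  note EL = X_lift[OF E(2)]
  obtain p q where o: "orbital E p q"
    and free: "\<And>t R. t \<noteq> 0 \<Longrightarrow> R \<in> Y t \<Longrightarrow> \<not> (R p = p \<and> R q = q)"
    using exists_unstabilized_orbital[where E = E and \<beta> = \<beta> and c = c, OF E(2,3,1)] by meson
  have "E (p + 1) = p + 1" using orbitalD(2)[OF o] lift_mapsD(2)[OF EL] by simp
  then have "q \<le> p + 1" using orbitalD(4)[OF o, of "p + 1"] by force
  moreover have "R q \<le> p \<or> q \<le> R p" if R: "t \<noteq> 0" "R \<in> Y t" for t R
  proof (rule ccontr)
    assume "\<not> ?thesis"
    then have meet: "p < R q" "R p < q" by auto
    note RL = Y_lift[OF R(2)]
    let ?E = "R \<circ> E \<circ> finv R"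
    have o': "orbital ?E (R p) (R q)" using orbital_conjugate[OF RL o] .
    have Ex: "?E \<in> X (\<lambda>s. \<beta> (s + (t + t)))" "?E (R c) = R c"
      using conj_X[OF R(2) E(2)] conj_X_fixed[of R t E c, OF R(2) E(3)] by auto
    have comm: "?E \<circ> E = E \<circ> ?E" using X_fixed_commute[OF Ex E(2,3)] .
    have ends: "?E p = p" "?E q = q"
      using commuting_fixes_orbital_ends[OF EL X_lift[OF Ex(1)] comm o Ex(2)] by blast+
    show False
    proof (cases "\<exists>w. p < w \<and> w < q \<and> ?E w = w")
      case True
      then obtain w where w: "p < w" "w < q" "?E w = w" by blast
      have E_id: "?E z = z" if "p < z" "z < q" for z
        using commuting_identity_on_orbital[OF EL X_lift[OF Ex(1)] comm o ends(1) w that] .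
      have "max p (R p) < min q (R q)" using meet orbitalD(1)[OF o] orbitalD(1)[OF o'] by simp
      then obtain z where "max p (R p) < z" "z < min q (R q)" using dense by blast
      then have z: "p < z" "z < q" "R p < z" "z < R q" by auto
      then show False using E_id[OF z(1,2)] orbitalD(4)[OF o' z(3,4)] by blast
    next
      case False
      then have "orbital ?E p q" using ends orbitalD(1)[OF o] by (simp add: orbital_def)
      from orbital_disjoint[OF this o'] show False using meet free[OF R] by auto
    qed
  qed
  ultimately show thesis by (rule that[OF orbitalD(1)[OF o]])
qed

lemma zpow_Y:
  assumes R: "R \<in> Y (a, b)"
  shows "zpow R i \<in> Y (i * a, i * b)"
proof (induction i rule: int_induct[of _ 0])
  case base
  show ?case using Y_id by (simp only: zpow_0 mult_zero_left zero_prod_def)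
next
  case (step1 i)
  have "((i + 1) * a, (i + 1) * b) = (a, b) + (i * a, i * b)" by (simp add: algebra_simps)
  then show ?case using Y_compose[OF R step1(2)] zpow_Suc[OF Y_lift[OF R], of i] by (simp only:)
next
  case (step2 i)
  have "zpow R (i - 1) = finv R \<circ> zpow R i"
    using zpow_Suc[OF Y_lift[OF R], of "i - 1"] lift_map_inv(4)[OF Y_lift[OF R]] by (simp flip: comp_assoc)
  moreover have "((i - 1) * a, (i - 1) * b) = - (a, b) + (i * a, i * b)" by (simp add: algebra_simps)
  ultimately show ?case using Y_compose[OF Y_finv[OF R] step2(2)] by (simp only:)
qed

lemma periodic_translate:
  assumes pq: "p < q" "q \<le> p + 1" and free: "\<And>t R. t \<noteq> 0 \<Longrightarrow> R \<in> Y t \<Longrightarrow> R q \<le> p \<or> q \<le> R p"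
    and t: "(a, b) \<noteq> 0"
  shows "\<exists>n R x. n \<noteq> 0 \<and> R \<in> Y (n * a, n * b) \<and> R x = x"
proof -
  obtain A where A: "A \<in> Y (a, b)" using Y_nonempty by blast
  have "zpow A n q + of_int k \<le> p \<or> q \<le> zpow A n p + of_int k" if "n \<noteq> 0 \<or> k \<noteq> 0" for n k
  proof (cases "n = 0")
    case True
    with that have "k \<le> - 1 \<or> 1 \<le> k" by linarith
    then have "(of_int k :: real) \<le> - 1 \<or> (1 :: real) \<le> of_int k"
      by (metis of_int_1 of_int_le_iff of_int_minus)
    then show ?thesis using True pq by auto
  next
    case False
    then have "(n * a, n * b) \<noteq> 0" using t by (auto simp: zero_prod_def)
    then show ?thesis using free[OF _ Y_translate[OF zpow_Y[OF A]]] by blast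
  qed
  from wandering_interval_imp_periodic[OF Y_lift[OF A] pq(1) this]
  obtain n k x where nk: "n \<noteq> 0" "zpow A n x = x + of_int k" by blast
  show ?thesis
    using nk Y_translate[OF zpow_Y[OF A, of n], of "- k"]
    by (intro exI[of _ n] exI[of _ "\<lambda>x. zpow A n x + of_int (- k)"] exI[of _ x]) auto
qed

text \<open>The free interval wanders under each of the two generators of the top group, so by Denjoy's
  theorem both have powers with periodic points. Corrected by translations, these powers have fixed points
  and still move the interval freely, which is impossible.\<close>

theorem no_wreath_lifts: False
proof -
  obtain p q where pq: "p < q" "q \<le> p + 1" and free: "\<And>t R. t \<noteq> 0 \<Longrightarrow> R \<in> Y t \<Longrightarrow> R q \<le> p \<or> q \<le> R p"
    using free_interval by blast
  have "\<exists>n R x. n \<noteq> 0 \<and> R \<in> Y (n * 1, n * 0) \<and> R x = x"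
    by (rule periodic_translate[OF pq free]) (simp_all add: zero_prod_def)
  then obtain m A x where A: "m \<noteq> 0" "A \<in> Y (m * 1, m * 0)" "A x = x" by blast
  have "\<exists>n R x. n \<noteq> 0 \<and> R \<in> Y (n * 0, n * 1) \<and> R x = x"
    by (rule periodic_translate[OF pq free]) (simp_all add: zero_prod_def)
  then obtain n B y where B: "n \<noteq> 0" "B \<in> Y (n * 0, n * 1)" "B y = y" by blast
  show False
  proof (rule no_free_commuting_pair[OF Y_lift[OF A(2)] Y_lift[OF B(2)] Y_commute[OF A(2) B(2)] A(3) B(3) pq(1)])
    fix i j :: int assume "i \<noteq> 0 \<or> j \<noteq> 0"
    then have "(i * m, j * n) \<noteq> 0" using A(1) B(1) by (simp add: zero_prod_def)
    moreover have "zpow A i \<circ> zpow B j \<in> Y (i * m, j * n)"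
      using Y_compose[OF zpow_Y[OF A(2), of i] zpow_Y[OF B(2), of j]] by simp
    ultimately have "(zpow A i \<circ> zpow B j) q \<le> p \<or> q \<le> (zpow A i \<circ> zpow B j) p" by (rule free)
    then show "zpow A i (zpow B j q) \<le> p \<or> q \<le> zpow A i (zpow B j p)" by simp
  qed
qed

end

section \<open>A piecewise-linear parametrization of the circle\<close>

text \<open>Of the finitely many polytopes covering \<open>P\<close>, those not containing \<open>g x\<close> stay away from it;
  so a short segment of \<open>g\<close> starting there lies in a single one of the others, by convexity.\<close>

lemma piecewise_linear_on_right_affine:
  fixes f :: "'a::euclidean_space \<Rightarrow> 'b::euclidean_space"
  assumes f: "piecewise_linear_on P f" and g: "right_affine g x"
    and e: "e > 0" and gP: "\<And>s. 0 \<le> s \<Longrightarrow> s \<le> e \<Longrightarrow> g (x + s) \<in> P"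
  shows "right_affine (\<lambda>y. f (g y)) x"
proof -
  obtain F where F: "finite F" "\<And>K. K \<in> F \<Longrightarrow> polytope K" "\<And>K. K \<in> F \<Longrightarrow> affine_map_on K f" "P = \<Union>F"
    using f by (auto simp: piecewise_linear_on_def)
  obtain d v where d: "d > 0" "\<forall>s\<in>{0..d}. g (x + s) = g x + s *\<^sub>R v"
    using g by (auto simp: right_affine_def)
  let ?C = "\<Union>{K \<in> F. g x \<notin> K}"
  have "closed ?C" using F by (intro closed_Union) (auto intro: compact_imp_closed polytope_imp_compact)
  then have "open (- ?C)" "g x \<in> - ?C" by (auto simp: open_Compl)
  then obtain r where r: "r > 0" "ball (g x) r \<subseteq> - ?C" by (meson open_contains_ball)
  define s1 where "s1 = Min {d, e, r / (2 * (norm v + 1))}"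
  have nv: "norm v + 1 > 0" by (simp add: add_nonneg_pos)
  have s1: "0 < s1" "s1 \<le> d" "s1 \<le> e" "s1 \<le> r / (2 * (norm v + 1))"
    using d(1) e r(1) nv by (simp_all add: s1_def)
  have "s1 * norm v < r"
  proof -
    have "s1 * (norm v + 1) \<le> r / 2" using s1(4) nv by (simp add: field_simps)
    then show ?thesis using s1(1) r(1) by (simp add: algebra_simps)
  qed
  then have "g x + s1 *\<^sub>R v \<in> ball (g x) r" using s1(1) by (simp add: dist_norm)
  moreover have end_eq: "g (x + s1) = g x + s1 *\<^sub>R v" using d(2) s1 by simp
  moreover have "g (x + s1) \<in> \<Union>F" using gP[of s1] s1 F(4) by simp
  ultimately obtain K where K: "K \<in> F" "g x + s1 *\<^sub>R v \<in> K" "g x + s1 *\<^sub>R v \<notin> ?C"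
    using r(2) by auto
  then have gxK: "g x \<in> K" by blast
  define w where "w = (1 / s1) *\<^sub>R (f (g x + s1 *\<^sub>R v) - f (g x))"
  show ?thesis
  proof (rule right_affineI[OF s1(1), of _ _ w])
    fix s assume s: "0 \<le> s" "s \<le> s1"
    define t where "t = s / s1"
    have t: "t \<in> {0..1}" "t * s1 = s" using s s1(1) by (auto simp: t_def)
    have "g (x + s) = g x + (t * s1) *\<^sub>R v" using d(2) s s1 t(2) by simp
    also have "\<dots> = (1 - t) *\<^sub>R g x + t *\<^sub>R (g x + s1 *\<^sub>R v)" by (simp add: algebra_simps)
    finally have "f (g (x + s)) = (1 - t) *\<^sub>R f (g x) + t *\<^sub>R f (g x + s1 *\<^sub>R v)"
      using F(3)[OF K(1)] K gxK t(1) by (simp add: affine_map_on_def)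
    also have "\<dots> = f (g x) + s *\<^sub>R w" using s1(1) by (simp add: w_def t_def algebra_simps)
    finally show "f (g (x + s)) = f (g x) + s *\<^sub>R w" .
  qed
qed

lemma right_affine_cong:
  assumes "right_affine g x" "e > 0" "\<And>s. 0 \<le> s \<Longrightarrow> s \<le> e \<Longrightarrow> f (x + s) = g (x + s)"
  shows "right_affine f x"
proof -
  obtain d v where d: "d > 0" "\<forall>s\<in>{0..d}. g (x + s) = g x + s *\<^sub>R v"
    using assms(1) by (auto simp: right_affine_def)
  show ?thesis
  proof (rule right_affineI[of "min d e" _ _ v])
    show "f (x + s) = f x + s *\<^sub>R v" if "0 \<le> s" "s \<le> min d e" for s
      using d(2) assms(3)[of s] assms(3)[of 0] assms(2) that by simp
  qed (use d(1) assms(2) in simp)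
qed

lemma right_affine_linear: "right_affine (\<lambda>y. a + (y - b) *\<^sub>R c) x"
  by (rule right_affineI[of 1 _ _ c]) (simp_all add: algebra_simps)

definition circle_parametrization :: "(real \<Rightarrow> 'a::real_vector) \<Rightarrow> 'a set \<Rightarrow> bool"
  where "circle_parametrization \<gamma> S \<longleftrightarrow> locally_pl \<gamma> \<and> range \<gamma> = S \<and>
    (\<forall>x y. \<gamma> x = \<gamma> y \<longleftrightarrow> (\<exists>k::int. x = y + of_int k))"

lemma reflect_across_involution:
  assumes "norm u = 1"
  shows "reflect_across p u (reflect_across p u x) = x"
proof -
  have "u \<bullet> u = 1" using assms by (simp add: dot_square_norm)
  moreover have "reflect_across p u x - p = (2 * ((x - p) \<bullet> u)) *\<^sub>R u - (x - p)"
    by (simp add: reflect_across_def)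
  ultimately have "(reflect_across p u x - p) \<bullet> u = (x - p) \<bullet> u"
    by (simp add: inner_diff_left)
  then show ?thesis unfolding reflect_across_def by simp
qed

lemma reflect_across_fixes_line:
  assumes "norm u = 1" "x \<in> line_through p u"
  shows "reflect_across p u x = x"
proof -
  obtain t where x: "x = p + t *\<^sub>R u" using assms(2) by (auto simp: line_through_def)
  then have t: "(x - p) \<bullet> u = t" using assms(1) by (simp add: dot_square_norm)
  have "(2 * t) *\<^sub>R u = t *\<^sub>R u + t *\<^sub>R u" by (simp flip: scaleR_left_distrib)
  then show ?thesis unfolding reflect_across_def t by (simp add: x)
qed

lemma right_affine_reflect_across:
  assumes "right_affine f x"
  shows "right_affine (\<lambda>y. reflect_across p u (f y)) x"
proof -
  obtain d v where d: "d > 0" "\<forall>s\<in>{0..d}. f (x + s) = f x + s *\<^sub>R v"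
    using assms by (auto simp: right_affine_def)
  show ?thesis
  proof (rule right_affineI[OF d(1), of _ _ "(2 * (v \<bullet> u)) *\<^sub>R u - v"])
    show "reflect_across p u (f (x + s)) = reflect_across p u (f x) + s *\<^sub>R ((2 * (v \<bullet> u)) *\<^sub>R u - v)"
      if "0 \<le> s" "s \<le> d" for s
    proof -
      have "f (x + s) = f x + s *\<^sub>R v" using d(2) that by simp
      moreover have "(f x + s *\<^sub>R v - p) \<bullet> u = (f x - p) \<bullet> u + s * (v \<bullet> u)"
        by (simp add: inner_diff_left inner_add_left)
      ultimately show ?thesis unfolding reflect_across_def by (simp add: scaleR_add_left scaleR_diff_right distrib_left)
    qed
  qed
qed

text \<open>Run through the arc \<open>\<phi>\<close> on the first half of each period and back through its mirror
  image on the second half. Then \<open>\<gamma> (- x)\<close> is the mirror image of \<open>\<gamma> x\<close>, which reduces germs on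
  the left to germs on the right.\<close>

lemma polyhedral_circle_parametrization:
  assumes "polyhedral_circle S"
  shows "\<exists>\<gamma>. circle_parametrization \<gamma> S"
proof -
  obtain p u and I :: "real set" and \<phi> \<psi> A where *: "norm u = 1 \<and> pl_polyhedron I \<and> I homeomorphic {0..1 :: real} \<and>
      homeomorphism I A \<phi> \<psi> \<and> piecewise_linear_on I \<phi> \<and> S = A \<union> reflect_across p u ` A \<and>
      A \<inter> reflect_across p u ` A = \<phi> ` frontier I \<and> \<phi> ` frontier I \<subseteq> line_through p u"
    using assms[unfolded polyhedral_circle_def, THEN conjunct2, THEN conjunct2]
    by (elim exE) (rule that)
  have u: "norm u = 1" and I: "I homeomorphic {0..1 :: real}" and hom: "homeomorphism I A \<phi> \<psi>"
    and pl: "piecewise_linear_on I \<phi>" and S: "S = A \<union> reflect_across p u ` A"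
    and meet: "A \<inter> reflect_across p u ` A = \<phi> ` frontier I"
    and line: "\<phi> ` frontier I \<subseteq> line_through p u"
    using * by blast+
  define R where "R = reflect_across p u"
  have RR: "R (R x) = x" for x using reflect_across_involution[OF u] by (simp add: R_def)
  have "compact I" "connected I"
    using homeomorphic_compactness[OF I] homeomorphic_connectedness[OF I] by simp_all
  then obtain \<alpha> \<beta> where I_eq: "I = {\<alpha>..\<beta>}" using connected_compact_interval_1[of I] by blast
  obtain f g where "homeomorphism I {0..1 :: real} f g" using I by (auto simp: homeomorphic_def)
  then have "f ` I = {0..1}" by (auto simp: homeomorphism_def)
  then have "infinite I" using infinite_Icc[of 0 "1 :: real"] by (metis finite_imageI zero_less_one)
  then have ab: "\<alpha> < \<beta>" unfolding I_eq by (metis finite.emptyI finite_insert infinite_Icc_iff)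
  define L where "L = \<beta> - \<alpha>"
  have L: "L > 0" "\<beta> = \<alpha> + L" using ab by (simp_all add: L_def)
  have fr: "frontier I = {\<alpha>, \<beta>}" unfolding I_eq frontier_def using ab by auto
  have Rends: "R (\<phi> \<alpha>) = \<phi> \<alpha>" "R (\<phi> \<beta>) = \<phi> \<beta>"
    using line reflect_across_fixes_line[OF u] unfolding fr R_def by blast+
  have A: "A = \<phi> ` I" and inj: "\<And>x y. x \<in> I \<Longrightarrow> y \<in> I \<Longrightarrow> \<phi> x = \<phi> y \<Longrightarrow> x = y"
    using hom unfolding homeomorphism_def by (blast, metis)
  define h where "h x = (if frac x \<le> 1/2 then \<alpha> + 2 * L * frac x else \<alpha> + 2 * L * (1 - frac x))" for x
  define \<gamma> where "\<gamma> x = (if frac x \<le> 1/2 then \<phi> (h x) else R (\<phi> (h x)))" for x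
  have hI: "h x \<in> I" for x
    using L frac_lt_1[of x] frac_ge_0[of x] by (auto simp: h_def I_eq L(2) algebra_simps)
  have gneg: "\<gamma> (- x) = R (\<gamma> x)" for x
  proof -
    consider "frac x = 0" | "0 < frac x" "frac x < 1/2" | "frac x = 1/2" | "1/2 < frac x"
      using frac_ge_0[of x] by linarith
    then show ?thesis
    proof cases
      case 1
      then have 0: "frac (- x) = 0" by (simp add: frac_neg)
      show ?thesis unfolding \<gamma>_def h_def 0 1 using Rends by simp
    next
      case 2
      then have "frac x \<noteq> 0" by linarith
      then have "frac (- x) = 1 - frac x" by (rule frac_non_zero)
      then show ?thesis using 2 by (simp add: \<gamma>_def h_def)
    next
      case 3
      then have "frac x \<noteq> 0" by linarith
      then have "frac (- x) = 1 - frac x" by (rule frac_non_zero)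
      then have 0: "frac (- x) = 1 / 2" using 3 by linarith
      show ?thesis unfolding \<gamma>_def h_def 0 3 using Rends L by simp
    next
      case 4
      then have "frac x \<noteq> 0" by linarith
      then have "frac (- x) = 1 - frac x" by (rule frac_non_zero)
      then show ?thesis using 4 RR by (simp add: \<gamma>_def h_def)
    qed
  qed
  have right: "right_affine \<gamma> x" for x
  proof (cases "frac x < 1/2")
    case True
    define e where "e = 1/2 - frac x"
    have e: "e > 0" using True by (simp add: e_def)
    have fr: "frac (x + s) = frac x + s" if "0 \<le> s" "s \<le> e" for s
      using that frac_ge_0[of x] unfolding frac_unique_iff e_def by (auto simp: frac_def)
    show ?thesis
    proof (rule right_affine_cong[OF _ e])
      show "right_affine (\<lambda>y. \<phi> ((\<alpha> + 2 * L * frac x) + (y - x) *\<^sub>R (2 * L))) x"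
      proof (rule piecewise_linear_on_right_affine[OF pl right_affine_linear e])
        fix s assume s: "0 \<le> s" "s \<le> e"
        have "frac x + s \<le> 1/2" using s by (simp add: e_def)
        then have "\<alpha> + 2 * L * frac x + (x + s - x) *\<^sub>R (2 * L) = h (x + s)"
          unfolding h_def fr[OF s] by (simp add: algebra_simps)
        then show "\<alpha> + 2 * L * frac x + (x + s - x) *\<^sub>R (2 * L) \<in> I" using hI by simp
      qed
    next
      fix s assume s: "0 \<le> s" "s \<le> e"
      then have "frac x + s \<le> 1/2" by (simp add: e_def)
      then show "\<gamma> (x + s) = \<phi> ((\<alpha> + 2 * L * frac x) + (x + s - x) *\<^sub>R (2 * L))"
        unfolding \<gamma>_def h_def fr[OF s] by (simp add: algebra_simps)
    qed
  next
    case False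
    define e where "e = (1 - frac x) / 2"
    have e: "e > 0" using frac_lt_1[of x] by (simp add: e_def)
    have fr: "frac (x + s) = frac x + s" if "0 \<le> s" "s \<le> e" for s
      using that frac_ge_0[of x] frac_lt_1[of x] unfolding frac_unique_iff e_def by (auto simp: frac_def)
    have val: "\<gamma> (x + s) = R (\<phi> ((\<alpha> + 2 * L * (1 - frac x)) + (x + s - x) *\<^sub>R (- 2 * L)))"
      and dom: "\<alpha> + 2 * L * (1 - frac x) + (x + s - x) *\<^sub>R (- 2 * L) \<in> I" if s: "0 \<le> s" "s \<le> e" for s
    proof -
      let ?z = "\<alpha> + 2 * L * (1 - frac x) + (x + s - x) *\<^sub>R (- 2 * L)"
      have z: "?z = \<alpha> + 2 * L * (1 - frac (x + s))" unfolding fr[OF s] by (simp add: algebra_simps)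
      show "\<gamma> (x + s) = R (\<phi> ?z)" and "?z \<in> I"
      proof -
        consider "frac (x + s) = 1/2" | "1/2 < frac (x + s)" using False s fr[OF s] by linarith
        then have "\<gamma> (x + s) = R (\<phi> ?z) \<and> ?z = h (x + s)"
        proof cases
          case 1
          show ?thesis unfolding z \<gamma>_def h_def 1 using Rends L by simp
        next
          case 2
          then show ?thesis unfolding z by (simp add: \<gamma>_def h_def)
        qed
        then show "\<gamma> (x + s) = R (\<phi> ?z)" and "?z \<in> I" using hI by auto
      qed
    qed
    show ?thesis
    proof (rule right_affine_cong[OF _ e])
      show "right_affine (\<lambda>y. R (\<phi> ((\<alpha> + 2 * L * (1 - frac x)) + (y - x) *\<^sub>R (- 2 * L)))) x"
        unfolding R_def
        by (intro right_affine_reflect_across piecewise_linear_on_right_affine[OF pl right_affine_linear e] dom)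
    qed (rule val)
  qed
  have left: "right_affine (\<lambda>y. \<gamma> (- y)) x" for x
    unfolding gneg unfolding R_def by (rule right_affine_reflect_across[OF right])
  have "range \<gamma> = S"
  proof
    show "range \<gamma> \<subseteq> S" using hI unfolding S A R_def[symmetric] by (auto simp: \<gamma>_def)
    have 1: "a \<in> range \<gamma>" if a: "a \<in> A" for a
    proof -
      obtain i where i: "a = \<phi> i" "\<alpha> \<le> i" "i \<le> \<beta>" using a by (auto simp: A I_eq)
      define x where "x = (i - \<alpha>) / (2 * L)"
      have "0 \<le> x" "x \<le> 1/2" using i L by (auto simp: x_def field_simps)
      then have "frac x = x" by (simp add: frac_eq)
      then have "\<gamma> x = a" using \<open>x \<le> 1/2\<close> L i(1) by (simp add: \<gamma>_def h_def x_def)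
      then show ?thesis by blast
    qed
    have 2: "R a \<in> range \<gamma>" if "a \<in> range \<gamma>" for a using that gneg by (metis rangeE rangeI)
    show "S \<subseteq> range \<gamma>" unfolding S R_def[symmetric] using 1 2 by blast
  qed
  moreover have "\<gamma> x = \<gamma> y \<longleftrightarrow> (\<exists>k::int. x = y + of_int k)" for x y
  proof
    assume eq: "\<gamma> x = \<gamma> y"
    have mixed: False if xy: "\<gamma> x = \<gamma> y" "frac x \<le> 1/2" "1/2 < frac y" for x y
    proof -
      have "\<phi> (h x) = R (\<phi> (h y))" using xy by (simp add: \<gamma>_def)
      then have "\<phi> (h x) \<in> \<phi> ` frontier I" unfolding meet[symmetric] R_def A using hI by blast
      then obtain e where e: "e \<in> {\<alpha>, \<beta>}" "\<phi> (h x) = \<phi> e" unfolding fr by blast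
      then have "\<phi> (h y) = \<phi> e" using \<open>\<phi> (h x) = R (\<phi> (h y))\<close> RR Rends by (metis empty_iff insert_iff)
      then have "h y = e" using e(1) hI ab by (intro inj) (auto simp: I_eq)
      moreover have "0 < L * (1 - frac y)" using L frac_lt_1[of y] by simp
      moreover have "2 * L * (1 - frac y) < L" using L xy(3) by (simp add: algebra_simps)
      ultimately show False using e(1) xy(3) L(2) by (auto simp: h_def)
    qed
    have "frac x = frac y"
    proof (cases "frac x \<le> 1/2"; cases "frac y \<le> 1/2")
      assume "frac x \<le> 1/2" "frac y \<le> 1/2"
      moreover from this have "h x = h y" using eq hI by (intro inj) (simp_all add: \<gamma>_def)
      ultimately show ?thesis using L by (simp add: h_def)
    next
      assume xy: "\<not> frac x \<le> 1/2" "\<not> frac y \<le> 1/2"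
      then have "R (R (\<phi> (h x))) = R (R (\<phi> (h y)))" using eq by (simp add: \<gamma>_def)
      then have "h x = h y" using hI RR by (intro inj) simp_all
      with xy show ?thesis using L by (simp add: h_def)
    qed (use mixed[of x y] mixed[of y x] eq in auto)
    then obtain k where "x = y + of_int k" by (rule frac_eqE)
    then show "\<exists>k::int. x = y + of_int k" by blast
  qed (auto simp: \<gamma>_def h_def)
  ultimately show ?thesis
    using right left by (intro exI[of _ \<gamma>]) (simp add: circle_parametrization_def locally_pl_def)
qed

section \<open>Lifting circle homeomorphisms\<close>

definition lifts :: "(real \<Rightarrow> 'a) \<Rightarrow> ('a \<Rightarrow> 'a) \<Rightarrow> (real \<Rightarrow> real) set"
  where "lifts \<gamma> f = {F \<in> lift_maps. \<forall>x. \<gamma> (F x) = f (\<gamma> x)}"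

lemma integer_valued_continuous_constant:
  fixes D :: "real \<Rightarrow> real"
  assumes "continuous_on UNIV D" "\<And>x. \<exists>k::int. D x = of_int k"
  shows "\<exists>k::int. \<forall>x. D x = of_int k"
proof -
  have "D constant_on UNIV"
  proof (rule continuous_discrete_range_constant[OF connected_UNIV assms(1)])
    fix x
    have "1 \<le> norm (D y - D x)" if ne: "D y \<noteq> D x" for y
    proof -
      obtain k l :: int where kl: "D y = of_int k" "D x = of_int l" using assms(2) by metis
      then have "1 \<le> \<bar>k - l\<bar>" using ne by auto
      then have "1 \<le> \<bar>of_int (k - l) :: real\<bar>" by linarith
      then show ?thesis using kl by simp
    qed
    then show "\<exists>e>0. \<forall>y. y \<in> UNIV \<and> D y \<noteq> D x \<longrightarrow> e \<le> norm (D y - D x)"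
      by (intro exI[of _ 1]) auto
  qed
  then show ?thesis using assms(2) by (metis UNIV_I constant_on_def)
qed

locale parametrized_circle =
  fixes \<gamma> :: "real \<Rightarrow> 'a::euclidean_space" and S
  assumes param: "circle_parametrization \<gamma> S"
begin

lemma gamma_pl: "locally_pl \<gamma>" and gamma_range: "range \<gamma> = S"
  and gamma_eq_iff: "\<gamma> x = \<gamma> y \<longleftrightarrow> (\<exists>k::int. x = y + of_int k)"
  using param by (auto simp: circle_parametrization_def)

lemma gamma_in: "\<gamma> x \<in> S"
  using gamma_range by blast

lemma gamma_add_int [simp]: "\<gamma> (x + of_int k) = \<gamma> x"
  using gamma_eq_iff by blast

lemma gamma_unit: "S = \<gamma> ` {0..1}"
proof
  show "S \<subseteq> \<gamma> ` {0..1}"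
  proof
    fix s assume "s \<in> S"
    then obtain x where "s = \<gamma> x" using gamma_range by blast
    then have "s = \<gamma> (x - of_int \<lfloor>x\<rfloor>)" using gamma_add_int[of x "- \<lfloor>x\<rfloor>"] by simp
    moreover have "x - of_int \<lfloor>x\<rfloor> \<in> {0..1}" by (simp; linarith)
    ultimately show "s \<in> \<gamma> ` {0..1}" by blast
  qed
qed (use gamma_in in blast)

text \<open>Continuity can be tested on closed sets because \<open>\<gamma>\<close> maps compact sets to closed sets.\<close>

lemma angle_function:
  obtains e :: "'a \<Rightarrow> complex" where "continuous_on S e" "\<And>x. e (\<gamma> x) = cis (2 * pi * x)"
proof -
  define e where "e s = cis (2 * pi * (SOME x. \<gamma> x = s))" for s
  have e: "e (\<gamma> x) = cis (2 * pi * x)" for x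
  proof -
    have "\<gamma> (SOME y. \<gamma> y = \<gamma> x) = \<gamma> x" by (rule someI) simp
    then obtain k :: int where "(SOME y. \<gamma> y = \<gamma> x) = x + of_int k" unfolding gamma_eq_iff by blast
    then have "e (\<gamma> x) = cis (2 * pi * x + 2 * pi * of_int k)" by (simp add: e_def distrib_left)
    also have "\<dots> = cis (2 * pi * x) * cis (2 * pi * of_int k)" by (rule cis_mult[symmetric])
    finally show ?thesis by simp
  qed
  have S: "closed S"
    unfolding gamma_unit using locally_pl_continuous_on[OF gamma_pl]
    by (intro compact_imp_closed compact_continuous_image) auto
  have "closed (e -` B \<inter> S)" if B: "closed B" for B
  proof -
    have "closed ((\<lambda>x. cis (2 * pi * x)) -` B \<inter> {0..1})"
      by (intro closed_vimage_Int B closed_atLeastAtMost continuous_on_cis continuous_intros)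
    then have "compact ({0..1} \<inter> ((\<lambda>x. cis (2 * pi * x)) -` B \<inter> {0..1}))"
      by (intro compact_Int_closed) auto
    then have "closed (\<gamma> ` ({0..1} \<inter> ((\<lambda>x. cis (2 * pi * x)) -` B \<inter> {0..1})))"
      using locally_pl_continuous_on[OF gamma_pl]
      by (intro compact_imp_closed compact_continuous_image)
    moreover have "e -` B \<inter> S = \<gamma> ` ({0..1} \<inter> ((\<lambda>x. cis (2 * pi * x)) -` B \<inter> {0..1}))"
      unfolding gamma_unit using e by auto
    ultimately show ?thesis by simp
  qed
  then have "continuous_on S e" using continuous_on_closed_vimage[OF S] by blast
  then show thesis using e by (rule that)
qed

text \<open>Lift the angle of \<open>f (\<gamma> x)\<close> to a continuous logarithm on the contractible line.\<close>

lemma continuous_lift: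
  assumes f: "continuous_on S f" "f ` S \<subseteq> S"
  shows "\<exists>F. continuous_on UNIV F \<and> (\<forall>x. \<gamma> (F x) = f (\<gamma> x))"
proof -
  obtain e where e: "continuous_on S e" "\<And>x. e (\<gamma> x) = cis (2 * pi * x)"
    using angle_function by metis
  have fg: "f (\<gamma> x) \<in> S" for x using f(2) gamma_in by blast
  have "continuous_on UNIV (\<lambda>x. f (\<gamma> x))"
    by (rule continuous_on_compose2[OF f(1) locally_pl_continuous_on[OF gamma_pl]]) (use gamma_in in blast)
  then have cont: "continuous_on UNIV (\<lambda>x. e (f (\<gamma> x)))"
    by (rule continuous_on_compose2[OF e(1)]) (use fg in blast)
  have unit: "norm (e (f (\<gamma> x))) = 1" for x
  proof -
    obtain y where "f (\<gamma> x) = \<gamma> y" using fg[of x] gamma_range by blast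
    then show ?thesis using e(2) by simp
  qed
  then have nz: "e (f (\<gamma> x)) \<noteq> 0" for x by (metis norm_zero zero_neq_one)
  have "contractible (UNIV :: real set)" by (rule convex_imp_contractible) simp
  then obtain g where g: "continuous_on UNIV g" "\<And>x. e (f (\<gamma> x)) = exp (g x)"
    using continuous_logarithm_on_contractible[OF cont _ nz] by (metis UNIV_I)
  define F where "F x = Im (g x) / (2 * pi)" for x
  have "continuous_on UNIV F" unfolding F_def using g(1) by (intro continuous_intros) auto
  moreover have "\<gamma> (F x) = f (\<gamma> x)" for x
  proof -
    have "exp (Re (g x)) = 1" using unit[of x] unfolding g(2) by simp
    then have "g x = \<i> * of_real (2 * pi * F x)" by (simp add: complex_eq_iff F_def)
    then have ex: "e (f (\<gamma> x)) = cis (2 * pi * F x)" unfolding g(2) by (simp add: cis_conv_exp)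
    obtain y where y: "f (\<gamma> x) = \<gamma> y" using fg[of x] gamma_range by blast
    then have "cis (2 * pi * y) = cis (2 * pi * F x)" using ex e(2) by simp
    then have "sin (2 * pi * y) = sin (2 * pi * F x) \<and> cos (2 * pi * y) = cos (2 * pi * F x)"
      by (simp add: complex_eq_iff)
    then obtain n :: int where "2 * pi * y = 2 * pi * F x + 2 * pi * of_int n"
      unfolding sin_cos_eq_iff by blast
    then have "2 * pi * y = 2 * pi * (F x + of_int n)" by (simp add: distrib_left)
    then have "y = F x + of_int n" by simp
    then show ?thesis unfolding y by simp
  qed
  ultimately show ?thesis by blast
qed

lemma lifts_differ_by_integer:
  fixes F G :: "real \<Rightarrow> real"
  assumes "continuous_on UNIV F" "continuous_on UNIV G" "\<And>x. \<gamma> (F x) = \<gamma> (G x)"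
  shows "\<exists>k::int. \<forall>x. F x = G x + of_int k"
proof -
  have "\<exists>k::int. F x - G x = of_int k" for x using assms(3)[of x] unfolding gamma_eq_iff by auto
  moreover have "continuous_on UNIV (\<lambda>x. F x - G x)" by (intro continuous_intros assms(1,2))
  ultimately have "\<exists>k::int. \<forall>x. F x - G x = of_int k"
    using integer_valued_continuous_constant[of "\<lambda>x. F x - G x"] by blast
  then show ?thesis by (metis add.commute diff_add_cancel)
qed

lemma pl_homeo_groupD:
  assumes "f \<in> carrier (pl_homeo_group S)"
  shows "f \<in> Bij S" "\<exists>g. homeomorphism S S f g" "piecewise_linear_on S f" "f \<in> extensional S"
    "s \<in> S \<Longrightarrow> f s \<in> S"
  using assms by (auto simp: pl_homeo_group_def homeo_group_def Bij_def bij_betw_def)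

lemma pl_homeo_group_mult_apply:
  assumes "f \<in> carrier (pl_homeo_group S)" "g \<in> carrier (pl_homeo_group S)" "s \<in> S"
  shows "(f \<otimes>\<^bsub>pl_homeo_group S\<^esub> g) s = f (g s)"
  using assms pl_homeo_groupD(1)[OF assms(1)] pl_homeo_groupD(1)[OF assms(2)]
  by (simp add: pl_homeo_group_def homeo_group_def BijGroup_def compose_eq)

lemma locally_pl_through_gamma:
  assumes "piecewise_linear_on S f"
  shows "locally_pl (\<lambda>x. f (\<gamma> x))"
  unfolding locally_pl_def
  using piecewise_linear_on_right_affine[OF assms, of _ _ 1] gamma_in locally_plD[OF gamma_pl]
  by (metis zero_less_one)

text \<open>A lift and a lift of the inverse are inverse to each other up to an integer translation.
  Hence a lift is strictly monotone and changes by \<open>\<plusminus>1\<close> over a period, and the square of a lift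
  is increasing.\<close>

lemma lifts_square_nonempty:
  assumes f: "f \<in> carrier (pl_homeo_group S)"
    and ff: "f \<otimes>\<^bsub>pl_homeo_group S\<^esub> f \<in> carrier (pl_homeo_group S)"
  shows "lifts \<gamma> (f \<otimes>\<^bsub>pl_homeo_group S\<^esub> f) \<noteq> {}"
proof -
  obtain g where g: "homeomorphism S S f g" using pl_homeo_groupD(2)[OF f] by blast
  have cont: "continuous_on S f" "f ` S \<subseteq> S" "continuous_on S g" "g ` S \<subseteq> S"
    and inv: "\<And>s. s \<in> S \<Longrightarrow> g (f s) = s"
    using g by (auto simp: homeomorphism_def)
  obtain F where F: "continuous_on UNIV F" "\<And>x. \<gamma> (F x) = f (\<gamma> x)"
    using continuous_lift[OF cont(1,2)] by blast
  obtain G where G: "continuous_on UNIV G" "\<And>x. \<gamma> (G x) = g (\<gamma> x)"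
    using continuous_lift[OF cont(3,4)] by blast
  have comp: "continuous_on UNIV (\<lambda>x. H (K x))" if "continuous_on UNIV H" "continuous_on UNIV K"
    for H K :: "real \<Rightarrow> real"
    by (rule continuous_on_compose2[OF that]) simp
  have sh: "continuous_on UNIV (\<lambda>x. H (x + 1))" if "continuous_on UNIV H" for H :: "real \<Rightarrow> real"
    by (intro comp[OF that] continuous_intros)
  have "\<gamma> (G (F x)) = \<gamma> x" for x using F(2) G(2) inv[OF gamma_in] by simp
  from lifts_differ_by_integer[OF comp[OF G(1) F(1)] continuous_on_id this]
  obtain k :: int where k: "\<And>x. G (F x) = x + of_int k" by blast
  have period: "\<gamma> (x + 1) = \<gamma> x" for x using gamma_add_int[of x 1] by simp
  have "\<gamma> (F (x + 1)) = \<gamma> (F x)" for x unfolding F(2) period ..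
  from lifts_differ_by_integer[OF sh[OF F(1)] F(1) this]
  obtain c :: int where c: "\<And>x. F (x + 1) = F x + of_int c" by blast
  have "\<gamma> (G (x + 1)) = \<gamma> (G x)" for x unfolding G(2) period ..
  from lifts_differ_by_integer[OF sh[OF G(1)] G(1) this]
  obtain d :: int where d: "\<And>x. G (x + 1) = G x + of_int d" by blast
  have ints: "H (x + of_int n) = H x + of_int (n * m)" if H: "\<And>x. H (x + 1) = H x + of_int m"
    for H :: "real \<Rightarrow> real" and x and n m :: int
  proof (induction n rule: int_induct[of _ 0])
    case (step1 i)
    then show ?case using H[of "x + of_int i"] by (simp add: algebra_simps)
  next
    case (step2 i)
    then show ?case using H[of "x + of_int i - 1"] by (simp add: algebra_simps)
  qed simp
  have "G (F 0) + 1 = G (F (0 + 1))" unfolding k by simp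
  also have "\<dots> = G (F 0) + of_int (c * d)" unfolding c using ints[where H = G and m = d, OF d] by simp
  finally have "of_int (c * d) = (1 :: real)" by simp
  then have "c * d = 1" by (simp only: of_int_eq_1_iff)
  then have cc: "c * c = 1" using zmult_eq_1_iff by auto
  have "inj F" using k by (metis add_right_cancel injI)
  then have "strict_mono_on UNIV F \<or> strict_antimono_on UNIV F"
    using injective_eq_monotone_map[of UNIV F] F(1) is_interval_univ by blast
  then have mono: "strict_mono (\<lambda>x. F (F x))" by (auto simp: monotone_on_def)
  have "F (F (x + 1)) = F (F x) + 1" for x using c[of x] ints[where H = F and m = c, OF c, of "F x" c] cc by simp
  moreover have sq: "\<gamma> (F (F x)) = (f \<otimes>\<^bsub>pl_homeo_group S\<^esub> f) (\<gamma> x)" for x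
    using F(2) pl_homeo_group_mult_apply[OF f f gamma_in] by simp
  moreover have "locally_pl (\<lambda>x. F (F x))"
  proof (rule locally_pl_cancel[OF gamma_pl _ mono])
    show "locally_pl (\<lambda>x. \<gamma> (F (F x)))"
      unfolding sq by (rule locally_pl_through_gamma[OF pl_homeo_groupD(3)[OF ff]])
    show "isCont (\<lambda>x. F (F x)) x" for x
      using comp[OF F(1) F(1)] by (simp add: continuous_on_eq_continuous_at)
    show "inj_on \<gamma> {x..x + 1/2}" for x
    proof (rule inj_onI)
      fix y z assume yz: "y \<in> {x..x + 1/2}" "z \<in> {x..x + 1/2}" "\<gamma> y = \<gamma> z"
      then obtain k :: int where k: "y = z + of_int k" unfolding gamma_eq_iff by blast
      then have "\<bar>of_int k :: real\<bar> < 1" using yz(1,2) by auto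
      then have "k = 0" by linarith
      with k show "y = z" by simp
    qed
  qed simp
  ultimately have "(\<lambda>x. F (F x)) \<in> lifts \<gamma> (f \<otimes>\<^bsub>pl_homeo_group S\<^esub> f)"
    using mono by (simp add: lifts_def lift_maps_def)
  then show ?thesis by blast
qed

lemma lifts_compose:
  assumes "f \<in> carrier (pl_homeo_group S)" "g \<in> carrier (pl_homeo_group S)" "F \<in> lifts \<gamma> f" "G \<in> lifts \<gamma> g"
  shows "F \<circ> G \<in> lifts \<gamma> (f \<otimes>\<^bsub>pl_homeo_group S\<^esub> g)"
  using assms pl_homeo_group_mult_apply[OF assms(1,2) gamma_in] by (simp add: lifts_def compose_lift_map)

lemma lifts_finv:
  assumes "group (pl_homeo_group S)" "f \<in> carrier (pl_homeo_group S)" "F \<in> lifts \<gamma> f"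
  shows "finv F \<in> lifts \<gamma> (inv\<^bsub>pl_homeo_group S\<^esub> f)"
proof -
  interpret group "pl_homeo_group S" by fact
  have F: "F \<in> lift_maps" "\<And>x. \<gamma> (F x) = f (\<gamma> x)" using assms(3) by (auto simp: lifts_def)
  have "inv\<^bsub>pl_homeo_group S\<^esub> f \<otimes>\<^bsub>pl_homeo_group S\<^esub> f = (\<lambda>x\<in>S. x)"
    using assms(2) l_inv by (simp add: pl_homeo_group_def homeo_group_def BijGroup_def)
  then have "(inv\<^bsub>pl_homeo_group S\<^esub> f) (f s) = s" if "s \<in> S" for s
    using pl_homeo_group_mult_apply[OF inv_closed[OF assms(2)] assms(2) that] that by simp
  then have "(inv\<^bsub>pl_homeo_group S\<^esub> f) (\<gamma> x) = \<gamma> (finv F x)" for x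
    using F(2)[of "finv F x"] F(1) gamma_in by (metis lift_map_inv(1))
  then show ?thesis using inv_lift_map[OF F(1)] by (simp add: lifts_def)
qed

lemma lifts_unique:
  assumes "F \<in> lifts \<gamma> f" "G \<in> lifts \<gamma> f"
  shows "\<exists>k::int. \<forall>x. F x = G x + of_int k"
  using assms by (intro lifts_differ_by_integer) (auto simp: lifts_def lift_mapsD(5))

lemma lifts_translate:
  assumes "F \<in> lifts \<gamma> f"
  shows "(\<lambda>x. F x + of_int k) \<in> lifts \<gamma> f"
  using assms compose_lift_map[OF translation_lift_map[of k], of F] by (simp add: lifts_def comp_def)

lemma lifts_id:
  assumes "f \<in> carrier (pl_homeo_group S)" "id \<in> lifts \<gamma> f"
  shows "f = \<one>\<^bsub>pl_homeo_group S\<^esub>"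
proof -
  have "f (\<gamma> x) = \<gamma> x" for x using assms(2) by (simp add: lifts_def)
  then have "f s = s" if "s \<in> S" for s using that gamma_range by (metis rangeE)
  then have "f = (\<lambda>x\<in>S. x)" using pl_homeo_groupD(4)[OF assms(1)]
    by (auto simp: fun_eq_iff extensional_def)
  then show ?thesis by (simp add: pl_homeo_group_def homeo_group_def BijGroup_def)
qed

end

section \<open>The wreath product\<close>

lemma ZW2_group: "group ZW2"
  unfolding ZW2_def by (intro group_restricted_wreath DirProd_group group_integer_group)

lemma ZW2_carrier: "(a, r) \<in> carrier ZW2 \<longleftrightarrow> finite {s. a s \<noteq> 0}"
  by (simp add: ZW2_def restricted_wreath_def carrier_sum_group DirProd_def)

lemma ZW2_mult: "(a, r) \<otimes>\<^bsub>ZW2\<^esub> (b, s) = (\<lambda>t. a t + b (t + r), r + s)"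
  by (simp add: ZW2_def restricted_wreath_def DirProd_def split_beta plus_prod_def restrict_def)

lemma ZW2_one: "\<one>\<^bsub>ZW2\<^esub> = (\<lambda>_. 0, 0)"
  by (simp add: ZW2_def restricted_wreath_def DirProd_def zero_prod_def restrict_def)

theorem theorem1p4:
  fixes S :: "(real ^ 2) set"
  assumes "polyhedral_circle S"
  shows "\<not> (\<exists>h \<in> hom ZW2 (pl_homeo_group S). inj_on h (carrier ZW2))"
proof
  assume "\<exists>h \<in> hom ZW2 (pl_homeo_group S). inj_on h (carrier ZW2)"
  then obtain h where h: "h \<in> hom ZW2 (pl_homeo_group S)" and inj: "inj_on h (carrier ZW2)" by blast
  obtain \<gamma> where "circle_parametrization \<gamma> S" using polyhedral_circle_parametrization[OF assms] by blast
  then interpret parametrized_circle \<gamma> S by unfold_locales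
  have P: "group (pl_homeo_group S)" using assms by (intro group_pl_homeo_group) (simp add: polyhedral_circle_def)
  interpret group_hom ZW2 "pl_homeo_group S" h
    using ZW2_group P h by (simp add: group_hom_def group_hom_axioms_def)
  \<comment> \<open>Squares of group elements, so that their images have increasing lifts.\<close>
  define base :: "(int \<times> int \<Rightarrow> int) \<Rightarrow> _" where "base b = (\<lambda>s. b s + b s, 0 :: int \<times> int)" for b
  define top :: "int \<times> int \<Rightarrow> _" where "top t = (\<lambda>_ :: int \<times> int. 0 :: int, t + t)" for t :: "int \<times> int"
  have fin2: "finite {s. b s + b s \<noteq> 0}" if "finite {s. b s \<noteq> 0}" for b :: "int \<times> int \<Rightarrow> int"
    by (rule finite_subset[OF _ that]) auto
  have base: "base b \<in> carrier ZW2" if "finite {s. b s \<noteq> 0}" for b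
    using fin2[OF that] by (simp add: base_def ZW2_carrier)
  have top: "top t \<in> carrier ZW2" for t by (simp add: top_def ZW2_carrier)
  have base_add: "base b \<otimes>\<^bsub>ZW2\<^esub> base c = base (\<lambda>s. b s + c s)" for b c
    by (simp add: base_def ZW2_mult fun_eq_iff)
  have top_add: "top s \<otimes>\<^bsub>ZW2\<^esub> top t = top (s + t)" for s t
    by (simp add: top_def ZW2_mult add_ac)
  have conj: "top t \<otimes>\<^bsub>ZW2\<^esub> base b \<otimes>\<^bsub>ZW2\<^esub> top (- t) = base (\<lambda>s. b (s + (t + t)))" for t b
    by (simp add: top_def base_def ZW2_mult fun_eq_iff)
  have zero: "base (\<lambda>_. 0) = \<one>\<^bsub>ZW2\<^esub>" "top 0 = \<one>\<^bsub>ZW2\<^esub>"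
    by (simp_all add: base_def top_def ZW2_one)
  have finm: "finite {s. - b s \<noteq> 0}" if "finite {s. b s \<noteq> 0}" for b :: "int \<times> int \<Rightarrow> int"
    using that by simp
  have base_inv: "inv\<^bsub>ZW2\<^esub> base b = base (\<lambda>s. - b s)" if "finite {s. b s \<noteq> 0}" for b
    by (rule G.inv_equality) (use base[OF that] base[OF finm[OF that]] zero in \<open>auto simp: base_add\<close>)
  have top_inv: "inv\<^bsub>ZW2\<^esub> top t = top (- t)" for t
    by (rule G.inv_equality) (use top zero in \<open>auto simp: top_add\<close>)
  have square: "lifts \<gamma> (h (x \<otimes>\<^bsub>ZW2\<^esub> x)) \<noteq> {}" if x: "x \<in> carrier ZW2" for x
    using lifts_square_nonempty[OF hom_closed[OF x]] x by simp
  interpret wreath_lifts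
    "\<lambda>b. {F. finite {s. b s \<noteq> 0} \<and> F \<in> lifts \<gamma> (h (base b))}" "\<lambda>t. lifts \<gamma> (h (top t))"
  proof
    fix b :: "int \<times> int \<Rightarrow> int" assume b: "finite {s. b s \<noteq> 0}"
    have "(b, 0) \<otimes>\<^bsub>ZW2\<^esub> (b, 0) = base b" by (simp add: base_def ZW2_mult)
    then show "{F. finite {s. b s \<noteq> 0} \<and> F \<in> lifts \<gamma> (h (base b))} \<noteq> {}"
      using square[of "(b, 0)"] b by (auto simp: ZW2_carrier)
  next
    fix F G b c
    assume "F \<in> {F. finite {s. b s \<noteq> 0} \<and> F \<in> lifts \<gamma> (h (base b))}"
      "G \<in> {F. finite {s. c s \<noteq> 0} \<and> F \<in> lifts \<gamma> (h (base c))}"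
    then have b: "finite {s. b s \<noteq> 0}" "F \<in> lifts \<gamma> (h (base b))"
      and c: "finite {s. c s \<noteq> 0}" "G \<in> lifts \<gamma> (h (base c))" by auto
    have "finite {s. b s + c s \<noteq> 0}" by (rule finite_subset[OF _ finite_UnI[OF b(1) c(1)]]) auto
    moreover have "F \<circ> G \<in> lifts \<gamma> (h (base b) \<otimes>\<^bsub>pl_homeo_group S\<^esub> h (base c))"
      by (intro lifts_compose hom_closed base b c)
    ultimately show "F \<circ> G \<in> {F. finite {s. b s + c s \<noteq> 0} \<and> F \<in> lifts \<gamma> (h (base (\<lambda>s. b s + c s)))}"
      using hom_mult[OF base[OF b(1)] base[OF c(1)]] by (simp add: base_add)
  next
    fix F b assume "F \<in> {F. finite {s. b s \<noteq> 0} \<and> F \<in> lifts \<gamma> (h (base b))}"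
    then have b: "finite {s. b s \<noteq> 0}" "F \<in> lifts \<gamma> (h (base b))" by auto
    have "finv F \<in> lifts \<gamma> (inv\<^bsub>pl_homeo_group S\<^esub> h (base b))"
      by (intro lifts_finv P hom_closed base b)
    then have "finv F \<in> lifts \<gamma> (h (base (\<lambda>s. - b s)))"
      using hom_inv[OF base[OF b(1)]] base_inv[OF b(1)] by simp
    with finm[OF b(1)] show "finv F \<in> {F. finite {s. - b s \<noteq> 0} \<and> F \<in> lifts \<gamma> (h (base (\<lambda>s. - b s)))}" by simp
  next
    fix b s assume "id \<in> {F. finite {s. b s \<noteq> 0} \<and> F \<in> lifts \<gamma> (h (base b))}"
    then have b: "finite {s. b s \<noteq> 0}" "id \<in> lifts \<gamma> (h (base b))" by auto
    then have "h (base b) = h \<one>\<^bsub>ZW2\<^esub>" using lifts_id[OF hom_closed[OF base[OF b(1)]]] by simp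
    then have "base b = \<one>\<^bsub>ZW2\<^esub>" by (rule inj_onD[OF inj]) (use base[OF b(1)] in auto)
    then show "b s = 0" by (cases s) (simp add: base_def ZW2_one fun_eq_iff)
  next
    fix t
    have "(\<lambda>_. 0, t) \<otimes>\<^bsub>ZW2\<^esub> (\<lambda>_. 0, t) = top t" by (simp add: top_def ZW2_mult)
    then show "lifts \<gamma> (h (top t)) \<noteq> {}" using square[of "(\<lambda>_. 0, t)"] by (auto simp: ZW2_carrier)
  next
    fix R s R' t assume "R \<in> lifts \<gamma> (h (top s))" "R' \<in> lifts \<gamma> (h (top t))"
    then have "R \<circ> R' \<in> lifts \<gamma> (h (top s) \<otimes>\<^bsub>pl_homeo_group S\<^esub> h (top t))"
      by (intro lifts_compose hom_closed top)
    then show "R \<circ> R' \<in> lifts \<gamma> (h (top (s + t)))"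
      using hom_mult[OF top top] by (simp add: top_add)
  next
    fix R t assume "R \<in> lifts \<gamma> (h (top t))"
    then have "finv R \<in> lifts \<gamma> (inv\<^bsub>pl_homeo_group S\<^esub> h (top t))"
      by (intro lifts_finv P hom_closed top)
    then show "finv R \<in> lifts \<gamma> (h (top (- t)))" using hom_inv[OF top] top_inv by simp
  next
    fix R t F b
    assume R: "R \<in> lifts \<gamma> (h (top t))"
      and "F \<in> {F. finite {s. b s \<noteq> 0} \<and> F \<in> lifts \<gamma> (h (base b))}"
    then have b: "finite {s. b s \<noteq> 0}" "F \<in> lifts \<gamma> (h (base b))" by auto
    have "finv R \<in> lifts \<gamma> (h (top (- t)))"
      using lifts_finv[OF P hom_closed[OF top] R] hom_inv[OF top] top_inv by simp
    then have "(R \<circ> F) \<circ> finv R \<in>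
        lifts \<gamma> (h (top t) \<otimes>\<^bsub>pl_homeo_group S\<^esub> h (base b) \<otimes>\<^bsub>pl_homeo_group S\<^esub> h (top (- t)))"
      by (intro lifts_compose R b H.m_closed hom_closed top base)
    moreover have "h (top t) \<otimes>\<^bsub>pl_homeo_group S\<^esub> h (base b) \<otimes>\<^bsub>pl_homeo_group S\<^esub> h (top (- t))
        = h (base (\<lambda>s. b (s + (t + t))))"
      using top base[OF b(1)] by (simp flip: hom_mult add: conj)
    moreover have "finite ((\<lambda>s. s + (t + t)) -` {s. b s \<noteq> 0})"
      using b(1) by (intro finite_vimageI) (auto simp: inj_def)
    ultimately show "R \<circ> F \<circ> finv R \<in> {F. finite {s. b (s + (t + t)) \<noteq> 0} \<and>
        F \<in> lifts \<gamma> (h (base (\<lambda>s. b (s + (t + t)))))}" by (simp add: vimage_def)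
  next
    fix R t k assume "R \<in> lifts \<gamma> (h (top t))"
    then show "(\<lambda>x. R x + of_int k) \<in> lifts \<gamma> (h (top t))" by (rule lifts_translate)
  next
    fix R R' t assume "R \<in> lifts \<gamma> (h (top t))" "R' \<in> lifts \<gamma> (h (top t))"
    then show "\<exists>k. \<forall>x. R x = R' x + of_int k" by (rule lifts_unique)
  next
    fix F G b assume "F \<in> {F. finite {s. b s \<noteq> 0} \<and> F \<in> lifts \<gamma> (h (base b))}"
      "G \<in> {F. finite {s. b s \<noteq> 0} \<and> F \<in> lifts \<gamma> (h (base b))}"
    then show "\<exists>k. \<forall>x. F x = G x + of_int k" using lifts_unique by blast
  qed (auto simp: lifts_def)
  show False by (rule no_wreath_lifts)
qed

end
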